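(* Let $n\geq 3$. There exists $\epsilon>0$ (depending only on $n$) such that the following holds: if $K\subset\mathbb{R}^n$ is an origin-symmetric convex body with $d_{BM}(B,K)<1+\epsilon$, where $B$ is the unit Euclidean ball, and if there is a constant $c$ such that $c\,\Gamma K=K$, where $\Gamma K$ is the centroid body of $K$, then $K$ is an ellipsoid.
   Context: A convex body in $\mathbb{R}^n$ is a compact convex subset with non-empty interior; it is origin-symmetric if $-x\in K$ whenever $x\in K$. The support function of a convex body $K$ is $h_K(\theta)=\max\{x\cdot\theta : x\in K\}$ for $\theta$ in the unit sphere $S^{n-1}=\{x\in\mathbb{R}^n:|x|=1\}$. For a scalar $c$, $cL=\{cx:x\in L\}$. The centroid body $\Gamma K$ of a convex body $K$ is the convex body with support function $$h_{\Gamma K}(\phi)=\frac{1}{\mathrm{vol}_n(K)}\int_K|\phi\cdot x|\,dx,\qquad \phi\in S^{n-1}.$$ The Banach-Mazur distance between origin-symmetric convex bodies $K,L\subset\mathbb{R}^n$ is $$d_{BM}(K,L)=\min\left\{\frac{1+\lambda}{1-\lambda}\geq 1 : (1-\lambda)K\subseteq TL\subseteq(1+\lambda)K \text{ for some } T\in GL_n(\mathbb{R})\right\},$$ so $d_{BM}(K,L)\ge 1$, with equality when $L$ is a linear image of $K$. An (origin-symmetric) ellipsoid is a set of the form $TB$ with $T\in GL_n(\mathbb{R})$. *)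

theory Defs
  imports "HOL-Analysis.Analysis"
begin

definition convex_body :: "'a::euclidean_space set \<Rightarrow> bool" where
  "convex_body K \<longleftrightarrow> compact K \<and> convex K \<and> interior K \<noteq> {}"

definition origin_symmetric :: "'a::euclidean_space set \<Rightarrow> bool" where
  "origin_symmetric K \<longleftrightarrow> (\<forall>x\<in>K. - x \<in> K)"

text \<open>For a convex body the supremum is a maximum. Only unit vectors \<open>\<theta>\<close> are relevant.\<close>
definition support_function :: "'a::euclidean_space set \<Rightarrow> 'a \<Rightarrow> real" where
  "support_function K \<theta> = (SUP x\<in>K. x \<bullet> \<theta>)"

definition centroid_body :: "'a::euclidean_space set \<Rightarrow> 'a set" where
  "centroid_body K = (THE C. convex_body C \<and>
     (\<forall>\<phi>\<in>sphere 0 1. support_function C \<phi> =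
        1 / measure lborel K * (LINT x:K|lborel. \<bar>\<phi> \<bullet> x\<bar>)))"

text \<open>
  The set of admissible values is non-empty and has a least element when \<open>K\<close> and \<open>L\<close> are
  origin-symmetric convex bodies, so that the infimum is the minimum. The constraint
  \<open>(1 + l) / (1 - l) \<ge> 1\<close> is equivalent to \<open>0 \<le> l < 1\<close>; the value \<open>l = 1\<close> is excluded
  because division by zero yields zero.
\<close>
definition banach_mazur_distance :: "(real^'n) set \<Rightarrow> (real^'n) set \<Rightarrow> real" where
  "banach_mazur_distance K L =
     Inf {(1 + l) / (1 - l) | l. (1 + l) / (1 - l) \<ge> 1 \<and>
       (\<exists>T :: real^'n^'n. invertible T \<and>
          (*\<^sub>R) (1 - l) ` K \<subseteq> (*v) T ` L \<and> (*v) T ` L \<subseteq> (*\<^sub>R) (1 + l) ` K)}"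

definition ellipsoid :: "(real^'n) set \<Rightarrow> bool" where
  "ellipsoid E \<longleftrightarrow> (\<exists>T :: real^'n^'n. invertible T \<and> E = (*v) T ` cball 0 1)"


text \<open>The centroid body of a convex body is well defined.\<close>

lemma support_function_le_imp_subset:
  fixes C D :: "'a::euclidean_space set"
  assumes C: "compact C" "C \<noteq> {}" and D: "compact D" "convex D" "D \<noteq> {}"
    and le: "\<And>u. norm u = 1 \<Longrightarrow> support_function C u \<le> support_function D u"
  shows "C \<subseteq> D"
proof (rule ccontr)
  assume "\<not> C \<subseteq> D"
  then obtain z where z: "z \<in> C" "z \<notin> D" by auto
  obtain a b where ab: "a \<bullet> z < b" "\<And>x. x \<in> D \<Longrightarrow> b < a \<bullet> x"
    using separating_hyperplane_closed_point[OF D(2) compact_imp_closed[OF D(1)] z(2)] by auto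
  have a0: "a \<noteq> 0" using ab D(3) by force
  define u where "u = - (1 / norm a) *\<^sub>R a"
  have nu: "norm u = 1" using a0 by (simp add: u_def)
  have "support_function D u \<le> - (b / norm a)" unfolding support_function_def
  proof (rule cSUP_least[OF D(3)])
    fix x assume "x \<in> D"
    then have "b / norm a \<le> (a \<bullet> x) / norm a" using ab(2) a0
      by (intro divide_right_mono) (auto intro: less_imp_le)
    then show "x \<bullet> u \<le> - (b / norm a)" by (simp add: u_def inner_commute)
  qed
  moreover have "z \<bullet> u \<le> support_function C u" unfolding support_function_def
  proof (rule cSUP_upper[OF z(1)])
    have "compact ((\<lambda>x. x \<bullet> u) ` C)"
      by (intro compact_continuous_image C continuous_intros)
    then show "bdd_above ((\<lambda>x. x \<bullet> u) ` C)" by (simp add: bounded_imp_bdd_above compact_imp_bounded)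
  qed
  moreover have "(a \<bullet> z) / norm a < b / norm a" using ab(1) a0 by (simp add: divide_strict_right_mono)
  then have "z \<bullet> u > - (b / norm a)" by (simp add: u_def inner_commute)
  ultimately show False using le[OF nu] by linarith
qed

lemma centroid_body_ex1:
  fixes K :: "'a::euclidean_space set"
  assumes "convex_body K"
  shows "\<exists>!C. convex_body C \<and>
     (\<forall>\<phi>\<in>sphere 0 1. support_function C \<phi> =
        1 / measure lborel K * (LINT x:K|lborel. \<bar>\<phi> \<bullet> x\<bar>))"
proof -
  have K: "compact K" "convex K" "interior K \<noteq> {}" using assms by (auto simp: convex_body_def)
  have Kb[measurable]: "K \<in> sets borel" using K(1) borel_compact by blast
  have Kf: "emeasure lborel K < \<infinity>" using K(1) by (rule emeasure_compact_finite)
  define \<mu> where "\<mu> = measure lborel K"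
  have nn: "\<not> negligible K" using K(3) open_not_negligible[of "interior K"]
      negligible_subset[of K "interior K"] interior_subset by auto
  have "emeasure lborel K \<noteq> 0"
  proof
    assume "emeasure lborel K = 0"
    then have "K \<in> null_sets lebesgue" by (intro null_sets_completionI) (auto simp: null_sets_def)
    then show False using nn by (simp add: negligible_iff_null_sets)
  qed
  then have mu: "\<mu> > 0" using Kf
    by (simp add: \<mu>_def measure_def enn2real_positive_iff zero_less_iff_neq_zero)
  obtain R where R: "R > 0" "\<And>x. x \<in> K \<Longrightarrow> norm x \<le> R"
    using compact_imp_bounded[OF K(1)] bounded_pos by blast
  define h where "h a = 1 / \<mu> * (LINT x:K|lborel. \<bar>a \<bullet> x\<bar>)" for a :: 'a
  define G where "G = {g :: 'a \<Rightarrow> real. g \<in> borel_measurable borel \<and> (\<forall>x. \<bar>g x\<bar> \<le> 1)}"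
  define m where "m g = (1 / \<mu>) *\<^sub>R (LINT x:K|lborel. g x *\<^sub>R x)" for g :: "'a \<Rightarrow> real"
  define C where "C = closure (m ` G)"
  have int: "set_integrable lborel K (\<lambda>x. g x *\<^sub>R x)" if "g \<in> G" for g
    unfolding set_integrable_def
  proof (rule integrableI_bounded_set[where A=K and B=R])
    have [measurable]: "g \<in> borel_measurable borel" using that by (simp add: G_def)
    show "(\<lambda>x. indicator K x *\<^sub>R g x *\<^sub>R x) \<in> borel_measurable lborel" by measurable
    have "norm (g x *\<^sub>R x) \<le> R" if "x \<in> K" for x
      using mult_mono[of "\<bar>g x\<bar>" 1 "norm x" R] R \<open>g \<in> G\<close> that by (auto simp: G_def)
    then show "AE x in lborel. x \<in> K \<longrightarrow> norm (indicator K x *\<^sub>R g x *\<^sub>R x) \<le> R" by auto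
    show "AE x in lborel. x \<notin> K \<longrightarrow> indicator K x *\<^sub>R g x *\<^sub>R x = 0" by auto
  qed (use Kf in auto)
  have intabs: "set_integrable lborel K (\<lambda>x. \<bar>a \<bullet> x\<bar>)" for a :: 'a
    using K(1) by (intro borel_integrable_compact[unfolded set_integrable_def[symmetric]]
        continuous_intros) (auto simp: set_integrable_def)
  have inner: "m g \<bullet> a = 1 / \<mu> * (LINT x:K|lborel. g x * (a \<bullet> x))" 
    and intin: "set_integrable lborel K (\<lambda>x. g x * (a \<bullet> x))" if "g \<in> G" for g a
  proof -
    have *: "integrable lborel (\<lambda>x. indicator K x *\<^sub>R g x *\<^sub>R x)"
      using int[OF that] by (simp add: set_integrable_def)
    have eq: "(indicator K x *\<^sub>R g x *\<^sub>R x) \<bullet> a = indicator K x *\<^sub>R (g x * (a \<bullet> x))" for x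
      by (simp add: inner_commute)
    show "set_integrable lborel K (\<lambda>x. g x * (a \<bullet> x))"
      using integrable_inner_left[of a, OF *] unfolding eq set_integrable_def .
    show "m g \<bullet> a = 1 / \<mu> * (LINT x:K|lborel. g x * (a \<bullet> x))"
      using integral_inner_left[of a, OF *] unfolding eq
      by (simp add: m_def set_lebesgue_integral_def)
  qed
  have ub: "m g \<bullet> a \<le> h a" if "g \<in> G" for g a
  proof -
    have "(LINT x:K|lborel. g x * (a \<bullet> x)) \<le> (LINT x:K|lborel. \<bar>a \<bullet> x\<bar>)"
    proof (rule set_integral_mono[OF intin[OF that] intabs])
      fix x
      have "g x * (a \<bullet> x) \<le> \<bar>g x\<bar> * \<bar>a \<bullet> x\<bar>" by (metis abs_ge_self abs_mult)
      also have "\<dots> \<le> 1 * \<bar>a \<bullet> x\<bar>" using that by (intro mult_right_mono) (auto simp: G_def)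
      finally show "g x * (a \<bullet> x) \<le> \<bar>a \<bullet> x\<bar>" by simp
    qed
    then show ?thesis using mu by (simp add: inner[OF that] h_def divide_right_mono)
  qed
  have sG: "(\<lambda>x. sgn (a \<bullet> x)) \<in> G" for a :: 'a
    by (auto simp: G_def abs_sgn_eq)
  have att: "m (\<lambda>x. sgn (a \<bullet> x)) \<bullet> a = h a" for a
  proof -
    have "sgn (a \<bullet> x) * (a \<bullet> x) = \<bar>a \<bullet> x\<bar>" for x by (simp add: sgn_real_def)
    then show ?thesis unfolding inner[OF sG] h_def by simp
  qed
  have conv: "convex (m ` G)"
  proof (rule convexI)
    fix p q :: 'a and u v :: real
    assume "p \<in> m ` G" "q \<in> m ` G" and uv: "0 \<le> u" "0 \<le> v" "u + v = 1"
    then obtain f g where fg: "f \<in> G" "g \<in> G" "p = m f" "q = m g" by auto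
    let ?k = "\<lambda>x. u * f x + v * g x"
    have "\<bar>?k x\<bar> \<le> 1" for x
    proof -
      have "\<bar>?k x\<bar> \<le> u * \<bar>f x\<bar> + v * \<bar>g x\<bar>"
        using uv abs_triangle_ineq[of "u * f x" "v * g x"] by (simp add: abs_mult)
      also have "\<dots> \<le> u * 1 + v * 1"
        using uv fg by (intro add_mono mult_left_mono) (auto simp: G_def)
      finally show ?thesis using uv by simp
    qed
    moreover have "?k \<in> borel_measurable borel"
    proof -
      have [measurable]: "f \<in> borel_measurable borel" "g \<in> borel_measurable borel"
        using fg(1,2) by (simp_all add: G_def)
      show ?thesis by measurable
    qed
    ultimately have kG: "?k \<in> G" by (simp add: G_def)
    have i: "set_integrable lborel K (\<lambda>x. u *\<^sub>R (f x *\<^sub>R x))"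
        "set_integrable lborel K (\<lambda>x. v *\<^sub>R (g x *\<^sub>R x))"
      by (rule set_integrable_scaleR_right, rule int[OF fg(1)], rule set_integrable_scaleR_right, rule int[OF fg(2)])
    have "m ?k = (1 / \<mu>) *\<^sub>R (LINT x:K|lborel. u *\<^sub>R (f x *\<^sub>R x) + v *\<^sub>R (g x *\<^sub>R x))"
      unfolding m_def scaleR_left_distrib scaleR_scaleR ..
    also have "\<dots> = u *\<^sub>R m f + v *\<^sub>R m g"
      unfolding set_integral_add(2)[OF i] set_integral_scaleR_right m_def
      by (simp only: scaleR_right_distrib scaleR_left_commute)
    finally show "u *\<^sub>R p + v *\<^sub>R q \<in> m ` G"
      unfolding fg(3,4) using imageI[OF kG, of m] by (simp only:)
  qed
  have hK: "h a \<le> norm a * R" for a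
  proof -
    have "(LINT x:K|lborel. \<bar>a \<bullet> x\<bar>) \<le> (LINT x:K|lborel. norm a * R)"
    proof (rule set_integral_mono[OF intabs])
      show "set_integrable lborel K (\<lambda>x. norm a * R)" using Kf by (simp add: set_integrable_def)
      fix x assume "x \<in> K"
      then show "\<bar>a \<bullet> x\<bar> \<le> norm a * R"
        using Cauchy_Schwarz_ineq2[of a x] R(2)[of x] mult_left_mono[of "norm x" R "norm a"] by force
    qed
    also have "\<dots> = \<mu> * (norm a * R)" by (simp add: set_lebesgue_integral_def \<mu>_def)
    finally show ?thesis using mu by (simp add: h_def field_simps)
  qed
  have bnd: "bounded (m ` G)"
  proof (rule boundedI)
    fix p assume "p \<in> m ` G"
    then obtain g where "g \<in> G" "p = m g" by auto
    then have "p \<bullet> p \<le> norm p * R" using order_trans[OF ub[of g p] hK[of p]] by simp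
    then have "norm p * norm p \<le> norm p * R" by (simp add: dot_square_norm power2_eq_square)
    then show "norm p \<le> R" using R(1) by (cases "p = 0") auto
  qed
  have hpos: "h a > 0" if "a \<noteq> 0" for a
  proof (rule ccontr)
    assume "\<not> h a > 0"
    moreover have "(LINT x:K|lborel. \<bar>a \<bullet> x\<bar>) \<ge> 0"
      by (auto simp: set_lebesgue_integral_def intro!: integral_nonneg_AE)
    ultimately have "(LINT x:K|lborel. \<bar>a \<bullet> x\<bar>) = 0"
      using mu by (auto simp: h_def zero_less_divide_iff)
    then have "AE x in lborel. indicator K x *\<^sub>R \<bar>a \<bullet> x\<bar> = (0::real)"
      using intabs[of a] unfolding set_lebesgue_integral_def set_integrable_def
      by (subst (asm) integral_nonneg_eq_0_iff_AE) auto
    then have "AE x in lborel. x \<notin> K - {x. a \<bullet> x = 0}" by (auto simp: indicator_def elim!: eventually_mono)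
    moreover have "K - {x. a \<bullet> x = 0} \<in> sets lborel"
      using borel_closed[OF closed_hyperplane[of a 0]] by auto
    ultimately have "K - {x. a \<bullet> x = 0} \<in> null_sets lborel"
      by (simp add: AE_iff_null_sets)
    then have "negligible (K - {x. a \<bullet> x = 0})"
      by (simp add: negligible_iff_null_sets null_sets_completionI)
    moreover have "negligible {x. a \<bullet> x = 0}" using that by (simp add: negligible_hyperplane)
    ultimately have "negligible ((K - {x. a \<bullet> x = 0}) \<union> {x. a \<bullet> x = 0})" by (rule negligible_Un)
    then have "negligible K" by (rule negligible_subset) auto
    then show False using nn by simp
  qed
  have GC: "m g \<in> C" if "g \<in> G" for g unfolding C_def by (rule subsetD[OF closure_subset imageI[OF that]])
  have cC: "compact C" unfolding C_def using bnd by simp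
  have vC: "convex C" unfolding C_def using conv by (rule convex_closure)
  have "interior C \<noteq> {}"
  proof
    assume "interior C = {}"
    then obtain a b where ab: "a \<noteq> 0" "C \<subseteq> {x. a \<bullet> x = b}"
      using empty_interior_subset_hyperplane[OF vC] by metis
    have "(\<lambda>x. 0) \<in> G" by (simp add: G_def)
    from GC[OF this] have "b = 0" using ab(2) by (auto simp: m_def set_lebesgue_integral_def)
    moreover have "m (\<lambda>x. sgn (a \<bullet> x)) \<bullet> a = b"
      using GC[OF sG[of a]] ab(2) by (auto simp: inner_commute)
    ultimately show False using att[of a] hpos[OF ab(1)] by simp
  qed
  moreover have sC: "support_function C a = h a" for a
    unfolding support_function_def
  proof (rule cSup_eq_maximum)
    show "h a \<in> (\<lambda>x. x \<bullet> a) ` C" using att[of a] GC[OF sG[of a]] by (metis imageI)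
    have "C \<subseteq> {x. a \<bullet> x \<le> h a}" unfolding C_def
      using ub by (intro closure_minimal closed_halfspace_le) (auto simp: inner_commute)
    then show "p \<le> h a" if "p \<in> (\<lambda>x. x \<bullet> a) ` C" for p using that by (auto simp: inner_commute)
  qed
  ultimately have ex: "convex_body C" using cC vC by (simp add: convex_body_def)
  show ?thesis
  proof (rule ex1I[of _ C])
    show "convex_body C \<and> (\<forall>\<phi>\<in>sphere 0 1. support_function C \<phi> =
        1 / measure lborel K * (LINT x:K|lborel. \<bar>\<phi> \<bullet> x\<bar>))"
      using ex sC by (simp add: h_def \<mu>_def)
    fix D assume D: "convex_body D \<and> (\<forall>\<phi>\<in>sphere 0 1. support_function D \<phi> =
        1 / measure lborel K * (LINT x:K|lborel. \<bar>\<phi> \<bullet> x\<bar>))"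
    then have eq: "support_function D u = support_function C u" if "norm u = 1" for u
      using that sC by (simp add: h_def \<mu>_def)
    have "D \<noteq> {}" "compact D" "convex D" "C \<noteq> {}"
      using D ex interior_subset by (auto simp: convex_body_def)
    then show "D = C"
      using support_function_le_imp_subset[of D C] support_function_le_imp_subset[of C D] eq cC vC
      by (simp add: subset_antisym)
  qed
qed

end

theory Submission
  imports Defs "HOL-Probability.Distributions" "HOL-Complex_Analysis.Great_Picard"
begin

text \<open>
  The fixed point equation is invariant under linear maps, so \<open>K\<close> may be assumed isotropic, of mean
  half-width one and close to the ball. In polar coordinates it says that the support function \<open>h\<close> is
  proportional to the cosine transform of \<open>\<rho>\<^sup>n\<^sup>+\<^sup>1\<close>, where \<open>\<rho>\<close> is the radial function. The cosine
  transform makes \<open>h\<close> Lipschitz with constant \<open>O(s)\<close>, \<open>s = max \<bar>h - 1\<bar>\<close>, and convexity then gives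
  \<open>h - \<rho> = O(s\<^sup>2)\<close>. Hence \<open>f = h - 1\<close> satisfies the linearized equation \<open>f = (n + 1) C f\<close>, with \<open>C\<close> the normalized
  cosine transform, up to \<open>O(s\<^sup>2)\<close>, and its components of degree zero and two are \<open>0\<close> and \<open>O(s\<^sup>2)\<close>.

  For the linearized equation no spherical harmonics are needed: \<open>C\<close> maps \<open>(a \<bullet> x)\<^sup>2\<^sup>p\<close> to a polynomial in
  \<open>a \<bullet> x\<close> with leading coefficient \<open>\<lambda>\<close>, \<open>(n + 1) \<bar>\<lambda>\<bar> < 1\<close> for \<open>p \<ge> 2\<close>. As \<open>C\<close> is symmetric, the moments
  of a solution against \<open>(a \<bullet> x)\<^sup>2\<^sup>p\<close> vanish inductively, and these determine an even function. By compactness of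
  \<open>C\<close> the uniqueness is stable, so \<open>s = O(s\<^sup>2)\<close>, which forces \<open>s = 0\<close> when \<open>s\<close> is small.
\<close>

section \<open>Uniform measure on the sphere and polar coordinates\<close>

text \<open>The critical degree of the linearized equation is two: (n + 1) times the multiplier of
  the normalized cosine transform is n + 1 on constants, exactly 1 in degree two, and below 1 in
  absolute value from degree four on. The eigenvalue 1 is unavoidable, since the linear images of
  the ball are solutions and their tangent directions at the ball are the quadratic forms. The two
  normalizations answer exactly these obstructions: mean half-width one removes the constants,
  isotropy makes the degree-two part second order. The other obstacle is that the equation links h
  to a power of \<rho>. A bound \<bar>h - 1\<bar> \<le> s alone gives only h - \<rho> = O(s), of the
  same order as the terms to be kept. The gap is controlled by the square of the slope of h, so the
  equation itself must first improve the slope to O(s). The number n + 1 arises in polar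
  coordinates: \<bar>\<phi> \<bullet> x\<bar> contributes one power of r beside the weight of order
  n - 1, the radial integral is a multiple of the power n + 1 of \<rho>, and that power has
  derivative n + 1 at \<rho> = 1.\<close>

lemma ball_sets_borel [measurable]: "ball (x::'a::metric_space) e \<in> sets borel"
  by simp

lemma ennreal_unit_ball_vol_neq_0 [simp]: "ennreal (unit_ball_vol (real n)) \<noteq> 0"
proof -
  have "unit_ball_vol (real n) > 0" by simp
  then show ?thesis by (simp only: ennreal_eq_0_iff not_le)
qed

section \<open>Linear changes of variables for Lebesgue measure\<close>

lemma borel_measurable_linear:
  fixes T :: "'a::euclidean_space \<Rightarrow> 'b::real_normed_vector"
  assumes "linear T"
  shows "T \<in> borel_measurable borel"
  using assms by (intro borel_measurable_continuous_onI linear_continuous_on linear_linear[THEN iffD2])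

lemma nn_integral_lborel_shift:
  fixes g :: "'a::euclidean_space \<Rightarrow> ennreal"
  assumes [measurable]: "g \<in> borel_measurable borel"
  shows "(\<integral>\<^sup>+x. g (x + t) \<partial>lborel) = (\<integral>\<^sup>+x. g x \<partial>lborel)"
proof -
  have "(\<integral>\<^sup>+x. g x \<partial>lborel) = (\<integral>\<^sup>+x. g x \<partial>(distr lborel borel ((+) t)))"
    by (simp add: lborel_distr_plus)
  also have "\<dots> = (\<integral>\<^sup>+x. g (t + x) \<partial>lborel)" by (subst nn_integral_distr) auto
  finally show ?thesis by (simp add: add.commute)
qed

lemma nn_integral_lborel_scaleR:
  fixes g :: "'a::euclidean_space \<Rightarrow> ennreal"
  assumes [measurable]: "g \<in> borel_measurable borel" and c: "c \<noteq> 0"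
  shows "(\<integral>\<^sup>+x. g x \<partial>lborel) = ennreal (\<bar>c\<bar> ^ DIM('a)) * (\<integral>\<^sup>+x. g (c *\<^sub>R x) \<partial>lborel)"
proof -
  have "(\<integral>\<^sup>+x. g x \<partial>lborel) =
    (\<integral>\<^sup>+x. g x \<partial>density (distr lborel borel (\<lambda>x. 0 + c *\<^sub>R x)) (\<lambda>_. \<bar>c\<bar>^DIM('a)))"
    using lborel_affine[OF c, of "0::'a"] by simp
  also have "\<dots> = ennreal (\<bar>c\<bar> ^ DIM('a)) * (\<integral>\<^sup>+x. g (c *\<^sub>R x) \<partial>lborel)"
    by (simp add: nn_integral_density nn_integral_distr nn_integral_cmult)
  finally show ?thesis .
qed

text \<open>Uniqueness of Haar measure: integrate \<open>g (T x + y)\<close> over \<open>y\<close> in the unit ball and use the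
  translation invariance of Lebesgue measure in both variables.\<close>
lemma nn_integral_lborel_linear_aux:
  fixes T :: "'a::euclidean_space \<Rightarrow> 'a" and g :: "'a \<Rightarrow> ennreal"
  assumes T: "linear T" "bij T" and [measurable]: "g \<in> borel_measurable borel"
  shows "emeasure lborel (ball (0::'a) 1) * (\<integral>\<^sup>+x. g (T x) \<partial>lborel) =
    emeasure lborel (T -` ball 0 1) * (\<integral>\<^sup>+x. g x \<partial>lborel)"
proof -
  let ?b = "indicator (ball (0::'a) 1) :: 'a \<Rightarrow> ennreal"
  note [measurable] = borel_measurable_linear[OF T(1)]
  have TI: "T (x + inv T y) = T x + y" for x y
    using T by (simp add: linear_add bij_is_surj surj_f_inv_f)
  have "emeasure lborel (ball (0::'a) 1) * (\<integral>\<^sup>+x. g (T x) \<partial>lborel) =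
      (\<integral>\<^sup>+y. ?b y * (\<integral>\<^sup>+x. g (T x) \<partial>lborel) \<partial>lborel)"
    using nn_integral_multc[of ?b lborel "\<integral>\<^sup>+x. g (T x) \<partial>lborel"] by simp
  also have "\<dots> = (\<integral>\<^sup>+y. ?b y * (\<integral>\<^sup>+x. g (T x + y) \<partial>lborel) \<partial>lborel)"
    using nn_integral_lborel_shift[of "\<lambda>x. g (T x)", symmetric] by (simp add: TI[symmetric])
  also have "\<dots> = (\<integral>\<^sup>+y. (\<integral>\<^sup>+x. ?b y * g (T x + y) \<partial>lborel) \<partial>lborel)"
    by (intro nn_integral_cong nn_integral_cmult[symmetric]) measurable
  also have "\<dots> = (\<integral>\<^sup>+x. (\<integral>\<^sup>+y. ?b y * g (T x + y) \<partial>lborel) \<partial>lborel)"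
    by (rule lborel_pair.Fubini') measurable
  also have "\<dots> = (\<integral>\<^sup>+x. (\<integral>\<^sup>+y. ?b (y - T x) * g y \<partial>lborel) \<partial>lborel)"
  proof (rule nn_integral_cong)
    fix x
    show "(\<integral>\<^sup>+y. ?b y * g (T x + y) \<partial>lborel) = (\<integral>\<^sup>+y. ?b (y - T x) * g y \<partial>lborel)"
      using nn_integral_lborel_shift[of "\<lambda>y. ?b y * g (T x + y)" "- T x"] by simp
  qed
  also have "\<dots> = (\<integral>\<^sup>+y. (\<integral>\<^sup>+x. ?b (y - T x) * g y \<partial>lborel) \<partial>lborel)"
    by (rule lborel_pair.Fubini') measurable
  also have "\<dots> = (\<integral>\<^sup>+y. emeasure lborel (T -` ball 0 1) * g y \<partial>lborel)"
  proof (rule nn_integral_cong)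
    fix y
    have e: "?b (y - T (x + inv T y)) = indicator (T -` ball 0 1) x" for x
      by (simp add: TI indicator_def)
    have [measurable]: "T -` ball 0 1 \<in> sets borel"
      using measurable_sets[of T borel borel "ball 0 1"] by simp
    have "(\<integral>\<^sup>+x. ?b (y - T x) * g y \<partial>lborel) = (\<integral>\<^sup>+x. ?b (y - T x) \<partial>lborel) * g y"
      by (rule nn_integral_multc) measurable
    also have "(\<integral>\<^sup>+x. ?b (y - T x) \<partial>lborel) = (\<integral>\<^sup>+x. ?b (y - T (x + inv T y)) \<partial>lborel)"
      by (rule nn_integral_lborel_shift[of "\<lambda>x. ?b (y - T x)", symmetric]) measurable
    also have "\<dots> = emeasure lborel (T -` ball 0 1)" unfolding e by simp
    finally show "(\<integral>\<^sup>+x. ?b (y - T x) * g y \<partial>lborel) = emeasure lborel (T -` ball 0 1) * g y" .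
  qed
  also have "\<dots> = emeasure lborel (T -` ball 0 1) * (\<integral>\<^sup>+x. g x \<partial>lborel)"
    by (rule nn_integral_cmult) auto
  finally show ?thesis .
qed

lemma emeasure_unit_ball: "emeasure lborel (ball (0::'a::euclidean_space) 1) = ennreal (unit_ball_vol (DIM('a)))"
  by (subst emeasure_ball) auto

text \<open>An orthogonal map preserves the unit ball, so the two volume factors in
  \<open>nn_integral_lborel_linear_aux\<close> agree and cancel.\<close>

lemma nn_integral_lborel_orthogonal_transformation:
  fixes T :: "'a::euclidean_space \<Rightarrow> 'a" and g :: "'a \<Rightarrow> ennreal"
  assumes T: "orthogonal_transformation T" and g[measurable]: "g \<in> borel_measurable borel"
  shows "(\<integral>\<^sup>+x. g (T x) \<partial>lborel) = (\<integral>\<^sup>+x. g x \<partial>lborel)"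
proof -
  have "T -` ball 0 1 = ball 0 1"
    using orthogonal_transformation_norm[OF T] by auto
  then have "ennreal (unit_ball_vol (DIM('a))) * (\<integral>\<^sup>+x. g (T x) \<partial>lborel) =
      ennreal (unit_ball_vol (DIM('a))) * (\<integral>\<^sup>+x. g x \<partial>lborel)"
    using nn_integral_lborel_linear_aux[OF orthogonal_transformation_linear[OF T] orthogonal_transformation_bij[OF T] g]
    by (simp add: emeasure_unit_ball)
  then show ?thesis
    by (subst (asm) ennreal_mult_cancel_left) auto
qed

text \<open>\<open>d\<close> is the volume of the preimage of the unit ball divided by the volume of
  the ball. Only its positivity and its independence of \<open>g\<close> matter: every such factor
  ends up inside an unspecified constant, so no determinant is computed.\<close>

lemma nn_integral_lborel_linear:
  fixes T :: "'a::euclidean_space \<Rightarrow> 'a"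
  assumes T: "linear T" "bij T"
  obtains d where "d > 0" "\<And>g. g \<in> borel_measurable borel \<Longrightarrow>
    (\<integral>\<^sup>+x. g (T x) \<partial>lborel) = ennreal d * (\<integral>\<^sup>+x. g x \<partial>lborel)"
proof -
  have cont: "continuous_on UNIV T"
    using T(1) by (simp add: linear_continuous_on linear_linear)
  have op: "open (T -` ball 0 1)" by (rule open_vimage[OF open_ball cont])
  have "0 \<in> T -` ball 0 1" using linear_0[OF T(1)] by simp
  then have ne: "T -` ball 0 1 \<noteq> {}" by (metis empty_iff)
  have nn: "\<not> negligible (T -` ball 0 1)"
    by (rule open_not_negligible[OF op ne])
  have [measurable]: "T -` ball 0 1 \<in> sets borel" using op by simp
  have pos: "emeasure lborel (T -` ball 0 1) \<noteq> 0"
    using nn by (auto simp: negligible_iff_null_sets null_sets_def)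
  have "bounded (inv T ` ball 0 1)"
    by (intro bounded_linear_image bounded_ball
        linear_linear[THEN iffD2] inj_linear_imp_inv_linear[OF T(1) bij_is_inj[OF T(2)]])
  then have "bounded (T -` ball 0 1)" using T(2) by (simp add: bij_vimage_eq_inv_image)
  then have fin: "emeasure lborel (T -` ball 0 1) < \<infinity>"
    by (rule emeasure_bounded_finite)
  define m where "m = measure lborel (T -` ball 0 1)"
  have m: "emeasure lborel (T -` ball 0 1) = ennreal m"
    using fin unfolding m_def by (intro emeasure_eq_ennreal_measure) auto
  moreover have "m \<noteq> 0" using pos unfolding m by auto
  moreover have "m \<ge> 0" unfolding m_def by (rule measure_nonneg)
  ultimately have m: "emeasure lborel (T -` ball 0 1) = ennreal m" "m > 0" by auto
  define v where "v = unit_ball_vol (DIM('a))"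
  have v: "v > 0" by (simp add: v_def)
  show ?thesis
  proof (rule that[of "m / v"])
    show "m / v > 0" using m v by simp
    fix g :: "'a \<Rightarrow> ennreal" assume g: "g \<in> borel_measurable borel"
    have "ennreal v * (\<integral>\<^sup>+x. g (T x) \<partial>lborel) = ennreal m * (\<integral>\<^sup>+x. g x \<partial>lborel)"
      using nn_integral_lborel_linear_aux[OF T g] by (simp add: emeasure_unit_ball v_def m)
    also have "\<dots> = ennreal v * (ennreal (m / v) * (\<integral>\<^sup>+x. g x \<partial>lborel))"
      using m v by (simp add: mult.assoc[symmetric] ennreal_mult[symmetric])
    finally show "(\<integral>\<^sup>+x. g (T x) \<partial>lborel) = ennreal (m / v) * (\<integral>\<^sup>+x. g x \<partial>lborel)"
      using v by (subst (asm) ennreal_mult_cancel_left) (auto simp: ennreal_eq_0_iff not_le)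
  qed
qed

section \<open>The rotation-invariant probability measure on the sphere\<close>

text \<open>Radial projection of the uniform distribution on the ball. It is a Borel measure on the
  whole space, so integrands need no restriction to the sphere; since \<open>sgn\<close> sends only
  the null set {0} off the sphere, the measure is carried by unit vectors.\<close>

definition sphere_measure :: "'a::euclidean_space measure" where
  "sphere_measure = distr (uniform_measure lborel (ball 0 1)) borel sgn"

lemma sets_sphere_measure [simp, measurable_cong]: "sets sphere_measure = sets borel"
  and space_sphere_measure [simp]: "space sphere_measure = UNIV"
  by (auto simp: sphere_measure_def)

lemma borel_measurable_sgn [measurable]: "(sgn :: 'a::euclidean_space \<Rightarrow> 'a) \<in> borel_measurable borel"
  unfolding sgn_div_norm[abs_def] by measurable

abbreviation sphere_integral :: "('a::euclidean_space \<Rightarrow> real) \<Rightarrow> real" (binder "\<integral>\<^sub>S " 10) where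
  "sphere_integral f \<equiv> integral\<^sup>L sphere_measure f"

lemma prob_space_sphere_measure: "prob_space (sphere_measure :: 'a::euclidean_space measure)"
proof -
  interpret U: prob_space "uniform_measure lborel (ball (0::'a) 1)"
    by (rule prob_space_uniform_measure)
      (auto simp: emeasure_unit_ball)
  show ?thesis unfolding sphere_measure_def by (rule U.prob_space_distr) simp
qed

lemma nn_integral_sphere_measure:
  fixes g :: "'a::euclidean_space \<Rightarrow> ennreal"
  assumes [measurable]: "g \<in> borel_measurable borel"
  shows "ennreal (unit_ball_vol (DIM('a))) * (\<integral>\<^sup>+x. g x \<partial>sphere_measure) =
    (\<integral>\<^sup>+x. indicator (ball 0 1) x * g (sgn x) \<partial>lborel)"
proof -
  have "(\<integral>\<^sup>+x. g x \<partial>sphere_measure) =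
      (\<integral>\<^sup>+x. indicator (ball 0 1) x * g (sgn x) \<partial>lborel) / ennreal (unit_ball_vol (DIM('a)))"
    unfolding sphere_measure_def
    by (subst nn_integral_distr) (auto simp: nn_integral_uniform_measure emeasure_unit_ball mult.commute)
  then show ?thesis
    using unit_ball_vol_pos[of "DIM('a)"]
    by (simp add: ennreal_times_divide ennreal_mult_divide_eq mult.commute[of "ennreal (unit_ball_vol (DIM('a)))"] ennreal_eq_0_iff not_le)
qed

lemma AE_sphere_measure: "AE x in (sphere_measure :: 'a::euclidean_space measure). norm x = 1"
proof -
  have "AE x in lborel. x \<noteq> (0::'a)"
    using AE_lborel_singleton[of 0] by simp
  then have "AE x in uniform_measure lborel (ball (0::'a) 1). norm (sgn x) = 1"
    by (intro AE_uniform_measureI) (auto simp: norm_sgn)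
  then show ?thesis unfolding sphere_measure_def
    by (subst AE_distr_iff) auto
qed

text \<open>\<open>sgn\<close> commutes with orthogonal maps, so the invariance of Lebesgue measure
  on the ball descends to the projected measure.\<close>

lemma nn_integral_sphere_orthogonal:
  fixes T :: "'a::euclidean_space \<Rightarrow> 'a" and g :: "'a \<Rightarrow> ennreal"
  assumes T: "orthogonal_transformation T" and g[measurable]: "g \<in> borel_measurable borel"
  shows "(\<integral>\<^sup>+x. g (T x) \<partial>sphere_measure) = (\<integral>\<^sup>+x. g x \<partial>sphere_measure)"
proof -
  have l: "linear T" using T by (rule orthogonal_transformation_linear)
  note [measurable] = borel_measurable_linear[OF l]
  have s: "T (sgn x) = sgn (T x)" for x
    using orthogonal_transformation_norm[OF T] l by (simp add: sgn_div_norm linear_scale)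
  have "(\<integral>\<^sup>+x. indicator (ball 0 1) x * g (T (sgn x)) \<partial>lborel) =
    (\<integral>\<^sup>+x. indicator (ball 0 1) (T x) * g (sgn (T x)) \<partial>lborel)"
    using orthogonal_transformation_norm[OF T] by (simp add: s indicator_def)
  also have "\<dots> = (\<integral>\<^sup>+x. indicator (ball 0 1) x * g (sgn x) \<partial>lborel)"
    by (rule nn_integral_lborel_orthogonal_transformation[OF T, of "\<lambda>x. indicator (ball 0 1) x * g (sgn x)"]) measurable
  finally have "ennreal (unit_ball_vol (DIM('a))) * (\<integral>\<^sup>+x. g (T x) \<partial>sphere_measure) =
      ennreal (unit_ball_vol (DIM('a))) * (\<integral>\<^sup>+x. g x \<partial>sphere_measure)"
    by (simp add: nn_integral_sphere_measure)
  then show ?thesis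
    by (subst (asm) ennreal_mult_cancel_left) auto
qed

lemma distr_sphere_orthogonal:
  fixes T :: "'a::euclidean_space \<Rightarrow> 'a"
  assumes T: "orthogonal_transformation T"
  shows "distr sphere_measure borel T = sphere_measure"
proof (rule measure_eqI)
  fix A assume A: "A \<in> sets (distr sphere_measure borel T)"
  have l: "linear T" using T by (rule orthogonal_transformation_linear)
  note [measurable] = borel_measurable_linear[OF l]
  have [measurable]: "A \<in> sets borel" using A by simp
  have "emeasure (distr sphere_measure borel T) A = (\<integral>\<^sup>+x. indicator A x \<partial>distr sphere_measure borel T)"
    by simp
  also have "\<dots> = (\<integral>\<^sup>+x. indicator A (T x) \<partial>sphere_measure)"
    by (rule nn_integral_distr) auto
  also have "\<dots> = (\<integral>\<^sup>+x. indicator A x \<partial>sphere_measure)"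
    by (rule nn_integral_sphere_orthogonal[OF T]) auto
  finally show "emeasure (distr sphere_measure borel T) A = emeasure sphere_measure A" by simp
qed simp

lemma integral_sphere_orthogonal:
  fixes T :: "'a::euclidean_space \<Rightarrow> 'a" and g :: "'a \<Rightarrow> real"
  assumes T: "orthogonal_transformation T" and g[measurable]: "g \<in> borel_measurable borel"
  shows "(\<integral>\<^sub>S x. g (T x)) = (\<integral>\<^sub>S x. g x)"
proof -
  have l: "linear T" using T by (rule orthogonal_transformation_linear)
  note [measurable] = borel_measurable_linear[OF l]
  have "(\<integral>\<^sub>S x. g (T x)) = (\<integral>x. g x \<partial>distr sphere_measure borel T)"
    by (rule integral_distr[symmetric]) auto
  then show ?thesis by (simp add: distr_sphere_orthogonal[OF T])
qed

text \<open>Substituting \<open>r = t \<bar>x\<bar>\<close> and then \<open>y = t x\<close> turns the right-hand side into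
  a double integral that Fubini's theorem evaluates.\<close>
lemma nn_integral_polar:
  fixes g :: "'a::euclidean_space \<Rightarrow> ennreal"
  assumes g[measurable]: "g \<in> borel_measurable borel"
  shows "(\<integral>\<^sup>+x. g x \<partial>lborel) = ennreal (DIM('a) * unit_ball_vol (DIM('a))) *
    (\<integral>\<^sup>+\<theta>. (\<integral>\<^sup>+r. indicator {0<..} r * ennreal (r ^ (DIM('a) - 1)) * g (r *\<^sub>R \<theta>) \<partial>lborel) \<partial>sphere_measure)"
proof -
  define n where "n = DIM('a)"
  have n: "n > 0" by (simp add: n_def)
  let ?I = "indicator {0<..} :: real \<Rightarrow> ennreal"
  let ?B = "indicator (ball (0::'a) 1) :: 'a \<Rightarrow> ennreal"
  \<comment> \<open>The exponent n + 1 collects the powers of t under y = t x: n - 1 from the radial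
    weight with the opposite sign, n from \<open>norm x ^ n = norm y ^ n / t ^ n\<close>, and n from
    the Jacobian.\<close>
  let ?k = "\<lambda>t y. ?I t * ennreal (1 / t ^ (n+1)) * ?B ((1/t) *\<^sub>R y)"
  have tail: "(\<integral>\<^sup>+t. ?k t y \<partial>lborel) = ennreal (1 / (n * norm y ^ n))"
    if y: "y \<noteq> 0" for y
  proof -
    have "(\<integral>\<^sup>+t. ?k t y \<partial>lborel) =
        (\<integral>\<^sup>+t. ennreal (1 / t ^ (n+1)) * indicator {norm y..} t \<partial>lborel)"
    proof (rule nn_integral_cong_AE)
      \<comment> \<open>The open ball gives a strict inequality and the half-line is closed; the
        integrands differ only at t = \<open>norm y\<close>.\<close>
      have "AE t in lborel. t \<noteq> norm y" by (rule AE_lborel_singleton)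
      then show "AE t in lborel. ?k t y =
        ennreal (1 / t ^ (n+1)) * indicator {norm y..} t"
      proof eventually_elim
        case (elim t)
        then show ?case using y by (auto simp: indicator_def field_simps)
          (metis less_le_trans norm_ge_zero not_less order.strict_trans1 order_le_less)+
      qed
    qed
    also have "\<dots> = ennreal (0 - (- (1 / (n * norm y ^ n))))"
    proof (rule nn_integral_FTC_atLeast)
      show "((\<lambda>t. - (1 / (real n * t ^ n))) has_real_derivative 1 / t ^ (n+1)) (at t)" if "norm y \<le> t" for t
      proof -
        have t: "t > 0" using y that by (metis less_le_trans zero_less_norm_iff)
        obtain k where k: "n = Suc k" using n by (cases n) auto
        have "((\<lambda>t. - (1 / (real n * t ^ n))) has_real_derivative
          (real n * (real n * t ^ (n - 1))) / (real n * t ^ n)^2) (at t)"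
          using t n by (auto intro!: derivative_eq_intros simp: power2_eq_square)
        also have "(real n * (real n * t ^ (n - 1))) / (real n * t ^ n)^2 =
            (real n * real n * t ^ k) / (real n * real n * t ^ k * t ^ (n+1))"
          unfolding k by (simp add: power2_eq_square mult_ac)
        also have "\<dots> = 1 / t ^ (n+1)" using t n by simp
        finally show ?thesis .
      qed
      show "((\<lambda>t. - (1 / (real n * t ^ n))) \<longlongrightarrow> 0) at_top"
      proof -
        have "((\<lambda>t. - ((1 / real n) * inverse (t ^ n))) \<longlongrightarrow> - ((1 / real n) * 0)) at_top"
          using n by (intro tendsto_intros tendsto_inverse_0_at_top filterlim_pow_at_top filterlim_ident)
        then show ?thesis by (simp add: field_simps)
      qed
      show "\<And>t. norm y \<le> t \<Longrightarrow> 0 \<le> 1 / t ^ (n + 1)"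
        by (meson norm_ge_zero order_trans zero_le_divide_1_iff zero_le_power)
    qed simp
    finally show ?thesis by simp
  qed
  define A where "A = (\<lambda>\<theta>. \<integral>\<^sup>+r. ?I r * ennreal (r ^ (n - 1)) * g (r *\<^sub>R \<theta>) \<partial>lborel)"
  have [measurable]: "A \<in> borel_measurable borel" unfolding A_def by measurable
  have rad: "A (sgn x) = (\<integral>\<^sup>+t. ?I t * ennreal (t ^ (n - 1)) * (ennreal (norm x ^ n) * g (t *\<^sub>R x)) \<partial>lborel)"
    if x: "x \<noteq> 0" for x
  proof -
    have e: "ennreal \<bar>norm x\<bar> * (?I (norm x * t) * ennreal ((norm x * t) ^ (n - 1)) * g ((norm x * t) *\<^sub>R sgn x)) =
        ?I t * ennreal (t ^ (n - 1)) * (ennreal (norm x ^ n) * g (t *\<^sub>R x))" for t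
    proof (cases "t > 0")
      case True
      have p: "ennreal (norm x) * ennreal ((norm x * t) ^ (n - 1)) = ennreal (t ^ (n - 1)) * ennreal (norm x ^ n)"
        using True n by (cases n) (auto simp: ennreal_mult[symmetric] power_mult_distrib mult_ac)
      have s: "(norm x * t) *\<^sub>R sgn x = t *\<^sub>R x" using x by (simp add: sgn_div_norm)
      show ?thesis unfolding s using True x p by (simp add: mult.assoc[symmetric])
    qed (use x in \<open>auto simp: indicator_def zero_less_mult_iff\<close>)
    have "A (sgn x) = ennreal \<bar>norm x\<bar> *
       (\<integral>\<^sup>+t. ?I (norm x * t) * ennreal ((norm x * t) ^ (n - 1)) * g ((norm x * t) *\<^sub>R sgn x) \<partial>lborel)"
      unfolding A_def using x
        nn_integral_real_affine[of "\<lambda>r. ?I r * ennreal (r ^ (n - 1)) * g (r *\<^sub>R sgn x)" "norm x" 0]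
      by simp
    also have "\<dots> = (\<integral>\<^sup>+t. ennreal \<bar>norm x\<bar> * (?I (norm x * t) * ennreal ((norm x * t) ^ (n - 1)) * g ((norm x * t) *\<^sub>R sgn x)) \<partial>lborel)"
      by (rule nn_integral_cmult[symmetric]) measurable
    finally show ?thesis unfolding e .
  qed
  have "ennreal (unit_ball_vol n) * (\<integral>\<^sup>+x. A x \<partial>sphere_measure) = (\<integral>\<^sup>+x. ?B x * A (sgn x) \<partial>lborel)"
    unfolding n_def by (rule nn_integral_sphere_measure) measurable
  also have "\<dots> = (\<integral>\<^sup>+x. \<integral>\<^sup>+t. ?B x * (?I t * ennreal (t ^ (n - 1)) * (ennreal (norm x ^ n) * g (t *\<^sub>R x))) \<partial>lborel \<partial>lborel)"
  proof (rule nn_integral_cong_AE)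
    have "AE x in lborel. x \<noteq> (0::'a)" using AE_lborel_singleton[of 0] by simp
    then show "AE x in lborel. ?B x * A (sgn x) =
      (\<integral>\<^sup>+t. ?B x * (?I t * ennreal (t ^ (n - 1)) * (ennreal (norm x ^ n) * g (t *\<^sub>R x))) \<partial>lborel)"
    proof eventually_elim
      case (elim x)
      show ?case unfolding rad[OF elim] by (rule nn_integral_cmult[symmetric]) measurable
    qed
  qed
  also have "\<dots> = (\<integral>\<^sup>+t. \<integral>\<^sup>+x. ?B x * (?I t * ennreal (t ^ (n - 1)) * (ennreal (norm x ^ n) * g (t *\<^sub>R x))) \<partial>lborel \<partial>lborel)"
    by (rule lborel_pair.Fubini') measurable
  also have "\<dots> = (\<integral>\<^sup>+t. \<integral>\<^sup>+y. ?k t y * (ennreal (norm y ^ n) * g y) \<partial>lborel \<partial>lborel)"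
  proof (rule nn_integral_cong)
    fix t :: real
    show "(\<integral>\<^sup>+x. ?B x * (?I t * ennreal (t ^ (n - 1)) * (ennreal (norm x ^ n) * g (t *\<^sub>R x))) \<partial>lborel) =
      (\<integral>\<^sup>+y. ?k t y * (ennreal (norm y ^ n) * g y) \<partial>lborel)"
    proof (cases "t > 0")
      case True
      have e: "ennreal (t ^ n) * (?k t (t *\<^sub>R x) * (ennreal (norm (t *\<^sub>R x) ^ n) * g (t *\<^sub>R x)))
        = ?B x * (?I t * ennreal (t ^ (n - 1)) * (ennreal (norm x ^ n) * g (t *\<^sub>R x)))" for x
      proof -
        have "ennreal (t ^ n) * ennreal (1 / t ^ (n+1)) * ennreal (norm (t *\<^sub>R x) ^ n) = ennreal (t ^ (n - 1)) * ennreal (norm x ^ n)"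
          using True n by (cases n) (auto simp: ennreal_mult[symmetric] power_mult_distrib field_simps)
        moreover have "a * ((1 * b * c) * (d * e)) = (a * b * d) * (c * e)" for a b c d e :: ennreal
          by (simp add: mult_ac)
        moreover have "c * (1 * p * (q * e)) = (p * q) * (c * e)" for c p q e :: ennreal
          by (simp add: mult_ac)
        moreover have "?I t = 1" "(1/t) *\<^sub>R (t *\<^sub>R x) = x" using True by auto
        ultimately show ?thesis by (simp only:)
      qed
      have "(\<integral>\<^sup>+y. ?k t y * (ennreal (norm y ^ n) * g y) \<partial>lborel) =
        ennreal (t ^ n) * (\<integral>\<^sup>+x. ?k t (t *\<^sub>R x) * (ennreal (norm (t *\<^sub>R x) ^ n) * g (t *\<^sub>R x)) \<partial>lborel)"
        using nn_integral_lborel_scaleR[of "\<lambda>y. ?k t y * (ennreal (norm y ^ n) * g y)" t] True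
        by (simp add: n_def)
      also have "\<dots> = (\<integral>\<^sup>+x. ennreal (t ^ n) * (?k t (t *\<^sub>R x) * (ennreal (norm (t *\<^sub>R x) ^ n) * g (t *\<^sub>R x))) \<partial>lborel)"
        by (rule nn_integral_cmult[symmetric]) measurable
      finally show ?thesis unfolding e ..
    qed auto
  qed
  also have "\<dots> = (\<integral>\<^sup>+y. \<integral>\<^sup>+t. ?k t y * (ennreal (norm y ^ n) * g y) \<partial>lborel \<partial>lborel)"
    by (rule lborel_pair.Fubini') measurable
  also have "\<dots> = (\<integral>\<^sup>+y. ennreal (1 / n) * g y \<partial>lborel)"
  proof (rule nn_integral_cong_AE)
    have "AE x in lborel. x \<noteq> (0::'a)" using AE_lborel_singleton[of 0] by simp
    then show "AE y in lborel. (\<integral>\<^sup>+t. ?k t y * (ennreal (norm y ^ n) * g y) \<partial>lborel)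
       = ennreal (1 / n) * g y"
    proof eventually_elim
      case (elim y)
      have "(\<integral>\<^sup>+t. ?k t y * (ennreal (norm y ^ n) * g y) \<partial>lborel)
         = (\<integral>\<^sup>+t. ?k t y \<partial>lborel) * (ennreal (norm y ^ n) * g y)"
        by (rule nn_integral_multc) measurable
      also have "\<dots> = ennreal (1 / n) * g y"
        unfolding tail[OF elim] using elim n by (simp add: mult.assoc[symmetric] ennreal_mult[symmetric])
      finally show ?case .
    qed
  qed
  also have "\<dots> = ennreal (1 / n) * (\<integral>\<^sup>+y. g y \<partial>lborel)"
    by (rule nn_integral_cmult) measurable
  finally have *: "ennreal (unit_ball_vol n) * (\<integral>\<^sup>+x. A x \<partial>sphere_measure) = ennreal (1 / n) * (\<integral>\<^sup>+y. g y \<partial>lborel)" .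
  have "ennreal (real n * unit_ball_vol n) * (\<integral>\<^sup>+x. A x \<partial>sphere_measure) =
     ennreal n * (ennreal (1 / n) * (\<integral>\<^sup>+y. g y \<partial>lborel))"
    unfolding *[symmetric] by (simp add: ennreal_mult mult.assoc)
  also have "\<dots> = (\<integral>\<^sup>+y. g y \<partial>lborel)"
    using n by (simp add: mult.assoc[symmetric] ennreal_mult[symmetric])
  finally show ?thesis by (simp add: A_def n_def)
qed


section \<open>Moments of the uniform measure\<close>

lemma integrable_sphere_measure:
  fixes g :: "'a::euclidean_space \<Rightarrow> real"
  assumes "g \<in> borel_measurable borel" "\<And>x. norm x = 1 \<Longrightarrow> \<bar>g x\<bar> \<le> B"
  shows "integrable sphere_measure g"
proof -
  interpret prob_space "sphere_measure :: 'a measure" by (rule prob_space_sphere_measure)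
  show ?thesis
    using assms AE_sphere_measure by (intro integrable_const_bound[of _ B]) auto
qed

lemma integral_sphere_cong:
  fixes f g :: "'a::euclidean_space \<Rightarrow> real"
  assumes "f \<in> borel_measurable borel" "g \<in> borel_measurable borel" "\<And>x. norm x = 1 \<Longrightarrow> f x = g x"
  shows "(\<integral>\<^sub>S x. f x) = (\<integral>\<^sub>S x. g x)"
  using assms AE_sphere_measure by (intro integral_cong_AE) auto

lemma integral_sphere_const [simp]:
  "(\<integral>\<^sub>S x::'a::euclidean_space. (c::real)) = c"
proof -
  interpret prob_space "sphere_measure :: 'a measure" by (rule prob_space_sphere_measure)
  show ?thesis using prob_space by simp
qed

lemma integral_sphere_mono:
  fixes f g :: "'a::euclidean_space \<Rightarrow> real"
  assumes "integrable sphere_measure f" "integrable sphere_measure g" "\<And>x. norm x = 1 \<Longrightarrow> f x \<le> g x"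
  shows "(\<integral>\<^sub>S x. f x) \<le> (\<integral>\<^sub>S x. g x)"
  using assms AE_sphere_measure by (intro integral_mono_AE) auto

lemma abs_integral_sphere_le:
  fixes g :: "'a::euclidean_space \<Rightarrow> real"
  assumes "g \<in> borel_measurable borel" "\<And>x. norm x = 1 \<Longrightarrow> \<bar>g x\<bar> \<le> B"
  shows "\<bar>\<integral>\<^sub>S x. g x\<bar> \<le> B"
proof -
  have i: "integrable sphere_measure g" by (rule integrable_sphere_measure[OF assms])
  have c: "integrable (sphere_measure :: 'a measure) (\<lambda>x. c)" for c :: real
    by (rule integrable_sphere_measure[of _ "\<bar>c\<bar>"]) auto
  have "(\<integral>\<^sub>S x. g x) \<le> (\<integral>\<^sub>S x::'a. B)"
    using assms(2) by (intro integral_sphere_mono i c) (auto simp: abs_le_iff)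
  moreover have "(\<integral>\<^sub>S x::'a. - B) \<le> (\<integral>\<^sub>S x. g x)"
    using assms(2) by (intro integral_sphere_mono i c) (force simp: abs_le_iff)
  ultimately show ?thesis unfolding integral_sphere_const by linarith
qed

section \<open>Rotations and orthonormal pairs\<close>

text \<open>The reflection in the hyperplane orthogonal to \<open>a - b\<close>. Its fixed vectors
  are recorded so that a second reflection can adjust another vector without disturbing the
  first.\<close>

lemma orthogonal_transformation_reflection:
  fixes a b :: "'a::euclidean_space"
  assumes "norm a = norm b"
  obtains T where "orthogonal_transformation T" "T a = b" "\<And>x. x \<bullet> a = x \<bullet> b \<Longrightarrow> T x = x"
proof (cases "a = b")
  case True
  then show ?thesis using that[of "\<lambda>x. x"] by simp
next
  case False
  define u where "u = a - b"
  have u: "u \<bullet> u \<noteq> 0" using False by (simp add: u_def)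
  define T where "T x = x - (2 * (x \<bullet> u) / (u \<bullet> u)) *\<^sub>R u" for x
  have lin: "linear T"
    unfolding T_def by (rule linearI) (auto simp: algebra_simps inner_add_left add_divide_distrib scaleR_add_left)
  have "T x \<bullet> T y = x \<bullet> y" for x y
    using u by (simp add: T_def inner_diff inner_commute field_simps)
  then have "orthogonal_transformation T" using lin by (simp add: orthogonal_transformation_def)
  moreover have "T a = b"
  proof -
    have "a \<bullet> a = b \<bullet> b" using assms by (simp add: norm_eq)
    then have "2 * (a \<bullet> u) = u \<bullet> u" by (simp add: u_def inner_diff inner_commute)
    then show ?thesis using u by (simp add: T_def) (simp add: u_def)
  qed
  moreover have "T x = x" if "x \<bullet> a = x \<bullet> b" for x
    using that by (simp add: T_def u_def inner_diff_right)
  ultimately show ?thesis by (rule that)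
qed

lemma orthogonal_transformation_pair:
  fixes a b a' b' :: "'a::euclidean_space"
  assumes "norm a = 1" "norm b = 1" "a \<bullet> b = 0" "norm a' = 1" "norm b' = 1" "a' \<bullet> b' = 0"
  obtains T where "orthogonal_transformation T" "T a = a'" "T b = b'"
proof -
  obtain T1 where T1: "orthogonal_transformation T1" "T1 a = a'"
    using orthogonal_transformation_reflection[of a a'] assms by metis
  have c: "norm (T1 b) = 1" "a' \<bullet> T1 b = 0"
    using T1 assms by (auto simp: orthogonal_transformation_norm orthogonal_transformation_def)
  \<comment> \<open>\<open>a'\<close> is orthogonal to both \<open>T1 b\<close> and
    \<open>b'\<close>, so the second reflection leaves it fixed.\<close>
  obtain T2 where T2: "orthogonal_transformation T2" "T2 (T1 b) = b'" "T2 a' = a'"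
    using orthogonal_transformation_reflection[of "T1 b" b'] assms c by metis
  show ?thesis
    using that[of "T2 \<circ> T1"] T1 T2 orthogonal_transformation_compose[OF T2(1) T1(1)] by simp
qed

text \<open>The absolute value sits on the \<open>a\<close>-factor because the kernel of the cosine
  transform contributes an odd power there, while the powers of \<open>x \<bullet> b\<close> that
  survive are even.\<close>

definition sphere_moment :: "'a::euclidean_space \<Rightarrow> 'a \<Rightarrow> nat \<Rightarrow> nat \<Rightarrow> real" where
  "sphere_moment a b p q = (\<integral>\<^sub>S x. \<bar>x \<bullet> a\<bar> ^ p * (x \<bullet> b) ^ q)"

lemma integral_sphere_pair:
  fixes a b a' b' :: "'a::euclidean_space"
  assumes "norm a = 1" "norm b = 1" "a \<bullet> b = 0" "norm a' = 1" "norm b' = 1" "a' \<bullet> b' = 0"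
    and g[measurable]: "case_prod g \<in> borel_measurable (borel \<Otimes>\<^sub>M borel)"
  shows "(\<integral>\<^sub>S x. g (x \<bullet> a) (x \<bullet> b)) = (\<integral>\<^sub>S x. (g (x \<bullet> a') (x \<bullet> b') :: real))"
proof -
  obtain T where T: "orthogonal_transformation T" "T a = a'" "T b = b'"
    using orthogonal_transformation_pair[OF assms(1-6)] by metis
  have m: "(\<lambda>x. g (x \<bullet> a') (x \<bullet> b')) \<in> borel_measurable borel"
    using measurable_compose[OF _ g, of "\<lambda>x. (x \<bullet> a', x \<bullet> b')"] by simp
  have "(\<integral>\<^sub>S x. g (T x \<bullet> T a) (T x \<bullet> T b)) = (\<integral>\<^sub>S x. g (x \<bullet> a') (x \<bullet> b'))"
    using integral_sphere_orthogonal[OF T(1) m] T by simp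
  then show ?thesis using T(1) by (simp add: orthogonal_transformation_def)
qed

lemma sphere_moment_pair:
  fixes a b a' b' :: "'a::euclidean_space"
  assumes "norm a = 1" "norm b = 1" "a \<bullet> b = 0" "norm a' = 1" "norm b' = 1" "a' \<bullet> b' = 0"
  shows "sphere_moment a b p q = sphere_moment a' b' p q"
  unfolding sphere_moment_def
  using integral_sphere_pair[OF assms, of "\<lambda>s t. \<bar>s\<bar> ^ p * t ^ q"] by simp

lemma unit_inner_le: "norm x = 1 \<Longrightarrow> norm a = 1 \<Longrightarrow> \<bar>x \<bullet> a\<bar> \<le> 1"
  using Cauchy_Schwarz_ineq2[of x a] by simp

lemma abs_mult_inner_power_le:
  fixes x a :: "'a::euclidean_space"
  assumes "norm x = 1" "norm a = 1" "\<bar>c\<bar> \<le> C"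
  shows "\<bar>c * (x \<bullet> a) ^ k\<bar> \<le> C"
proof -
  have "\<bar>c\<bar> * \<bar>x \<bullet> a\<bar> ^ k \<le> C * 1"
    using assms(3) unit_inner_le[OF assms(1,2)] by (intro mult_mono) (auto intro!: power_le_one)
  then show ?thesis by (simp add: abs_mult power_abs)
qed

lemma sum_inner_Basis_square:
  fixes x :: "'a::euclidean_space"
  assumes "norm x = 1"
  shows "(\<Sum>b\<in>Basis. (x \<bullet> b)\<^sup>2) = 1"
  using euclidean_inner[of x x] assms by (simp add: power2_eq_square norm_eq_1)

lemma integrable_sphere_moment:
  fixes a b :: "'a::euclidean_space"
  assumes "norm a = 1" "norm b = 1"
  shows "integrable sphere_measure (\<lambda>x. \<bar>x \<bullet> a\<bar> ^ p * (x \<bullet> b) ^ q)"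
proof (rule integrable_sphere_measure[where B=1])
  fix x :: 'a assume "norm x = 1"
  then show "\<bar>\<bar>x \<bullet> a\<bar> ^ p * (x \<bullet> b) ^ q\<bar> \<le> 1"
    using unit_inner_le[of x] assms
    by (auto simp: abs_mult power_abs intro!: mult_le_one power_le_one)
qed measurable

lemma sphere_moment_0:
  fixes a b a' :: "'a::euclidean_space"
  assumes n: "norm a = 1" "norm b = 1" "norm a' = 1"
  shows "sphere_moment a b p 0 = (\<integral>\<^sub>S x. \<bar>x \<bullet> a'\<bar> ^ p)"
proof -
  obtain T where T: "orthogonal_transformation T" "T a = a'"
    using orthogonal_transformation_reflection[of a a'] n by metis
  have "(\<integral>\<^sub>S x. \<bar>T x \<bullet> T a\<bar> ^ p) = (\<integral>\<^sub>S x. \<bar>x \<bullet> a'\<bar> ^ p)"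
    using integral_sphere_orthogonal[OF T(1), of "\<lambda>x. \<bar>x \<bullet> a'\<bar> ^ p"] T by simp
  then show ?thesis using T(1) by (simp add: orthogonal_transformation_def sphere_moment_def)
qed

lemma obtain_orthonormal_pair:
  assumes "2 \<le> DIM('a::euclidean_space)"
  obtains a b :: "'a::euclidean_space" where "a \<in> Basis" "b \<in> Basis" "a \<noteq> b" "norm a = 1" "norm b = 1" "a \<bullet> b = 0"
proof -
  have "card (Basis :: 'a set) > Suc 0" using assms by simp
  then obtain a b :: 'a where "a \<in> Basis" "b \<in> Basis" "a \<noteq> b"
    by (metis card_le_Suc0_iff_eq finite_Basis linorder_not_less)
  then show ?thesis using that by (auto simp: inner_Basis)
qed

section \<open>Comparison with Gaussian moments\<close>

definition normal_abs_moment :: "nat \<Rightarrow> real" where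
  "normal_abs_moment p = (\<integral>t. std_normal_density t * \<bar>t\<bar> ^ p \<partial>lborel)"

lemma normal_abs_moment_even: "normal_abs_moment (2 * k) = fact (2 * k) / (2 ^ k * fact k)"
  unfolding normal_abs_moment_def using integral_std_normal_moment_even[of k] by (simp add: power_abs power_mult)

lemma normal_abs_moment_odd: "normal_abs_moment (Suc (2 * k)) = sqrt (2 / pi) * 2 ^ k * fact k"
  unfolding normal_abs_moment_def using integral_std_normal_moment_abs_odd[of k] by simp

lemma nn_integral_normal_abs_moment:
  "(\<integral>\<^sup>+t. ennreal (std_normal_density t * \<bar>t\<bar> ^ p) \<partial>lborel) = ennreal (normal_abs_moment p)"
  unfolding normal_abs_moment_def
  by (intro nn_integral_eq_integral integrable_std_normal_moment_abs) auto

text \<open>Integrate \<open>\<bar>x \<bullet> a\<bar>\<^sup>p \<bar>x \<bullet> b\<bar>\<^sup>q\<close> against the standard Gaussian in two ways, in Cartesian and in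
  polar coordinates. The radial factor depends only on the degree.\<close>
lemma sphere_moment_normal_Basis:
  assumes dim: "2 \<le> DIM('a::euclidean_space)"
  obtains N where "\<And>a b p q. a \<in> Basis \<Longrightarrow> b \<in> Basis \<Longrightarrow> a \<noteq> (b::'a::euclidean_space) \<Longrightarrow> p + 2 * q = d \<Longrightarrow>
    N * sphere_moment a b p (2 * q) = normal_abs_moment p * normal_abs_moment (2 * q)"
proof -
  define n where "n = DIM('a)"
  define \<Phi> where "\<Phi> s = (1 / sqrt (2 * pi)) ^ n * exp (- s\<^sup>2 / 2)" for s :: real
  have Phi0: "\<Phi> s \<ge> 0" for s by (simp add: \<Phi>_def)
  have [measurable]: "\<Phi> \<in> borel_measurable borel" unfolding \<Phi>_def by measurable
  have prodPhi: "(\<Prod>b\<in>Basis. std_normal_density (x \<bullet> b)) = \<Phi> (norm x)" for x :: 'a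
  proof -
    have "(\<Prod>b\<in>Basis. std_normal_density (x \<bullet> b)) = (\<Prod>b\<in>Basis. 1 / sqrt (2 * pi) * exp (- (x \<bullet> b)\<^sup>2 / 2))"
      by (simp add: normal_density_def)
    also have "\<dots> = (1 / sqrt (2 * pi)) ^ n * exp (\<Sum>b\<in>Basis. - (x \<bullet> b)\<^sup>2 / 2)"
      by (simp only: prod.distrib prod_constant n_def exp_sum[OF finite_Basis])
    also have "(\<Sum>b\<in>Basis. - (x \<bullet> b)\<^sup>2 / 2) = - (\<Sum>b\<in>Basis. (x \<bullet> b)\<^sup>2) / 2"
      by (simp add: sum_negf sum_divide_distrib)
    also have "(\<Sum>b\<in>Basis. (x \<bullet> b)\<^sup>2) = (norm x)\<^sup>2"
      unfolding power2_norm_eq_inner euclidean_inner[of x x] by (simp only: power2_eq_square)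
    finally show ?thesis by (simp add: \<Phi>_def)
  qed
  define C where "C = (\<integral>\<^sup>+r. indicator {0<..} r * ennreal (r ^ (n - 1)) * ennreal (r ^ d * \<Phi> r) \<partial>lborel)"
  \<comment> \<open>\<open>enn2real\<close> is multiplicative on all extended nonnegative reals, so
    the radial factor \<open>C\<close> can be converted without a separate proof of
    finiteness.\<close>
  define N where "N = enn2real (ennreal (n * unit_ball_vol n) * C)"
  show ?thesis
  proof (rule that[of N])
    fix a b :: 'a and p q
    assume ab: "a \<in> Basis" "b \<in> Basis" "a \<noteq> b" and d: "p + 2 * q = d"
    define G where "G x = \<bar>x \<bullet> a\<bar> ^ p * (x \<bullet> b) ^ (2 * q)" for x :: 'a
    have G0: "G x \<ge> 0" for x by (simp add: G_def)
    have [measurable]: "G \<in> borel_measurable borel" unfolding G_def by measurable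
    \<comment> \<open>Coordinates other than \<open>a\<close> and \<open>b\<close> get exponent 0,
      and their Gaussian factors integrate to 1.\<close>
    define e where "e c = (if c = a then p else if c = b then 2 * q else 0)" for c
    have G: "G x = (\<Prod>c\<in>Basis. \<bar>x \<bullet> c\<bar> ^ e c)" for x
    proof -
      have "(\<Prod>c\<in>Basis. \<bar>x \<bullet> c\<bar> ^ e c) = (\<Prod>c\<in>{a,b}. \<bar>x \<bullet> c\<bar> ^ e c)"
        using ab by (intro prod.mono_neutral_right) (auto simp: e_def)
      also have "\<dots> = G x" using ab by (simp add: e_def G_def power_mult)
      finally show ?thesis ..
    qed
    have "(\<integral>\<^sup>+x. ennreal (G x * \<Phi> (norm x)) \<partial>lborel) =
      (\<integral>\<^sup>+x. (\<Prod>c\<in>Basis. ennreal (std_normal_density (x \<bullet> c) * \<bar>x \<bullet> c\<bar> ^ e c)) \<partial>lborel)"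
      by (intro nn_integral_cong) (simp add: G prodPhi[symmetric] prod_ennreal prod.distrib[symmetric] mult.commute)
    also have "\<dots> = (\<Prod>c\<in>Basis. ennreal (normal_abs_moment (e c)))"
      by (subst nn_integral_lborel_prod[of "\<lambda>c t. ennreal (std_normal_density t * \<bar>t\<bar> ^ e c)"])
        (auto simp: nn_integral_normal_abs_moment)
    also have "\<dots> = (\<Prod>c\<in>{a,b}. ennreal (normal_abs_moment (e c)))"
      using ab normal_abs_moment_even[of 0] by (intro prod.mono_neutral_right) (auto simp: e_def)
    also have "\<dots> = ennreal (normal_abs_moment p) * ennreal (normal_abs_moment (2 * q))"
      using ab by (simp add: e_def)
    finally have 1: "(\<integral>\<^sup>+x. ennreal (G x * \<Phi> (norm x)) \<partial>lborel) =
       ennreal (normal_abs_moment p) * ennreal (normal_abs_moment (2 * q))" .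
    have "(\<integral>\<^sup>+x. ennreal (G x * \<Phi> (norm x)) \<partial>lborel) = ennreal (n * unit_ball_vol n) *
      (\<integral>\<^sup>+\<theta>. (\<integral>\<^sup>+r. indicator {0<..} r * ennreal (r ^ (n - 1)) * ennreal (G (r *\<^sub>R \<theta>) * \<Phi> (norm (r *\<^sub>R \<theta>))) \<partial>lborel) \<partial>sphere_measure)"
      unfolding n_def by (rule nn_integral_polar) measurable
    also have "(\<integral>\<^sup>+\<theta>. (\<integral>\<^sup>+r. indicator {0<..} r * ennreal (r ^ (n - 1)) * ennreal (G (r *\<^sub>R \<theta>) * \<Phi> (norm (r *\<^sub>R \<theta>))) \<partial>lborel) \<partial>sphere_measure)
      = (\<integral>\<^sup>+\<theta>. C * ennreal (G \<theta>) \<partial>sphere_measure)"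
    proof (rule nn_integral_cong_AE)
      show "AE \<theta> in sphere_measure. (\<integral>\<^sup>+r. indicator {0<..} r * ennreal (r ^ (n - 1)) * ennreal (G (r *\<^sub>R \<theta>) * \<Phi> (norm (r *\<^sub>R \<theta>))) \<partial>lborel) = C * ennreal (G \<theta>)"
        using AE_sphere_measure
      proof eventually_elim
        case (elim \<theta>)
        have "(\<integral>\<^sup>+r. indicator {0<..} r * ennreal (r ^ (n - 1)) * ennreal (G (r *\<^sub>R \<theta>) * \<Phi> (norm (r *\<^sub>R \<theta>))) \<partial>lborel)
          = (\<integral>\<^sup>+r. indicator {0<..} r * ennreal (r ^ (n - 1)) * ennreal (r ^ d * \<Phi> r) * ennreal (G \<theta>) \<partial>lborel)"
        proof (rule nn_integral_cong)
          fix r :: real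
          show "indicator {0<..} r * ennreal (r ^ (n - 1)) * ennreal (G (r *\<^sub>R \<theta>) * \<Phi> (norm (r *\<^sub>R \<theta>))) =
            indicator {0<..} r * ennreal (r ^ (n - 1)) * ennreal (r ^ d * \<Phi> r) * ennreal (G \<theta>)"
          proof (cases "r > 0")
            case True
            have "G (r *\<^sub>R \<theta>) = r ^ d * G \<theta>"
              using True by (simp add: G_def d[symmetric] power_add power_mult_distrib abs_mult)
            then show ?thesis
              using True elim G0[of \<theta>] Phi0[of r] by (simp add: ennreal_mult[symmetric] mult_ac)
          qed simp
        qed
        also have "\<dots> = C * ennreal (G \<theta>)"
          unfolding C_def by (rule nn_integral_multc) measurable
        finally show ?case .
      qed
    qed
    also have "\<dots> = C * (\<integral>\<^sup>+\<theta>. ennreal (G \<theta>) \<partial>sphere_measure)"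
      by (rule nn_integral_cmult) measurable
    also have "(\<integral>\<^sup>+\<theta>. ennreal (G \<theta>) \<partial>sphere_measure) = ennreal (sphere_moment a b p (2 * q))"
      using integrable_sphere_moment[of a b p "2 * q"] ab G0 unfolding G_def sphere_moment_def
      by (intro nn_integral_eq_integral) auto
    finally have "ennreal (n * unit_ball_vol n) * (C * ennreal (sphere_moment a b p (2 * q))) =
       ennreal (normal_abs_moment p) * ennreal (normal_abs_moment (2 * q))" unfolding 1 by simp
    then have "enn2real (ennreal (n * unit_ball_vol n) * C * ennreal (sphere_moment a b p (2 * q))) =
       enn2real (ennreal (normal_abs_moment p) * ennreal (normal_abs_moment (2 * q)))" by (simp add: mult.assoc)
    moreover have "sphere_moment a b p (2 * q) \<ge> 0" unfolding sphere_moment_def by (simp add: integral_nonneg_AE)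
    moreover have "normal_abs_moment k \<ge> 0" for k unfolding normal_abs_moment_def by (simp add: integral_nonneg_AE)
    ultimately show "N * sphere_moment a b p (2 * q) = normal_abs_moment p * normal_abs_moment (2 * q)"
      by (simp add: N_def enn2real_mult)
  qed
qed

text \<open>\<open>N\<close> depends on the total degree \<open>d\<close> alone, so mixed moments of
  equal degree on the sphere stand in the same ratios as Gaussian ones. \<open>N\<close> itself is
  never evaluated; it always cancels.\<close>

lemma sphere_moment_normal:
  assumes dim: "2 \<le> DIM('a::euclidean_space)"
  obtains N where "\<And>a b p q. norm a = 1 \<Longrightarrow> norm b = 1 \<Longrightarrow> a \<bullet> (b::'a::euclidean_space) = 0 \<Longrightarrow> p + 2 * q = d \<Longrightarrow>
    N * sphere_moment a b p (2 * q) = normal_abs_moment p * normal_abs_moment (2 * q)"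
proof -
  obtain N where N: "\<And>a b p q. a \<in> Basis \<Longrightarrow> b \<in> Basis \<Longrightarrow> a \<noteq> (b::'a::euclidean_space) \<Longrightarrow> p + 2 * q = d \<Longrightarrow>
    N * sphere_moment a b p (2 * q) = normal_abs_moment p * normal_abs_moment (2 * q)"
    using sphere_moment_normal_Basis[OF dim] by metis
  obtain e f :: 'a where ef: "e \<in> Basis" "f \<in> Basis" "e \<noteq> f" "norm e = 1" "norm f = 1" "e \<bullet> f = 0"
    using obtain_orthonormal_pair[OF dim] by metis
  show ?thesis
  proof (rule that[of N])
    fix a b :: 'a and p q
    assume "norm a = 1" "norm b = 1" "a \<bullet> b = 0" "p + 2 * q = d"
    then show "N * sphere_moment a b p (2 * q) = normal_abs_moment p * normal_abs_moment (2 * q)"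
      using N[of e f p q] ef sphere_moment_pair[of a b e f p "2 * q"] by simp
  qed
qed

lemma normal_abs_moment_odd_pos: "normal_abs_moment (Suc (2 * k)) > 0"
  unfolding normal_abs_moment_odd by simp

lemma sphere_moment_odd_pos:
  fixes a :: "'a::euclidean_space"
  assumes dim: "2 \<le> DIM('a)" and a: "norm a = 1"
  shows "(\<integral>\<^sub>S x. \<bar>x \<bullet> a\<bar> ^ Suc (2 * k)) > 0"
proof -
  obtain e f :: 'a where ef: "norm e = 1" "norm f = 1" "e \<bullet> f = 0"
    using obtain_orthonormal_pair[OF dim] by metis
  obtain N where "N * sphere_moment e f (Suc (2 * k)) 0 = normal_abs_moment (Suc (2 * k)) * normal_abs_moment 0"
    using sphere_moment_normal[OF dim, of "Suc (2 * k)"] ef by (metis add.right_neutral mult_0_right)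
  then have "sphere_moment e f (Suc (2 * k)) 0 \<noteq> 0"
    using normal_abs_moment_odd_pos[of k] normal_abs_moment_even[of 0] by auto
  moreover have "(\<integral>\<^sub>S x. \<bar>x \<bullet> a\<bar> ^ Suc (2 * k)) \<ge> 0" by (rule integral_nonneg_AE) simp
  ultimately show ?thesis using sphere_moment_0[OF ef(1,2) a, of "Suc (2 * k)"] by linarith
qed

text \<open>With p = 2k + 1, multiplying by the sum of all squared coordinates, which is 1, writes
  the moment of order p as the one of order p + 2 plus n - 1 equal mixed moments. Both kinds have
  degree p + 2, and the Gaussian recursion puts them in the ratio p + 1 to 1.\<close>

lemma sphere_moment_odd_rec:
  fixes a :: "'a::euclidean_space"
  assumes dim: "2 \<le> DIM('a)" and a: "norm a = 1"
  shows "(DIM('a) + real (Suc (2 * k))) * (\<integral>\<^sub>S x. \<bar>x \<bullet> a\<bar> ^ Suc (2 * Suc k)) =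
    (2 * real k + 2) * (\<integral>\<^sub>S x. \<bar>x \<bullet> a\<bar> ^ Suc (2 * k))"
proof -
  obtain e f :: 'a where ef: "e \<in> Basis" "f \<in> Basis" "e \<noteq> f" "norm e = 1" "norm f = 1" "e \<bullet> f = 0"
    using obtain_orthonormal_pair[OF dim] by metis
  define I where "I p = sphere_moment e f p 0" for p
  define p where "p = Suc (2 * k)"
  obtain N where N: "\<And>a b p' q. norm a = 1 \<Longrightarrow> norm b = 1 \<Longrightarrow> a \<bullet> (b::'a) = 0 \<Longrightarrow> p' + 2 * q = p + 2 \<Longrightarrow>
    N * sphere_moment a b p' (2 * q) = normal_abs_moment p' * normal_abs_moment (2 * q)"
    using sphere_moment_normal[OF dim] by metis
  have N1: "N * I (p + 2) = normal_abs_moment (p + 2)"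
    using N[of e f "p + 2" 0] ef normal_abs_moment_even[of 0] by (simp add: I_def)
  have N2: "N * sphere_moment e f p 2 = normal_abs_moment p"
    using N[of e f p 1] ef normal_abs_moment_even[of 1] by simp
  have p2: "p + 2 = Suc (2 * Suc k)" by (simp add: p_def)
  have r: "normal_abs_moment (p + 2) = (p + 1) * normal_abs_moment p"
    unfolding p2 unfolding p_def normal_abs_moment_odd by (simp add: algebra_simps)
  have "N \<noteq> 0" using N2 normal_abs_moment_odd_pos[of k] by (auto simp: p_def)
  moreover have "N * ((p + 1) * sphere_moment e f p 2) = N * I (p + 2)"
    unfolding N1 r using N2 by (simp add: algebra_simps)
  ultimately have A: "(p + 1) * sphere_moment e f p 2 = I (p + 2)" by simp
  have i: "integrable sphere_measure (\<lambda>x. \<bar>x \<bullet> e\<bar> ^ p * (x \<bullet> b)\<^sup>2)" if "b \<in> Basis" for b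
    using integrable_sphere_moment[of e b p 2] ef that by simp
  have "I p = (\<integral>\<^sub>S x. (\<Sum>b\<in>Basis. \<bar>x \<bullet> e\<bar> ^ p * (x \<bullet> b)\<^sup>2))"
    unfolding I_def sphere_moment_def
  proof (rule integral_sphere_cong)
    fix x :: 'a assume "norm x = 1"
    then show "\<bar>x \<bullet> e\<bar> ^ p * (x \<bullet> f) ^ 0 = (\<Sum>b\<in>Basis. \<bar>x \<bullet> e\<bar> ^ p * (x \<bullet> b)\<^sup>2)"
      by (simp add: sum_distrib_left[symmetric] sum_inner_Basis_square)
  qed measurable
  also have "\<dots> = (\<Sum>b\<in>Basis. \<integral>\<^sub>S x. \<bar>x \<bullet> e\<bar> ^ p * (x \<bullet> b)\<^sup>2)"
    by (rule Bochner_Integration.integral_sum) (rule i)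
  also have "\<dots> = (\<integral>\<^sub>S x. \<bar>x \<bullet> e\<bar> ^ p * (x \<bullet> e)\<^sup>2) +
       (\<Sum>b\<in>Basis - {e}. \<integral>\<^sub>S x. \<bar>x \<bullet> e\<bar> ^ p * (x \<bullet> b)\<^sup>2)"
    using ef by (intro sum.remove) auto
  also have "(\<integral>\<^sub>S x. \<bar>x \<bullet> e\<bar> ^ p * (x \<bullet> e)\<^sup>2) = I (p + 2)"
    unfolding I_def sphere_moment_def by (simp only: power_add power2_abs) simp
  also have "(\<Sum>b\<in>Basis - {e}. \<integral>\<^sub>S x. \<bar>x \<bullet> e\<bar> ^ p * (x \<bullet> b)\<^sup>2) =
      (\<Sum>b\<in>Basis - {e}. sphere_moment e f p 2)"
  proof (rule sum.cong)
    fix b assume "b \<in> Basis - {e}"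
    then have "norm b = 1" "e \<bullet> b = 0" using ef(1) by (auto simp: inner_Basis)
    then show "(\<integral>\<^sub>S x. \<bar>x \<bullet> e\<bar> ^ p * (x \<bullet> b)\<^sup>2) = sphere_moment e f p 2"
      using sphere_moment_pair[of e b e f p 2] ef by (simp add: sphere_moment_def)
  qed simp
  also have "\<dots> = (DIM('a) - 1) * sphere_moment e f p 2" using ef dim by (simp add: of_nat_diff)
  finally have Ip: "I p = I (p + 2) + (real (DIM('a)) - 1) * sphere_moment e f p 2"
    using dim by (simp add: of_nat_diff)
  have "(p + 1) * I p = (p + 1) * I (p + 2) + (real (DIM('a)) - 1) * ((p + 1) * sphere_moment e f p 2)"
    unfolding Ip by (simp add: algebra_simps)
  then have "(DIM('a) + real p) * I (p + 2) = (p + 1) * I p" unfolding A by (simp add: algebra_simps)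
  moreover have "I q = (\<integral>\<^sub>S x. \<bar>x \<bullet> a\<bar> ^ q)" for q
    unfolding I_def using sphere_moment_0[OF ef(4,5) a] by simp
  ultimately show ?thesis unfolding p2 by (simp add: p_def algebra_simps)
qed

section \<open>The multiplier of the cosine transform\<close>

text \<open>Passing to the next coefficient multiplies by a number of absolute value at most 1, so
  the first value 1/2 dominates. That value is the one attained in degree two.\<close>

lemma gbinomial_half_bound: "\<bar>(1/2 :: real) gchoose Suc p\<bar> \<le> 1/2"
proof (induction p)
  case 0
  show ?case by simp
next
  case (Suc p)
  have "(1/2 :: real) gchoose Suc (Suc p) = ((1/2) gchoose Suc p) * ((1/2 - real (Suc p)) / real (Suc (Suc p)))"
    by (simp add: gbinomial_prod_rev)
  then have "\<bar>(1/2 :: real) gchoose Suc (Suc p)\<bar> = \<bar>(1/2) gchoose Suc p\<bar> * \<bar>(1/2 - real (Suc p)) / real (Suc (Suc p))\<bar>"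
    by (simp add: abs_mult)
  also have "\<dots> \<le> (1/2) * 1" by (intro mult_mono Suc) (auto simp: field_simps)
  finally show ?case by simp
qed

text \<open>The bracket is the ratio of a mixed moment to the pure one of the same degree. Together
  with the binomial coefficient it collapses to a single generalized binomial coefficient, so that
  the alternating sum has a closed form.\<close>

lemma binomial_fact_gbinomial:
  assumes "i \<le> p"
  shows "real ((2 * p) choose (2 * i)) * (fact (p - i) * fact (2 * i) / (4 ^ i * fact i * fact p)) =
    (real p - 1/2) gchoose i"
proof -
  have "fact (2 * p) * fact (p - i) / (fact (2 * p - 2 * i) * fact p * 4 ^ i * fact i) = (real p - 1/2) gchoose i"
    using assms
  proof (induction i)
    case (Suc i)
    have 1: "p - i = Suc (p - Suc i)" "2 * p - 2 * i = Suc (Suc (2 * p - 2 * Suc i))" using Suc.prems by auto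
    have f1: "fact (p - i) = (real p - real i) * fact (p - Suc i)"
      unfolding 1(1) using Suc.prems by (simp add: of_nat_diff)
    have f2: "fact (2 * p - 2 * i) = (2 * real p - 2 * real i) * ((2 * real p - 2 * real i - 1) * fact (2 * p - 2 * Suc i))"
      unfolding 1(2) fact_Suc using Suc.prems by (simp add: of_nat_diff algebra_simps)
    have nz: "real p - real i \<noteq> 0" "2 * real p - 2 * real i - 1 \<noteq> 0" using Suc.prems by linarith+
    have "(real p - 1/2) gchoose Suc i = ((real p - 1/2) gchoose i) * ((real p - 1/2 - real i) / real (Suc i))"
      by (simp add: gbinomial_prod_rev)
    also have "\<dots> = fact (2 * p) * fact (p - i) / (fact (2 * p - 2 * i) * fact p * 4 ^ i * fact i) * ((real p - 1/2 - real i) / real (Suc i))"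
      using Suc by simp
    also have "\<dots> = fact (2 * p) * fact (p - Suc i) / (fact (2 * p - 2 * Suc i) * fact p * 4 ^ Suc i * fact (Suc i))"
    proof -
      \<comment> \<open>Naming the four atoms keeps the factorials opaque and reduces the step to a
        rational identity.\<close>
      define A B C E :: real where "A = fact (p - Suc i)" and "B = fact (2 * p - 2 * Suc i)"
        and "C = real p - real i" and "E = 2 * real p - 2 * real i - 1"
      have e: "fact (p - i) = C * A" "fact (2 * p - 2 * i) = 2 * C * (E * B)" "real p - 1/2 - real i = E / 2"
        unfolding f1 f2 by (simp_all add: A_def B_def C_def E_def)
      have "B \<noteq> 0" "C \<noteq> 0" "E \<noteq> 0" using nz by (simp_all add: B_def C_def E_def)
      then show ?thesis unfolding e A_def[symmetric] B_def[symmetric]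
        by (simp add: divide_simps)
    qed
    finally show ?case by simp
  qed simp
  moreover have "real ((2 * p) choose (2 * i)) = fact (2 * p) / (fact (2 * i) * fact (2 * p - 2 * i))"
    using assms by (subst binomial_fact) auto
  moreover have "fact (2 * p) / (fact (2 * i) * fact (2 * p - 2 * i)) * (fact (p - i) * fact (2 * i) / (4 ^ i * fact i * fact p)) =
      (fact (2 * p) * fact (p - i) / (fact (2 * p - 2 * i) * fact p * 4 ^ i * fact i) :: real)"
    by (simp add: divide_simps)
  ultimately show ?thesis by (simp only:)
qed

text \<open>The sum is the leading coefficient of the transform of
  \<open>(x \<bullet> a) ^ (2 * p)\<close>, before division by the mean of \<bar>x \<bullet>
  a\<bar>. It equals \<open>I p\<close> times the generalized binomial coefficient of 1/2 over p.
  The recursion for k = 0 says that (n + 1) times the degree-two value \<open>I 1 / 2\<close> is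
  exactly \<open>I 0\<close>, so strictness for p \<ge> 2 comes from the decrease of the moments
  \<open>I\<close>.\<close>

lemma sphere_multiplier_bound:
  fixes a b :: "'a::euclidean_space"
  assumes dim: "2 \<le> DIM('a)" and ab: "norm a = 1" "norm b = 1" "a \<bullet> b = 0" and p: "p \<ge> 2"
  shows "(DIM('a) + 1) * \<bar>\<Sum>i\<le>p. real ((2 * p) choose (2 * i)) * (-1) ^ i * sphere_moment a b (Suc (2 * (p - i))) (2 * i)\<bar>
    < (\<integral>\<^sub>S x. \<bar>x \<bullet> a\<bar>)"
proof -
  define I where "I k = (\<integral>\<^sub>S x. \<bar>x \<bullet> a\<bar> ^ Suc (2 * k))" for k
  have Ipos: "I k > 0" for k unfolding I_def by (rule sphere_moment_odd_pos[OF dim ab(1)])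
  have Irec: "(DIM('a) + real (Suc (2 * k))) * I (Suc k) = (2 * real k + 2) * I k" for k
    unfolding I_def by (rule sphere_moment_odd_rec[OF dim ab(1)])
  have Istep: "I (Suc k) < I k" for k
  proof -
    have "(2 * real k + 2) * I (Suc k) < (DIM('a) + real (Suc (2 * k))) * I (Suc k)"
      using Ipos[of "Suc k"] dim by (intro mult_strict_right_mono) auto
    then have "(2 * real k + 2) * I (Suc k) < (2 * real k + 2) * I k" unfolding Irec .
    then show ?thesis by simp
  qed
  have "I (Suc (Suc k)) < I 1" for k
    by (induction k) (use Istep in \<open>force intro: less_trans\<close>)+
  then have I1: "I p < I 1" using p by (metis Suc_le_D numeral_2_eq_2 Suc_le_mono)
  obtain N where N: "\<And>p' q. p' + 2 * q = Suc (2 * p) \<Longrightarrow>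
    N * sphere_moment a b p' (2 * q) = normal_abs_moment p' * normal_abs_moment (2 * q)"
    using sphere_moment_normal[OF dim] ab by metis
  have NI: "N * I p = sqrt (2 / pi) * 2 ^ p * fact p"
    using N[of "Suc (2 * p)" 0] normal_abs_moment_even[of 0] normal_abs_moment_odd[of p]
    by (simp add: I_def sphere_moment_def)
  then have N0: "N \<noteq> 0" by auto
  have M: "sphere_moment a b (Suc (2 * (p - i))) (2 * i) = I p * (fact (p - i) * fact (2 * i) / (4 ^ i * fact i * fact p))"
    if "i \<le> p" for i
  proof -
    have "N * sphere_moment a b (Suc (2 * (p - i))) (2 * i) =
        sqrt (2 / pi) * 2 ^ (p - i) * fact (p - i) * (fact (2 * i) / (2 ^ i * fact i))"
      using N[of "Suc (2 * (p - i))" i] that by (simp add: normal_abs_moment_odd normal_abs_moment_even)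
    also have "(2::real) ^ (p - i) = 2 ^ p / 2 ^ i" using that by (simp add: power_diff)
    also have "sqrt (2 / pi) * (2 ^ p / 2 ^ i) * fact (p - i) * (fact (2 * i) / (2 ^ i * fact i)) =
      (sqrt (2 / pi) * 2 ^ p * fact p) * (fact (p - i) * fact (2 * i) / ((2 ^ i * 2 ^ i) * fact i * fact p))"
      by (simp add: field_simps)
    also have "(2::real) ^ i * 2 ^ i = 4 ^ i" by (simp add: power_mult_distrib[symmetric])
    finally have "N * sphere_moment a b (Suc (2 * (p - i))) (2 * i) =
        (sqrt (2 / pi) * 2 ^ p * fact p) * (fact (p - i) * fact (2 * i) / (4 ^ i * fact i * fact p))" .
    then have "N * sphere_moment a b (Suc (2 * (p - i))) (2 * i) =
        N * (I p * (fact (p - i) * fact (2 * i) / (4 ^ i * fact i * fact p)))"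
      unfolding NI[symmetric] by (simp only: mult.assoc)
    then show ?thesis using N0 by (simp only: mult_left_cancel[OF N0])
  qed
  have "(\<Sum>i\<le>p. real ((2 * p) choose (2 * i)) * (-1) ^ i * sphere_moment a b (Suc (2 * (p - i))) (2 * i)) =
      (\<Sum>i\<le>p. I p * (((real p - 1/2) gchoose i) * (-1) ^ i))"
    by (intro sum.cong refl) (simp add: M binomial_fact_gbinomial[symmetric])
  also have "\<dots> = I p * ((-1) ^ p * ((real p - 3/2) gchoose p))"
    unfolding sum_distrib_left[symmetric] gbinomial_sum_lower_neg by (simp add: algebra_simps)
  \<comment> \<open>Negating the upper index sends p - 3/2 to p - (p - 3/2) - 1 = 1/2; the two signs
    (-1) to the power p then cancel.\<close>
  also have "(real p - 3/2) gchoose p = (-1) ^ p * ((1/2) gchoose p)"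
    by (subst gbinomial_negated_upper) simp
  finally have "\<bar>\<Sum>i\<le>p. real ((2 * p) choose (2 * i)) * (-1) ^ i * sphere_moment a b (Suc (2 * (p - i))) (2 * i)\<bar>
      = I p * \<bar>(1/2) gchoose p\<bar>" using Ipos[of p] by (simp add: abs_mult power_abs)
  also have "\<dots> \<le> I p * (1/2)"
    using gbinomial_half_bound[of "p - 1"] p Ipos[of p] by (intro mult_left_mono) auto
  finally have "(DIM('a) + 1) * \<bar>\<Sum>i\<le>p. real ((2 * p) choose (2 * i)) * (-1) ^ i * sphere_moment a b (Suc (2 * (p - i))) (2 * i)\<bar>
      \<le> (DIM('a) + 1) * (I p * (1/2))" by (intro mult_left_mono) auto
  also have "\<dots> < (DIM('a) + 1) * (I 1 * (1/2))" using I1 by (intro mult_strict_left_mono) auto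
  also have "\<dots> = I 0" using Irec[of 0] by (simp add: algebra_simps)
  finally show ?thesis by (simp add: I_def)
qed


section \<open>The cosine transform\<close>

lemma sphere_Fubini:
  fixes F :: "'a::euclidean_space \<Rightarrow> 'a \<Rightarrow> real"
  assumes F[measurable]: "case_prod F \<in> borel_measurable (borel \<Otimes>\<^sub>M borel)"
    and B: "\<And>x y. norm x = 1 \<Longrightarrow> norm y = 1 \<Longrightarrow> \<bar>F x y\<bar> \<le> B"
  shows "(\<integral>\<^sub>S x. \<integral>\<^sub>S y. F x y) = (\<integral>\<^sub>S y. \<integral>\<^sub>S x. F x y)"
proof -
  interpret S: prob_space "sphere_measure :: 'a measure" by (rule prob_space_sphere_measure)
  interpret P: pair_prob_space "sphere_measure :: 'a measure" "sphere_measure :: 'a measure" ..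
  have "AE z in sphere_measure \<Otimes>\<^sub>M sphere_measure. norm (fst z :: 'a) = 1 \<and> norm (snd z :: 'a) = 1"
  proof (rule P.AE_pair_measure)
    show "AE x in sphere_measure. AE y in sphere_measure. norm (fst (x :: 'a, y :: 'a)) = 1 \<and> norm (snd (x, y)) = 1"
      using AE_sphere_measure[where 'a='a] by (auto elim!: eventually_mono)
  qed measurable
  then have "AE z in sphere_measure \<Otimes>\<^sub>M sphere_measure. norm (case_prod F z) \<le> B"
  proof eventually_elim
    case (elim z)
    then show ?case using B[of "fst z" "snd z"] by (simp add: case_prod_beta)
  qed
  then have "integrable (sphere_measure \<Otimes>\<^sub>M sphere_measure) (case_prod F)"
    by (intro P.P.integrable_const_bound[of _ B]) auto
  from P.Fubini_integral[OF this] show ?thesis ..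
qed

lemma sum_even_indices:
  fixes F :: "nat \<Rightarrow> real"
  assumes "\<And>k. odd k \<Longrightarrow> F k = 0"
  shows "(\<Sum>k\<le>2 * p. F k) = (\<Sum>i\<le>p. F (2 * i))"
  using assms by (induction p) auto

lemma obtain_orthogonal_unit:
  fixes y :: "'a::euclidean_space"
  assumes dim: "2 \<le> DIM('a)" and y: "norm y = 1"
  obtains b where "norm b = 1" "y \<bullet> b = 0"
proof -
  obtain e f :: 'a where ef: "norm e = 1" "norm f = 1" "e \<bullet> f = 0"
    using obtain_orthonormal_pair[OF dim] by metis
  obtain T where T: "orthogonal_transformation T" "T e = y"
    using orthogonal_transformation_reflection[of e y] ef y by metis
  show ?thesis
    using that[of "T f"] T ef orthogonal_transformation_norm[OF T(1), of f]
    by (metis orthogonal_transformation_def)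
qed

section \<open>Cosine transforms of even powers\<close>

text \<open>Split \<open>a\<close> into its component along \<open>y\<close> and an orthogonal one,
  and expand binomially. By rotation invariance the resulting moments do not depend on
  \<open>y\<close> or \<open>a\<close>, so the right-hand side is a polynomial in
  \<open>y \<bullet> a\<close> with constant coefficients.\<close>

lemma integral_sphere_abs_inner_power:
  fixes y a e f :: "'a::euclidean_space"
  assumes dim: "2 \<le> DIM('a)" and y: "norm y = 1" and a: "norm a = 1"
    and ef: "norm e = 1" "norm f = 1" "e \<bullet> f = 0"
  shows "(\<integral>\<^sub>S x. \<bar>x \<bullet> y\<bar> * (x \<bullet> a) ^ (2 * p)) =
    (\<Sum>i\<le>p. real ((2 * p) choose (2 * i)) * sphere_moment e f (Suc (2 * (p - i))) (2 * i) *
      ((y \<bullet> a) ^ (2 * (p - i)) * (1 - (y \<bullet> a)\<^sup>2) ^ i))"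
proof -
  define s where "s = y \<bullet> a"
  have yy: "y \<bullet> y = 1" "a \<bullet> a = 1" using y a by (auto simp: norm_eq_1)
  obtain t b where b: "norm b = 1" "y \<bullet> b = 0" "a = s *\<^sub>R y + t *\<^sub>R b" and t: "t\<^sup>2 = 1 - s\<^sup>2"
  proof (cases "a = s *\<^sub>R y")
    \<comment> \<open>Here \<open>a\<close> is \<open>y\<close> or \<open>-y\<close>: the orthogonal
      component vanishes, and any unit vector orthogonal to \<open>y\<close> can serve as
      \<open>b\<close> with t = 0.\<close>
    case True
    then have "a \<bullet> a = s\<^sup>2 * (y \<bullet> y)" by (simp add: power2_eq_square)
    then have "s\<^sup>2 = 1" using yy by simp
    moreover obtain b where "norm b = 1" "y \<bullet> b = 0" using obtain_orthogonal_unit[OF dim y] by metis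
    ultimately show ?thesis using that[of b 0] True by simp
  next
    case False
    define t where "t = norm (a - s *\<^sub>R y)"
    have t0: "t \<noteq> 0" using False by (simp add: t_def)
    have "t\<^sup>2 = (a - s *\<^sub>R y) \<bullet> (a - s *\<^sub>R y)" by (simp add: t_def power2_norm_eq_inner)
    also have "\<dots> = 1 - s\<^sup>2" using yy by (simp add: inner_diff inner_commute s_def power2_eq_square algebra_simps)
    finally have t2: "t\<^sup>2 = 1 - s\<^sup>2" .
    show ?thesis
    proof (rule that[of "(1 / t) *\<^sub>R (a - s *\<^sub>R y)" t])
      show "norm ((1 / t) *\<^sub>R (a - s *\<^sub>R y)) = 1" using t0 by (simp add: t_def)
      show "y \<bullet> (1 / t) *\<^sub>R (a - s *\<^sub>R y) = 0" using yy by (simp add: inner_diff_right s_def)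
      show "a = s *\<^sub>R y + t *\<^sub>R (1 / t) *\<^sub>R (a - s *\<^sub>R y)" using t0 by simp
    qed (rule t2)
  qed
  define G where "G k = (\<integral>\<^sub>S x. \<bar>x \<bullet> y\<bar> * (x \<bullet> y) ^ (2 * p - k) * (x \<bullet> b) ^ k)" for k
  have int: "integrable sphere_measure (\<lambda>x. \<bar>x \<bullet> y\<bar> * (x \<bullet> y) ^ (2 * p - k) * (x \<bullet> b) ^ k)" for k
  proof (rule integrable_sphere_measure[where B=1])
    fix x :: 'a assume "norm x = 1"
    then show "\<bar>\<bar>x \<bullet> y\<bar> * (x \<bullet> y) ^ (2 * p - k) * (x \<bullet> b) ^ k\<bar> \<le> 1"
      using unit_inner_le[of x] y b by (auto simp: abs_mult power_abs intro!: mult_le_one power_le_one)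
  qed measurable
  \<comment> \<open>The pairs (y, b) and (y, -b) are both orthonormal, hence have the same moments,
    while an odd power changes sign.\<close>
  have odd: "G k = 0" if "odd k" for k
  proof -
    have "G k = (\<integral>\<^sub>S x. \<bar>x \<bullet> y\<bar> * (x \<bullet> y) ^ (2 * p - k) * (x \<bullet> (-b)) ^ k)"
      unfolding G_def
      using integral_sphere_pair[of y b y "-b" "\<lambda>s t. \<bar>s\<bar> * s ^ (2 * p - k) * t ^ k"] y b by simp
    also have "\<dots> = - G k" using that by (simp add: G_def power_minus_odd)
    finally show ?thesis by simp
  qed
  have even: "G (2 * i) = sphere_moment e f (Suc (2 * (p - i))) (2 * i)" if "i \<le> p" for i
  proof -
    have "2 * p - 2 * i = 2 * (p - i)" by simp
    then have "G (2 * i) = sphere_moment y b (Suc (2 * (p - i))) (2 * i)"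
      unfolding G_def sphere_moment_def by (simp add: power_mult)
    then show ?thesis using sphere_moment_pair[OF y b(1,2) ef] by simp
  qed
  have "(\<integral>\<^sub>S x. \<bar>x \<bullet> y\<bar> * (x \<bullet> a) ^ (2 * p)) =
    (\<integral>x. (\<Sum>k\<le>2 * p. (real ((2 * p) choose k) * t ^ k * s ^ (2 * p - k)) *
       (\<bar>x \<bullet> y\<bar> * (x \<bullet> y) ^ (2 * p - k) * (x \<bullet> b) ^ k)) \<partial>sphere_measure)"
  proof (rule Bochner_Integration.integral_cong)
    fix x :: 'a
    have "(x \<bullet> a) ^ (2 * p) = (t * (x \<bullet> b) + s * (x \<bullet> y)) ^ (2 * p)"
      by (subst b(3)) (simp add: inner_add_right add.commute)
    then have e: "(x \<bullet> a) ^ (2 * p) = (\<Sum>k\<le>2 * p. real ((2 * p) choose k) * (t * (x \<bullet> b)) ^ k * (s * (x \<bullet> y)) ^ (2 * p - k))"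
      by (simp only: binomial_ring)
    show "\<bar>x \<bullet> y\<bar> * (x \<bullet> a) ^ (2 * p) = (\<Sum>k\<le>2 * p. (real ((2 * p) choose k) * t ^ k * s ^ (2 * p - k)) *
       (\<bar>x \<bullet> y\<bar> * (x \<bullet> y) ^ (2 * p - k) * (x \<bullet> b) ^ k))"
      unfolding e sum_distrib_left
      by (intro sum.cong) (auto simp: sum_distrib_left power_mult_distrib mult_ac)
  qed simp
  also have "\<dots> = (\<Sum>k\<le>2 * p. (real ((2 * p) choose k) * t ^ k * s ^ (2 * p - k)) * G k)"
    unfolding G_def using int by (subst Bochner_Integration.integral_sum) auto
  also have "\<dots> = (\<Sum>i\<le>p. (real ((2 * p) choose (2 * i)) * t ^ (2 * i) * s ^ (2 * p - 2 * i)) * G (2 * i))"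
    using odd by (intro sum_even_indices) auto
  also have "\<dots> = (\<Sum>i\<le>p. real ((2 * p) choose (2 * i)) * sphere_moment e f (Suc (2 * (p - i))) (2 * i) *
      (s ^ (2 * (p - i)) * (1 - s\<^sup>2) ^ i))"
  proof (intro sum.cong refl)
    fix i assume "i \<in> {..p}"
    moreover have "2 * p - 2 * i = 2 * (p - i)" by simp
    moreover have "t ^ (2 * i) = (1 - s\<^sup>2) ^ i" by (simp add: power_mult t)
    ultimately show "real ((2 * p) choose (2 * i)) * t ^ (2 * i) * s ^ (2 * p - 2 * i) * G (2 * i) =
      real ((2 * p) choose (2 * i)) * sphere_moment e f (Suc (2 * (p - i))) (2 * i) * (s ^ (2 * (p - i)) * (1 - s\<^sup>2) ^ i)"
      using even by simp
  qed
  finally show ?thesis unfolding s_def .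
qed

text \<open>In the expansion of the power of 1 - (x \<bullet> a)^2 every term but the last has
  degree below 2p and integrates to zero. This is why only the leading coefficient of a transformed
  power matters. Peeling off one factor raises \<open>l\<close>, which therefore varies in the
  induction.\<close>

lemma integral_sphere_lower_moments_vanish:
  fixes f :: "'a::euclidean_space \<Rightarrow> real"
  assumes f[measurable]: "f \<in> borel_measurable borel" and B: "\<And>x. norm x = 1 \<Longrightarrow> \<bar>f x\<bar> \<le> B"
    and a: "norm a = 1" and z: "\<And>j. j < p \<Longrightarrow> (\<integral>\<^sub>S x. f x * (x \<bullet> a) ^ (2 * j)) = 0"
    and "l + i \<le> p"
  shows "(\<integral>\<^sub>S x. f x * ((x \<bullet> a) ^ (2 * l) * (1 - (x \<bullet> a)\<^sup>2) ^ i)) =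
    (-1) ^ i * (\<integral>\<^sub>S x. f x * (x \<bullet> a) ^ (2 * (l + i)))"
  using \<open>l + i \<le> p\<close>
proof (induction i arbitrary: l)
  case (Suc i)
  have int: "integrable sphere_measure (\<lambda>x. f x * ((x \<bullet> a) ^ (2 * l) * (1 - (x \<bullet> a)\<^sup>2) ^ i))" for l
  proof (rule integrable_sphere_measure)
    fix x :: 'a assume x: "norm x = 1"
    then have "\<bar>x \<bullet> a\<bar> \<le> 1" using unit_inner_le a by blast
    then have "\<bar>(x \<bullet> a) ^ (2 * l)\<bar> \<le> 1" "\<bar>(1 - (x \<bullet> a)\<^sup>2) ^ i\<bar> \<le> 1"
      by (auto simp: power_abs abs_square_le_1 intro!: power_le_one)
    then have "\<bar>f x\<bar> * (\<bar>(x \<bullet> a) ^ (2 * l)\<bar> * \<bar>(1 - (x \<bullet> a)\<^sup>2) ^ i\<bar>) \<le> B * 1"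
      using B[OF x] by (intro mult_mono mult_le_one) auto
    then show "\<bar>f x * ((x \<bullet> a) ^ (2 * l) * (1 - (x \<bullet> a)\<^sup>2) ^ i)\<bar> \<le> B" by (simp add: abs_mult)
  qed measurable
  have "(\<integral>\<^sub>S x. f x * ((x \<bullet> a) ^ (2 * l) * (1 - (x \<bullet> a)\<^sup>2) ^ Suc i)) =
    (\<integral>\<^sub>S x. f x * ((x \<bullet> a) ^ (2 * l) * (1 - (x \<bullet> a)\<^sup>2) ^ i) - f x * ((x \<bullet> a) ^ (2 * Suc l) * (1 - (x \<bullet> a)\<^sup>2) ^ i))"
    by (intro Bochner_Integration.integral_cong) (auto simp: algebra_simps power2_eq_square)
  also have "\<dots> = (-1) ^ i * (\<integral>\<^sub>S x. f x * (x \<bullet> a) ^ (2 * (l + i))) -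
     (-1) ^ i * (\<integral>\<^sub>S x. f x * (x \<bullet> a) ^ (2 * (Suc l + i)))"
    using Suc.prems Suc.IH[of l] Suc.IH[of "Suc l"] int[of l] int[of "Suc l"]
    by (subst Bochner_Integration.integral_diff) auto
  also have "(\<integral>\<^sub>S x. f x * (x \<bullet> a) ^ (2 * (l + i))) = 0"
    using Suc.prems by (intro z) auto
  finally show ?case by simp
qed simp

definition cosine_transform :: "('a::euclidean_space \<Rightarrow> real) \<Rightarrow> 'a \<Rightarrow> real" where
  "cosine_transform f x = (\<integral>\<^sub>S y. \<bar>x \<bullet> y\<bar> * f y)"

text \<open>The constant value on the sphere of the transform of 1; dividing by it makes the
  transform fix constants. \<open>SOME\<close> merely picks a unit vector, whose choice is
  immaterial by rotation invariance.\<close>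

definition cosine_mean :: "'a::euclidean_space itself \<Rightarrow> real" where
  "cosine_mean _ = cosine_transform (\<lambda>_. 1) (SOME b :: 'a. b \<in> Basis)"

lemma cosine_transform_1:
  fixes x :: "'a::euclidean_space"
  assumes "norm x = 1"
  shows "cosine_transform (\<lambda>_. 1) x = cosine_mean TYPE('a)"
proof -
  have "(SOME b :: 'a. b \<in> Basis) \<in> Basis" using nonempty_Basis by (metis some_in_eq)
  then have n: "norm (SOME b :: 'a. b \<in> Basis) = 1" by simp
  have "cosine_transform (\<lambda>_. 1) y = sphere_moment x x 1 0" if "norm y = 1" for y :: 'a
    using sphere_moment_0[OF assms assms that, of 1] by (simp add: cosine_transform_def inner_commute)
  from this[OF assms] this[OF n] show ?thesis by (simp add: cosine_mean_def)
qed

lemma cosine_mean_pos: 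
  assumes "2 \<le> DIM('a::euclidean_space)"
  shows "cosine_mean TYPE('a::euclidean_space) > 0"
proof -
  obtain e :: 'a where e: "norm e = 1" using obtain_orthonormal_pair[OF assms] by metis
  show ?thesis using sphere_moment_odd_pos[OF assms e, of 0]
    by (simp add: cosine_transform_1[OF e, symmetric] cosine_transform_def inner_commute)
qed

lemma borel_measurable_cosine_transform [measurable]:
  fixes f :: "'a::euclidean_space \<Rightarrow> real"
  assumes [measurable]: "f \<in> borel_measurable borel"
  shows "cosine_transform f \<in> borel_measurable borel"
proof -
  interpret S: prob_space "sphere_measure :: 'a measure" by (rule prob_space_sphere_measure)
  show ?thesis unfolding cosine_transform_def[abs_def]
    by (rule S.borel_measurable_lebesgue_integral) measurable
qed

lemma integrable_cosine_kernel:
  fixes f :: "'a::euclidean_space \<Rightarrow> real"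
  assumes f[measurable]: "f \<in> borel_measurable borel" and B: "\<And>x. norm x = 1 \<Longrightarrow> \<bar>f x\<bar> \<le> B"
  shows "integrable sphere_measure (\<lambda>y. \<bar>x \<bullet> y\<bar> * f y)"
proof (rule integrable_sphere_measure)
  fix y :: 'a assume y: "norm y = 1"
  have "\<bar>x \<bullet> y\<bar> * \<bar>f y\<bar> \<le> norm x * B"
    using B[OF y] Cauchy_Schwarz_ineq2[of x y] y by (intro mult_mono) auto
  then show "\<bar>\<bar>x \<bullet> y\<bar> * f y\<bar> \<le> norm x * B" by (simp add: abs_mult)
qed measurable

text \<open>The kernel is nonnegative with total mass \<open>cosine_mean\<close>, so the normalized
  transform does not increase the sup norm.\<close>

lemma cosine_transform_le:
  fixes f :: "'a::euclidean_space \<Rightarrow> real"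
  assumes f[measurable]: "f \<in> borel_measurable borel" and B: "\<And>x. norm x = 1 \<Longrightarrow> \<bar>f x\<bar> \<le> B" and x: "norm x = 1"
  shows "\<bar>cosine_transform f x\<bar> \<le> B * cosine_mean TYPE('a)"
proof -
  have c: "integrable sphere_measure (\<lambda>y. \<bar>x \<bullet> y\<bar> * c)" for c
    by (rule integrable_cosine_kernel[of "\<lambda>_. c" "\<bar>c\<bar>"]) auto
  have i: "integrable sphere_measure (\<lambda>y. \<bar>x \<bullet> y\<bar> * f y)" using integrable_cosine_kernel[OF f B] .
  have e: "(\<integral>\<^sub>S y. \<bar>x \<bullet> y\<bar> * c) = c * cosine_mean TYPE('a)" for c
    using cosine_transform_1[OF x] by (simp add: cosine_transform_def mult.commute)
  have "cosine_transform f x \<le> (\<integral>\<^sub>S y. \<bar>x \<bullet> y\<bar> * B)" unfolding cosine_transform_def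
    using B by (intro integral_sphere_mono i c mult_left_mono) (auto simp: abs_le_iff)
  moreover have "(\<integral>\<^sub>S y. \<bar>x \<bullet> y\<bar> * (- B)) \<le> cosine_transform f x" unfolding cosine_transform_def
    using B by (intro integral_sphere_mono i c mult_left_mono) (force simp: abs_le_iff)+
  ultimately show ?thesis unfolding e by linarith
qed

lemma integral_cosine_transform:
  fixes f :: "'a::euclidean_space \<Rightarrow> real"
  assumes f[measurable]: "f \<in> borel_measurable borel" and B: "\<And>x. norm x = 1 \<Longrightarrow> \<bar>f x\<bar> \<le> B"
    and g[measurable]: "g \<in> borel_measurable borel" and C: "\<And>x. norm x = 1 \<Longrightarrow> \<bar>g x\<bar> \<le> C"
  shows "(\<integral>\<^sub>S x. g x * cosine_transform f x) = (\<integral>\<^sub>S x. f x * cosine_transform g x)"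
proof -
  have "(\<integral>\<^sub>S x. g x * cosine_transform f x) = (\<integral>\<^sub>S x. \<integral>\<^sub>S y. g x * (\<bar>x \<bullet> y\<bar> * f y))"
    unfolding cosine_transform_def by simp
  also have "\<dots> = (\<integral>\<^sub>S y. \<integral>\<^sub>S x. g x * (\<bar>x \<bullet> y\<bar> * f y))"
  proof (rule sphere_Fubini)
    fix x y :: 'a assume xy: "norm x = 1" "norm y = 1"
    have "\<bar>g x\<bar> * (\<bar>x \<bullet> y\<bar> * \<bar>f y\<bar>) \<le> C * (1 * B)"
      using B[OF xy(2)] C[OF xy(1)] unit_inner_le[OF xy] by (intro mult_mono) auto
    then show "\<bar>g x * (\<bar>x \<bullet> y\<bar> * f y)\<bar> \<le> C * (1 * B)" by (simp add: abs_mult)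
  qed measurable
  also have "\<dots> = (\<integral>\<^sub>S y. f y * (\<integral>\<^sub>S x. \<bar>y \<bullet> x\<bar> * g x))"
    by (simp add: inner_commute mult_ac flip: integral_mult_right_zero)
  finally show ?thesis unfolding cosine_transform_def .
qed

text \<open>Moving the transform from f to the power of \<open>x \<bullet> a\<close> expresses the
  moment \<open>M\<close> as a multiple of itself, the lower moments being zero by induction. The
  cases p = 0 and p = 1 are assumed because their factors n + 1 and 1 carry no information; for p
  \<ge> 2 the factor is below 1 in absolute value.\<close>

lemma sphere_moments_vanish:
  fixes f :: "'a::euclidean_space \<Rightarrow> real"
  assumes dim: "2 \<le> DIM('a)"
    and f[measurable]: "f \<in> borel_measurable borel" and B: "\<And>x. norm x = 1 \<Longrightarrow> \<bar>f x\<bar> \<le> B"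
    and fp: "\<And>x. norm x = 1 \<Longrightarrow> f x = (DIM('a) + 1) / cosine_mean TYPE('a) * cosine_transform f x"
    and m0: "(\<integral>\<^sub>S x. f x) = 0"
    and m2: "(\<integral>\<^sub>S x. f x * (x \<bullet> a)\<^sup>2) = 0" and a: "norm a = 1"
  shows "(\<integral>\<^sub>S x. f x * (x \<bullet> a) ^ (2 * p)) = 0"
proof (induction p rule: less_induct)
  case (less p)
  define M where "M = (\<integral>\<^sub>S x. f x * (x \<bullet> a) ^ (2 * p))"
  consider "p = 0" | "p = 1" | "p \<ge> 2" by linarith
  then show ?case
  proof cases
    case 3
    obtain e g :: 'a where ef: "norm e = 1" "norm g = 1" "e \<bullet> g = 0"
      using obtain_orthonormal_pair[OF dim] by metis
    define D where "D = (DIM('a) + 1) / cosine_mean TYPE('a)"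
    have D: "D > 0" using cosine_mean_pos[OF dim] by (simp add: D_def)
    have pow: "\<bar>(x \<bullet> a) ^ (2 * p)\<bar> \<le> 1" if "norm x = 1" for x p
      using unit_inner_le[OF that a] by (auto simp: power_abs intro: power_le_one)
    define c where "c i = real ((2 * p) choose (2 * i)) * sphere_moment e g (Suc (2 * (p - i))) (2 * i)" for i
    define q where "q i x = (x \<bullet> a) ^ (2 * (p - i)) * (1 - (x \<bullet> a)\<^sup>2) ^ i" for i x
    have qm[measurable]: "q i \<in> borel_measurable borel" for i unfolding q_def by measurable
    have qint: "integrable sphere_measure (\<lambda>x. f x * q i x)" for i
    proof (rule integrable_sphere_measure[where B = B])
      fix x :: 'a assume x: "norm x = 1"
      have "\<bar>q i x\<bar> \<le> 1" unfolding q_def abs_mult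
        using pow[OF x] unit_inner_le[OF x a]
        by (intro mult_le_one) (auto simp: power_abs abs_square_le_1 intro!: power_le_one)
      then have "\<bar>f x\<bar> * \<bar>q i x\<bar> \<le> B * 1" using B[OF x] by (intro mult_mono) auto
      then show "\<bar>f x * q i x\<bar> \<le> B" by (simp add: abs_mult)
    qed measurable
    have "M = (\<integral>\<^sub>S x. (x \<bullet> a) ^ (2 * p) * (D * cosine_transform f x))"
      unfolding M_def D_def by (rule integral_sphere_cong) (auto simp: fp)
    also have "\<dots> = D * (\<integral>\<^sub>S x. (x \<bullet> a) ^ (2 * p) * cosine_transform f x)"
      by (simp add: mult.left_commute)
    also have "(\<integral>\<^sub>S x. (x \<bullet> a) ^ (2 * p) * cosine_transform f x) =
       (\<integral>\<^sub>S x. f x * cosine_transform (\<lambda>x. (x \<bullet> a) ^ (2 * p)) x)"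
      by (rule integral_cosine_transform[OF f B _ pow]) auto
    also have "\<dots> = (\<integral>\<^sub>S x. (\<Sum>i\<le>p. c i * (f x * q i x)))"
    proof (rule integral_sphere_cong)
      fix y :: 'a assume y: "norm y = 1"
      have "cosine_transform (\<lambda>x. (x \<bullet> a) ^ (2 * p)) y = (\<Sum>i\<le>p. c i * q i y)"
        unfolding cosine_transform_def c_def q_def
        using integral_sphere_abs_inner_power[OF dim y a ef, of p] by (simp add: inner_commute[of y])
      then show "f y * cosine_transform (\<lambda>x. (x \<bullet> a) ^ (2 * p)) y = (\<Sum>i\<le>p. c i * (f y * q i y))"
        by (simp add: sum_distrib_left mult_ac)
    qed measurable
    also have "\<dots> = (\<Sum>i\<le>p. c i * (\<integral>\<^sub>S x. f x * q i x))"
      using qint by (subst Bochner_Integration.integral_sum) auto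
    also have "\<dots> = (\<Sum>i\<le>p. c i * ((-1) ^ i * M))"
    proof (intro sum.cong refl)
      fix i assume "i \<in> {..p}"
      then show "c i * (\<integral>\<^sub>S x. f x * q i x) = c i * ((-1) ^ i * M)"
        using integral_sphere_lower_moments_vanish[OF f B a less.IH, of p "p - i" i]
        unfolding q_def M_def by simp
    qed
    finally have "M = D * (\<Sum>i\<le>p. real ((2 * p) choose (2 * i)) * (-1) ^ i * sphere_moment e g (Suc (2 * (p - i))) (2 * i)) * M"
      (is "M = D * ?S * M")
      unfolding mult.assoc sum_distrib_right by (simp add: c_def mult_ac)
    moreover have "\<bar>D * ?S\<bar> < 1"
    proof -
      have "(DIM('a) + 1) * \<bar>?S\<bar> < cosine_mean TYPE('a)"
        using sphere_multiplier_bound[OF dim ef 3] cosine_transform_1[OF ef(1)]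
        by (simp add: cosine_transform_def inner_commute)
      then have "(DIM('a) + 1) * \<bar>?S\<bar> / cosine_mean TYPE('a) < 1" using cosine_mean_pos[OF dim] by simp
      moreover have "\<bar>D * ?S\<bar> = (DIM('a) + 1) * \<bar>?S\<bar> / cosine_mean TYPE('a)"
        unfolding abs_mult abs_of_pos[OF D] by (simp add: D_def)
      ultimately show ?thesis by (simp only:)
    qed
    moreover have "M = 0" if "M = K * M" "\<bar>K\<bar> < 1" for K
      using that by (cases "M = 0") auto
    ultimately show ?thesis unfolding M_def[symmetric] by blast
  qed (use m0 m2 in simp_all)
qed

section \<open>Recovering an even function from its moments\<close>

text \<open>The part of the cone over \<open>U\<close> inside the punctured unit ball is open and
  contains a/2, so it has positive volume.\<close>

lemma sphere_measure_full_support: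
  fixes a :: "'a::euclidean_space"
  assumes U: "open U" "a \<in> U" "norm a = 1"
  shows "\<not> (AE x in sphere_measure. x \<notin> U)"
proof
  assume AE: "AE x in sphere_measure. x \<notin> U"
  have [measurable]: "U \<in> sets borel" using U by simp
  define V where "V = sgn -` U \<inter> (ball 0 1 - {0::'a})"
  have "continuous_on (ball 0 1 - {0::'a}) sgn"
    unfolding sgn_div_norm[abs_def] by (intro continuous_intros) auto
  then have op: "open V"
    unfolding V_def using continuous_on_open_vimage[of "ball 0 1 - {0::'a}" sgn] U by (simp add: open_delete)
  have [measurable]: "V \<in> sets borel" using op by simp
  have "emeasure sphere_measure U = 0"
    using AE by (subst (asm) AE_iff_null_sets[symmetric]) (auto simp: null_sets_def)
  then have "(\<integral>\<^sup>+x. indicator U x \<partial>(sphere_measure :: 'a measure)) = 0" by simp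
  then have "(\<integral>\<^sup>+x. indicator (ball 0 1) x * indicator U (sgn x) \<partial>lborel) = (0::ennreal)"
    using nn_integral_sphere_measure[of "indicator U :: 'a \<Rightarrow> ennreal"] by simp
  moreover have "(\<integral>\<^sup>+x. indicator V x \<partial>lborel) \<le> (\<integral>\<^sup>+x. indicator (ball 0 1) x * indicator U (sgn x) \<partial>lborel)"
    by (intro nn_integral_mono) (auto simp: V_def indicator_def)
  ultimately have "emeasure lborel V = 0" by simp
  then have "negligible V"
    by (auto simp: negligible_iff_null_sets null_sets_def)
  moreover have "(1/2) *\<^sub>R a \<in> V" using U by (auto simp: V_def sgn_div_norm)
  ultimately show False using open_not_negligible[OF op] by auto
qed

lemma continuous_on_sphere_bound:
  fixes f :: "'a::euclidean_space \<Rightarrow> real"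
  assumes "continuous_on (sphere 0 1) f"
  obtains B where "\<And>x. norm x = 1 \<Longrightarrow> \<bar>f x\<bar> \<le> B"
proof -
  have "bounded (f ` sphere 0 1)" by (intro compact_imp_bounded compact_continuous_image assms compact_sphere)
  then obtain B where B: "\<forall>y\<in>f ` sphere 0 1. norm y \<le> B" by (auto simp: bounded_iff)
  show ?thesis by (rule that[of B]) (use B in auto)
qed

text \<open>To reach the value at a point it suffices to test with functions of
  \<open>x \<bullet> a\<close>. Weierstrass approximation extends the vanishing from powers to all
  continuous functions. One supported on small caps around \<open>a\<close> and \<open>-a\<close>,
  where an even continuous function keeps the sign of \<open>f a\<close>, then contradicts full
  support.\<close>

lemma sphere_moments_determine:
  fixes f :: "'a::euclidean_space \<Rightarrow> real"
  assumes f[measurable]: "f \<in> borel_measurable borel" and cont: "continuous_on (sphere 0 1) f"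
    and even: "\<And>x. norm x = 1 \<Longrightarrow> f (- x) = f x"
    and mom: "\<And>p a. norm a = 1 \<Longrightarrow> (\<integral>\<^sub>S x. f x * (x \<bullet> a) ^ (2 * p)) = 0"
    and a: "norm a = 1"
  shows "f a = 0"
proof (rule ccontr)
  assume fa: "f a \<noteq> 0"
  obtain B where B: "\<And>x. norm x = 1 \<Longrightarrow> \<bar>f x\<bar> \<le> B"
    using continuous_on_sphere_bound[OF cont] by metis
  have B0: "B \<ge> 0" using B[OF a] by linarith
  have intp: "integrable sphere_measure (\<lambda>x. f x * (x \<bullet> a) ^ k)" for k
    by (rule integrable_sphere_measure[OF _ abs_mult_inner_power_le[OF _ a B]]) auto
  have mom': "(\<integral>\<^sub>S x. f x * (x \<bullet> a) ^ k) = 0" for k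
  proof (cases "even k")
    case True
    then show ?thesis using mom[OF a] by (auto elim!: evenE)
  next
    case False
    \<comment> \<open>The antipodal map preserves the measure, so odd moments of an even function
      vanish.\<close>
    have "(\<integral>\<^sub>S x. f (- x) * ((- x) \<bullet> a) ^ k) = (\<integral>\<^sub>S x. f x * (x \<bullet> a) ^ k)"
      by (rule integral_sphere_orthogonal[of uminus "\<lambda>x. f x * (x \<bullet> a) ^ k"]) 
        (auto simp: orthogonal_transformation_def linear_uminus)
    moreover have "(\<integral>\<^sub>S x. f (- x) * ((- x) \<bullet> a) ^ k) = (\<integral>\<^sub>S x. - (f x * (x \<bullet> a) ^ k))"
      using False by (intro integral_sphere_cong) (auto simp: even power_minus_odd)
    ultimately show ?thesis by simp
  qed
  have zero: "(\<integral>\<^sub>S x. f x * g (x \<bullet> a)) = 0" if g: "continuous_on UNIV g" for g :: "real \<Rightarrow> real"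
  proof -
    have [measurable]: "g \<in> borel_measurable borel" using g by (rule borel_measurable_continuous_onI)
    have "\<bar>\<integral>\<^sub>S x. f x * g (x \<bullet> a)\<bar> \<le> B * e" if e: "e > 0" for e
    proof -
      obtain P where P: "real_polynomial_function P" "\<And>t. t \<in> {-1..1} \<Longrightarrow> \<bar>g t - P t\<bar> < e"
        using Stone_Weierstrass_real_polynomial_function[of "{-1..1}" g e] g e continuous_on_subset by blast
      obtain c n where Pc: "P = (\<lambda>t. \<Sum>i\<le>n. c i * t ^ i)"
        using P(1) unfolding real_polynomial_function_iff_sum by blast
      have [measurable]: "P \<in> borel_measurable borel" unfolding Pc by measurable
      have fP: "(\<lambda>x. f x * P (x \<bullet> a)) = (\<lambda>x. \<Sum>i\<le>n. c i * (f x * (x \<bullet> a) ^ i))"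
        by (auto simp: Pc sum_distrib_left mult_ac)
      have iP: "integrable sphere_measure (\<lambda>x. f x * P (x \<bullet> a))"
        unfolding fP by (intro Bochner_Integration.integrable_sum integrable_mult_right intp)
      have P0: "(\<integral>\<^sub>S x. f x * P (x \<bullet> a)) = 0"
        unfolding fP using intp by (subst Bochner_Integration.integral_sum) (auto simp: mom')
      have bd: "\<bar>f x * (g (x \<bullet> a) - P (x \<bullet> a))\<bar> \<le> B * e" if x: "norm x = 1" for x
      proof -
        have "x \<bullet> a \<in> {-1..1}" using unit_inner_le[OF x a] by auto
        from P(2)[OF this] show ?thesis unfolding abs_mult using B[OF x] by (intro mult_mono) auto
      qed
      have iD: "integrable sphere_measure (\<lambda>x. f x * (g (x \<bullet> a) - P (x \<bullet> a)))"
        using bd by (intro integrable_sphere_measure) auto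
      have "(\<integral>\<^sub>S x. f x * g (x \<bullet> a)) =
         (\<integral>\<^sub>S x. f x * P (x \<bullet> a) + f x * (g (x \<bullet> a) - P (x \<bullet> a)))"
        by (intro Bochner_Integration.integral_cong) (auto simp: algebra_simps)
      also have "\<dots> = (\<integral>\<^sub>S x. f x * P (x \<bullet> a)) + (\<integral>\<^sub>S x. f x * (g (x \<bullet> a) - P (x \<bullet> a)))"
        by (rule Bochner_Integration.integral_add[OF iP iD])
      finally have "(\<integral>\<^sub>S x. f x * g (x \<bullet> a)) = (\<integral>\<^sub>S x. f x * (g (x \<bullet> a) - P (x \<bullet> a)))"
        by (simp add: P0)
      then show ?thesis
        using abs_integral_sphere_le[of "\<lambda>x. f x * (g (x \<bullet> a) - P (x \<bullet> a))" "B * e"] bd by simp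
    qed
    then have "\<bar>\<integral>\<^sub>S x. f x * g (x \<bullet> a)\<bar> \<le> 0 + e" if "e > 0" for e
    proof -
      \<comment> \<open>Dividing by \<open>B + 1\<close> instead of \<open>B\<close> covers the case
        \<open>B = 0\<close>.\<close>
      have "B * (e / (B + 1)) \<le> e" using that B0 by (simp add: field_simps)
      moreover have "e / (B + 1) > 0" using that B0 by simp
      ultimately show ?thesis using \<open>\<And>e. e > 0 \<Longrightarrow> _ \<le> B * e\<close>[of "e / (B + 1)"] by linarith
    qed
    then have "\<bar>\<integral>\<^sub>S x. f x * g (x \<bullet> a)\<bar> \<le> 0" by (rule field_le_epsilon)
    then show ?thesis by simp
  qed
  obtain \<delta> where \<delta>: "\<delta> > 0" "\<And>x. norm x = 1 \<Longrightarrow> dist x a < \<delta> \<Longrightarrow> \<bar>f x - f a\<bar> < \<bar>f a\<bar>"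
    using cont[unfolded continuous_on_iff, rule_format, of a "\<bar>f a\<bar>"] fa a by (auto simp: dist_real_def)
  have pos: "f a * f x > 0" if "norm x = 1" "dist x a < \<delta>" for x
    using \<delta>(2)[OF that] fa by (auto simp: abs_if zero_less_mult_iff split: if_splits)
  \<comment> \<open>For unit vectors the squared distance is 2 - 2 (z \<bullet> a), so
    \<open>z \<bullet> a > c\<close> says exactly that z lies within \<delta> of
    \<open>a\<close>.\<close>
  define c where "c = 1 - \<delta>\<^sup>2 / 2"
  define g where "g t = max 0 (\<bar>t\<bar> - c)" for t
  have near: "f a * f x > 0" if x: "norm x = 1" and xc: "\<bar>x \<bullet> a\<bar> > c" for x
  proof -
    have *: "dist z a < \<delta>" if z: "norm z = 1" "z \<bullet> a > c" for z
    proof -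
      have "(dist z a)\<^sup>2 = 2 - 2 * (z \<bullet> a)"
        using z a by (simp add: dist_norm power2_norm_eq_inner inner_diff inner_commute norm_eq_1)
      also have "\<dots> < \<delta>\<^sup>2" using z by (simp add: c_def)
      finally show ?thesis using \<delta>(1) by (simp add: power2_less_imp_less)
    qed
    show ?thesis
    proof (cases "x \<bullet> a > 0")
      case True then show ?thesis using pos[OF x *[OF x]] xc by simp
    next
      case False
      then have "(- x) \<bullet> a > c" using xc by simp
      then show ?thesis using pos[of "- x"] *[of "- x"] x even[OF x] by simp
    qed
  qed
  have [measurable]: "g \<in> borel_measurable borel" unfolding g_def by measurable
  have gc: "continuous_on UNIV g" unfolding g_def by (intro continuous_intros)
  have "(\<integral>\<^sub>S x. f a * (f x * g (x \<bullet> a))) = 0" using zero[OF gc] by simp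
  moreover have nn: "AE x in sphere_measure. 0 \<le> f a * (f x * g (x \<bullet> a))"
    using AE_sphere_measure
  proof eventually_elim
    case (elim x)
    show ?case
    proof (cases "\<bar>x \<bullet> a\<bar> > c")
      case True then show ?thesis using near[OF elim True] by (simp add: g_def mult.assoc[symmetric])
    qed (simp add: g_def)
  qed
  moreover have "integrable sphere_measure (\<lambda>x. f a * (f x * g (x \<bullet> a)))"
  proof (intro integrable_mult_right integrable_sphere_measure)
    fix x :: 'a assume x: "norm x = 1"
    have "c \<ge> 1 - \<delta>\<^sup>2 / 2" by (simp add: c_def)
    then have "\<bar>g (x \<bullet> a)\<bar> \<le> 1 + \<bar>c\<bar>" using unit_inner_le[OF x a] by (auto simp: g_def)
    then show "\<bar>f x * g (x \<bullet> a)\<bar> \<le> B * (1 + \<bar>c\<bar>)" unfolding abs_mult using B[OF x] by (intro mult_mono) auto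
  qed measurable
  ultimately have AE0: "AE x in sphere_measure. f a * (f x * g (x \<bullet> a)) = 0"
    using integral_nonneg_eq_0_iff_AE by blast
  have "AE x in sphere_measure. x \<notin> {x. \<bar>x \<bullet> a\<bar> > c}"
    using AE0 AE_sphere_measure
  proof eventually_elim
    case (elim x)
    show ?case
    proof
      assume "x \<in> {x. \<bar>x \<bullet> a\<bar> > c}"
      then have "f a * f x > 0" "g (x \<bullet> a) > 0" using near elim by (auto simp: g_def)
      then show False using elim by auto
    qed
  qed
  moreover have "open {x. \<bar>x \<bullet> a\<bar> > c}" by (intro open_Collect_less continuous_intros)
  moreover have "a \<in> {x. \<bar>x \<bullet> a\<bar> > c}" using a \<delta>(1) by (simp add: norm_eq_1 c_def)
  ultimately show False using sphere_measure_full_support a by blast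
qed

text \<open>The kernel is 1-Lipschitz in its first argument. This smoothing serves twice: as
  equicontinuity in the compactness argument, and as the slope bound for the support function of a
  solution.\<close>

lemma cosine_transform_Lipschitz:
  fixes f :: "'a::euclidean_space \<Rightarrow> real"
  assumes f: "f \<in> borel_measurable borel" and B: "\<And>x. norm x = 1 \<Longrightarrow> \<bar>f x\<bar> \<le> B"
  shows "\<bar>cosine_transform f x - cosine_transform f y\<bar> \<le> B * norm (x - y)"
proof -
  have [measurable]: "f \<in> borel_measurable borel" by (rule f)
  have "cosine_transform f x - cosine_transform f y = (\<integral>\<^sub>S z. \<bar>x \<bullet> z\<bar> * f z - \<bar>y \<bullet> z\<bar> * f z)"
    unfolding cosine_transform_def
    by (rule Bochner_Integration.integral_diff[symmetric]; rule integrable_cosine_kernel[OF f B])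
  also have "\<bar>\<dots>\<bar> \<le> B * norm (x - y)"
  proof (rule abs_integral_sphere_le)
    fix z :: 'a assume z: "norm z = 1"
    have "\<bar>\<bar>x \<bullet> z\<bar> - \<bar>y \<bullet> z\<bar>\<bar> \<le> \<bar>(x - y) \<bullet> z\<bar>" by (simp add: inner_diff_left abs_triangle_ineq3)
    also have "\<dots> \<le> norm (x - y)" using Cauchy_Schwarz_ineq2[of "x - y" z] z by simp
    finally have "\<bar>\<bar>x \<bullet> z\<bar> - \<bar>y \<bullet> z\<bar>\<bar> * \<bar>f z\<bar> \<le> norm (x - y) * B"
      using B[OF z] by (intro mult_mono) auto
    then show "\<bar>\<bar>x \<bullet> z\<bar> * f z - \<bar>y \<bullet> z\<bar> * f z\<bar> \<le> B * norm (x - y)"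
      unfolding left_diff_distrib[symmetric] abs_mult by (simp only: mult.commute)
  qed measurable
  finally show ?thesis .
qed

lemma cosine_fixed_point_eq_0:
  fixes f :: "'a::euclidean_space \<Rightarrow> real"
  assumes dim: "2 \<le> DIM('a)"
    and f: "f \<in> borel_measurable borel" and cont: "continuous_on (sphere 0 1) f"
    and even: "\<And>x. norm x = 1 \<Longrightarrow> f (- x) = f x"
    and fp: "\<And>x. norm x = 1 \<Longrightarrow> f x = (DIM('a) + 1) / cosine_mean TYPE('a) * cosine_transform f x"
    and m0: "(\<integral>\<^sub>S x. f x) = 0"
    and m2: "\<And>a. norm a = 1 \<Longrightarrow> (\<integral>\<^sub>S x. f x * (x \<bullet> a)\<^sup>2) = 0"
    and a: "norm a = 1"
  shows "f a = 0"
proof -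
  obtain B where B: "\<And>x. norm x = 1 \<Longrightarrow> \<bar>f x\<bar> \<le> B"
    using continuous_on_sphere_bound[OF cont] by metis
  show ?thesis
    using sphere_moments_vanish[OF dim f B fp m0 m2]
    by (intro sphere_moments_determine[OF f cont even _ a]) auto
qed

lemma cosine_transform_diff:
  fixes f g :: "'a::euclidean_space \<Rightarrow> real"
  assumes "f \<in> borel_measurable borel" "\<And>x. norm x = 1 \<Longrightarrow> \<bar>f x\<bar> \<le> B"
    and "g \<in> borel_measurable borel" "\<And>x. norm x = 1 \<Longrightarrow> \<bar>g x\<bar> \<le> C"
  shows "cosine_transform (\<lambda>x. f x - g x) x = cosine_transform f x - cosine_transform g x"
  unfolding cosine_transform_def right_diff_distrib
  by (intro Bochner_Integration.integral_diff integrable_cosine_kernel[OF assms(1,2)] integrable_cosine_kernel[OF assms(3,4)])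

section \<open>Stability of the uniqueness\<close>

text \<open>Every clause required of \<open>g\<close> passes to uniform limits, so a uniform limit
  of approximate solutions is an exact one. The approximants need only be measurable; continuity is
  demanded of the limit alone.\<close>

lemma cosine_approximate_fixed_point:
  fixes f :: "'a::euclidean_space \<Rightarrow> real"
  assumes dim: "2 \<le> DIM('a)"
    and f[measurable]: "f \<in> borel_measurable borel" and cont: "continuous_on (sphere 0 1) f"
    and approx: "\<And>e. e > 0 \<Longrightarrow> \<exists>g. g \<in> borel_measurable borel \<and> (\<forall>x. norm x = 1 \<longrightarrow> \<bar>g x\<bar> \<le> 1) \<and>
      (\<forall>x. norm x = 1 \<longrightarrow> \<bar>f x - g x\<bar> \<le> e) \<and> (\<forall>x. norm x = 1 \<longrightarrow> g (- x) = g x) \<and>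
      (\<integral>\<^sub>S x. g x) = 0 \<and>
      (\<forall>x. norm x = 1 \<longrightarrow> \<bar>g x - (DIM('a) + 1) / cosine_mean TYPE('a) * cosine_transform g x\<bar> \<le> e) \<and>
      (\<forall>a. norm a = 1 \<longrightarrow> \<bar>\<integral>\<^sub>S x. g x * (x \<bullet> a)\<^sup>2\<bar> \<le> e)"
    and a: "norm a = 1"
  shows "f a = 0"
proof (rule cosine_fixed_point_eq_0[OF dim f cont _ _ _ _ a])
  obtain B where B: "\<And>x. norm x = 1 \<Longrightarrow> \<bar>f x\<bar> \<le> B"
    using continuous_on_sphere_bound[OF cont] by metis
  define D where "D = (DIM('a) + 1) / cosine_mean TYPE('a)"
  have D: "D > 0" "D * cosine_mean TYPE('a) = DIM('a) + 1" using cosine_mean_pos[OF dim] by (auto simp: D_def)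
  have fi: "integrable sphere_measure f" by (rule integrable_sphere_measure[OF f B])
  have absle0: "y = 0" if "\<And>e. e > 0 \<Longrightarrow> \<bar>y\<bar> \<le> c * e" "c > 0" for y c :: real
  proof -
    have "\<bar>y\<bar> \<le> 0 + e" if "e > 0" for e
      using \<open>\<And>e. e > 0 \<Longrightarrow> \<bar>y\<bar> \<le> c * e\<close>[of "e / c"] \<open>c > 0\<close> that by simp
    then have "\<bar>y\<bar> \<le> 0" by (rule field_le_epsilon)
    then show ?thesis by simp
  qed
  show "f (- x) = f x" if x: "norm x = 1" for x
  proof -
    have "f (- x) - f x = 0"
    proof (rule absle0[of _ 2])
      fix e :: real assume "e > 0"
      from approx[OF this] obtain g where g: "\<And>x. norm x = 1 \<Longrightarrow> \<bar>f x - g x\<bar> \<le> e" "\<And>x. norm x = 1 \<Longrightarrow> g (- x) = g x" by blast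
      show "\<bar>f (- x) - f x\<bar> \<le> 2 * e" using g(1)[OF x] g(1)[of "- x"] g(2)[OF x] x by auto
    qed simp
    then show ?thesis by simp
  qed
  show "(\<integral>\<^sub>S x. f x) = 0"
  proof (rule absle0[of _ 1])
    fix e :: real assume "e > 0"
    from approx[OF this] obtain g where g: "g \<in> borel_measurable borel" "\<And>x. norm x = 1 \<Longrightarrow> \<bar>g x\<bar> \<le> 1"
      "\<And>x. norm x = 1 \<Longrightarrow> \<bar>f x - g x\<bar> \<le> e" "(\<integral>\<^sub>S x. g x) = 0" by blast
    have "(\<integral>\<^sub>S x. f x - g x) = (\<integral>\<^sub>S x. f x)"
      using fi integrable_sphere_measure[OF g(1,2)] g(4) by simp
    then show "\<bar>\<integral>\<^sub>S x. f x\<bar> \<le> 1 * e"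
      using abs_integral_sphere_le[of "\<lambda>x. f x - g x" e] g by simp
  qed simp
  show "(\<integral>\<^sub>S x. f x * (x \<bullet> b)\<^sup>2) = 0" if b: "norm b = 1" for b
  proof (rule absle0[of _ 2])
    fix e :: real assume e: "e > 0"
    from approx[OF this] obtain g where g: "g \<in> borel_measurable borel" "\<And>x. norm x = 1 \<Longrightarrow> \<bar>g x\<bar> \<le> 1"
      "\<And>x. norm x = 1 \<Longrightarrow> \<bar>f x - g x\<bar> \<le> e" "\<And>a. norm a = 1 \<Longrightarrow> \<bar>\<integral>\<^sub>S x. g x * (x \<bullet> a)\<^sup>2\<bar> \<le> e" by blast
    have [measurable]: "g \<in> borel_measurable borel" by (rule g)
    have bd: "\<bar>h x * (x \<bullet> b)\<^sup>2\<bar> \<le> C" if "norm x = 1" "\<bar>h x\<bar> \<le> C" for h x C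
      by (rule abs_mult_inner_power_le[OF that(1) b that(2)])
    have i: "integrable sphere_measure (\<lambda>x. f x * (x \<bullet> b)\<^sup>2)"
      by (rule integrable_sphere_measure[where B = B]) (simp_all add: bd B)
    have j: "integrable sphere_measure (\<lambda>x. g x * (x \<bullet> b)\<^sup>2)"
      by (rule integrable_sphere_measure[where B = 1]) (simp_all add: bd g(2))
    have "(\<integral>\<^sub>S x. (f x - g x) * (x \<bullet> b)\<^sup>2) =
      (\<integral>\<^sub>S x. f x * (x \<bullet> b)\<^sup>2) - (\<integral>\<^sub>S x. g x * (x \<bullet> b)\<^sup>2)"
      unfolding left_diff_distrib by (rule Bochner_Integration.integral_diff[OF i j])
    moreover have "\<bar>\<integral>\<^sub>S x. (f x - g x) * (x \<bullet> b)\<^sup>2\<bar> \<le> e"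
      using bd[of _ "\<lambda>x. f x - g x"] g(3) by (intro abs_integral_sphere_le) auto
    ultimately show "\<bar>\<integral>\<^sub>S x. f x * (x \<bullet> b)\<^sup>2\<bar> \<le> 2 * e" using g(4)[OF b] by linarith
  qed simp
  show "f x = (DIM('a) + 1) / cosine_mean TYPE('a) * cosine_transform f x" if x: "norm x = 1" for x
  proof -
    have "f x - D * cosine_transform f x = 0"
    \<comment> \<open>One e comes from \<open>f - g\<close>, one from the defect of
      \<open>g\<close>, and n + 1 from the transform of \<open>f - g\<close>, since \<open>D\<close>
      times the mass of the kernel is n + 1.\<close>
    proof (rule absle0[of _ "2 + (DIM('a) + 1)"])
      fix e :: real assume e: "e > 0"
      from approx[OF this] obtain g where g: "g \<in> borel_measurable borel" "\<And>x. norm x = 1 \<Longrightarrow> \<bar>g x\<bar> \<le> 1"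
        "\<And>x. norm x = 1 \<Longrightarrow> \<bar>f x - g x\<bar> \<le> e" "\<And>x. norm x = 1 \<Longrightarrow> \<bar>g x - D * cosine_transform g x\<bar> \<le> e"
        unfolding D_def by blast
      have "\<bar>cosine_transform (\<lambda>x. f x - g x) x\<bar> \<le> e * cosine_mean TYPE('a)"
        using g by (intro cosine_transform_le x) auto
      then have "D * \<bar>cosine_transform f x - cosine_transform g x\<bar> \<le> D * (e * cosine_mean TYPE('a))"
        using D(1) by (simp only: cosine_transform_diff[OF f B g(1,2)] mult_left_mono less_imp_le)
      also have "D * (e * cosine_mean TYPE('a)) = (DIM('a) + 1) * e" using D(2) by (metis mult.assoc mult.commute)
      finally have "\<bar>D * cosine_transform f x - D * cosine_transform g x\<bar> \<le> (DIM('a) + 1) * e"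
        unfolding right_diff_distrib[symmetric] abs_mult using D(1) by simp
      then show "\<bar>f x - D * cosine_transform f x\<bar> \<le> (2 + (DIM('a) + 1)) * e"
        using g(3)[OF x] g(4)[OF x] by (simp add: algebra_simps)
    qed simp
    then show ?thesis by (simp add: D_def)
  qed
qed

text \<open>The last conjunct says that the component of degree two of \<open>f\<close> is small.\<close>
definition almost_cosine_fixed :: "real \<Rightarrow> ('a::euclidean_space \<Rightarrow> real) \<Rightarrow> 'a \<Rightarrow> real \<Rightarrow> bool" where
  "almost_cosine_fixed \<delta> f x\<^sub>0 s \<longleftrightarrow> f \<in> borel_measurable borel \<and>
     (\<forall>x. norm x = 1 \<longrightarrow> f (- x) = f x) \<and> (\<integral>\<^sub>S x. f x) = 0 \<and>
     (\<forall>x. norm x = 1 \<longrightarrow> \<bar>f x\<bar> \<le> s) \<and> norm x\<^sub>0 = 1 \<and> \<bar>f x\<^sub>0\<bar> = s \<and>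
     (\<forall>x. norm x = 1 \<longrightarrow> \<bar>f x - (DIM('a) + 1) / cosine_mean TYPE('a) * cosine_transform f x\<bar> \<le> \<delta> * s) \<and>
     (\<forall>a. norm a = 1 \<longrightarrow> \<bar>\<integral>\<^sub>S x. f x * (x \<bullet> a)\<^sup>2\<bar> \<le> \<delta> * s)"

text \<open>Compactness of the cosine transform (Arzela--Ascoli) makes the uniqueness quantitative.\<close>
lemma cosine_stability:
  assumes dim: "2 \<le> DIM('a::euclidean_space)"
  obtains \<delta> where "\<delta> > 0" "\<And>(f :: 'a::euclidean_space \<Rightarrow> real) x\<^sub>0 s. almost_cosine_fixed \<delta> f x\<^sub>0 s \<Longrightarrow> s = 0"
proof -
  define D where "D = (DIM('a) + 1) / cosine_mean TYPE('a)"
  have D: "D > 0" "D * cosine_mean TYPE('a) = DIM('a) + 1" using cosine_mean_pos[OF dim] by (auto simp: D_def)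
  let ?P = "almost_cosine_fixed :: real \<Rightarrow> ('a \<Rightarrow> real) \<Rightarrow> 'a \<Rightarrow> real \<Rightarrow> bool"
  note P_def = almost_cosine_fixed_def[where 'a = 'a, folded D_def]
  have "\<exists>\<delta>>0. \<forall>f x\<^sub>0 s. ?P \<delta> f x\<^sub>0 s \<longrightarrow> s = 0"
  proof (rule ccontr)
    assume neg: "\<not> (\<exists>\<delta>>0. \<forall>f x\<^sub>0 s. ?P \<delta> f x\<^sub>0 s \<longrightarrow> s = 0)"
    have "\<exists>f x\<^sub>0. ?P (1 / Suc k) f x\<^sub>0 1" for k
    proof -
      obtain f x\<^sub>0 s where f: "?P (1 / Suc k) f x\<^sub>0 s" "s \<noteq> 0"
        using neg by (metis of_nat_0_less_iff zero_less_Suc zero_less_divide_1_iff)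
      then have s: "s > 0" by (auto simp: P_def)
      have [measurable]: "f \<in> borel_measurable borel" using f by (simp add: P_def)
      have c: "cosine_transform (\<lambda>x. f x / s) x = cosine_transform f x / s" for x
        by (simp add: cosine_transform_def)
      \<comment> \<open>All clauses are homogeneous in f and s jointly, so the counterexamples can
        be scaled to have maximum 1.\<close>
      have "?P (1 / Suc k) (\<lambda>x. f x / s) x\<^sub>0 1"
        unfolding P_def
      proof (intro conjI allI impI)
        fix x :: 'a assume x: "norm x = 1"
        have "\<bar>f x - D * cosine_transform f x\<bar> \<le> 1 / Suc k * s" using f x by (auto simp: P_def)
        moreover have "f x / s - D * cosine_transform (\<lambda>x. f x / s) x = (f x - D * cosine_transform f x) / s"
          unfolding c by (simp add: diff_divide_distrib)
        ultimately show "\<bar>f x / s - D * cosine_transform (\<lambda>x. f x / s) x\<bar> \<le> 1 / Suc k * 1"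
          using s by (simp only: abs_divide abs_of_pos pos_divide_le_eq mult_1_right)
        have "\<bar>\<integral>\<^sub>S y. f y * (y \<bullet> x)\<^sup>2\<bar> \<le> 1 / Suc k * s" using f x by (auto simp: P_def)
        then show "\<bar>\<integral>\<^sub>S y. f y / s * (y \<bullet> x)\<^sup>2\<bar> \<le> 1 / Suc k * 1"
          using s by (simp add: abs_divide field_simps)
      qed (use f s in \<open>auto simp: P_def\<close>)
      then show ?thesis by blast
    qed
    then obtain F X where FX: "\<And>k. ?P (1 / Suc k) (F k) (X k) 1" by metis
    have Fm: "F k \<in> borel_measurable borel" and F1: "norm x = 1 \<Longrightarrow> \<bar>F k x\<bar> \<le> 1" for k x
      using FX[of k] by (auto simp: P_def)
    \<comment> \<open>The functions \<open>F k\<close> are only known to be measurable and bounded;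
      their transforms are equicontinuous, and \<open>F k\<close> differs from \<open>U k\<close> by
      at most 1/(k + 1).\<close>
    define U where "U k x = D * cosine_transform (F k) x" for k x
    have Ul: "\<bar>U k x - U k y\<bar> \<le> D * norm (x - y)" for k x y
      using cosine_transform_Lipschitz[OF Fm[of k] F1, of x y] D(1)
      by (simp add: U_def right_diff_distrib[symmetric] abs_mult)
    obtain g r where g: "continuous_on (sphere 0 1) g" "strict_mono (r :: nat \<Rightarrow> nat)"
       "\<And>e. 0 < e \<Longrightarrow> \<exists>N. \<forall>n x. n \<ge> N \<and> x \<in> sphere 0 1 \<longrightarrow> norm (U (r n) x - g x) < e"
    proof (rule Arzela_Ascoli[of "sphere (0::'a) 1" U "DIM('a) + 1"])
      show "norm (U n x) \<le> DIM('a) + 1" if "x \<in> sphere 0 1" for n x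
        using cosine_transform_le[OF Fm[of n] F1, of x] that D
        by (simp add: U_def abs_mult) (metis mult_left_mono less_imp_le)
      show "\<exists>d>0. \<forall>n y. y \<in> sphere 0 1 \<and> norm (x - y) < d \<longrightarrow> norm (U n x - U n y) < e" if "0 < e" for x :: 'a and e
      proof (intro exI conjI allI impI)
        show "e / D > 0" using D that by simp
        fix n :: nat and y :: 'a assume "y \<in> sphere 0 1 \<and> norm (x - y) < e / D"
        then have "D * norm (x - y) < e" using D by (simp add: field_simps)
        then show "norm (U n x - U n y) < e" using Ul[of n x y] by simp
      qed
    qed auto
    \<comment> \<open>The limit is controlled on the sphere only; extending it by zero makes it
      Borel measurable on the whole space.\<close>
    define G where "G x = indicator (sphere 0 1) x *\<^sub>R g x" for x
    have Gg: "G x = g x" if "norm x = 1" for x using that by (simp add: G_def)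
    have Gm: "G \<in> borel_measurable borel"
      unfolding G_def by (rule borel_measurable_continuous_on_indicator[OF _ g(1)]) simp
    have Gc: "continuous_on (sphere 0 1) G"
      using g(1) by (rule continuous_on_eq) (simp add: Gg)
    have approx: "\<exists>k. (1 / Suc k \<le> e) \<and> (\<forall>x. norm x = 1 \<longrightarrow> \<bar>G x - F k x\<bar> \<le> e)" if e: "e > 0" for e
    proof -
      obtain N where N: "\<And>n x. n \<ge> N \<Longrightarrow> norm x = 1 \<Longrightarrow> \<bar>U (r n) x - g x\<bar> < e / 2"
        using g(3)[of "e / 2"] e by auto
      obtain M where M: "1 / Suc M < e / 2" using e nat_approx_posE[of "e / 2"] by auto
      define k where "k = r (max N M)"
      have "M \<le> k" using seq_suble[OF g(2), of "max N M"] by (simp add: k_def)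
      then have k: "1 / Suc k < e / 2" using M by (meson frac_le le_less_trans of_nat_0_less_iff of_nat_mono Suc_le_mono zero_less_Suc zero_le_one order_refl)
      show ?thesis
      proof (intro exI[of _ k] conjI allI impI)
        show "1 / Suc k \<le> e" using k e by linarith
        fix x :: 'a assume x: "norm x = 1"
        have "\<bar>F k x - U k x\<bar> \<le> 1 / Suc k" using FX[of k] x by (auto simp: P_def U_def)
        moreover have "\<bar>U k x - G x\<bar> < e / 2" using N[of "max N M" x] x by (simp add: k_def Gg)
        ultimately show "\<bar>G x - F k x\<bar> \<le> e" using k by linarith
      qed
    qed
    have G0: "G a = 0" if "norm a = 1" for a
    proof (rule cosine_approximate_fixed_point[OF dim Gm Gc _ that])
      fix e :: real assume "e > 0"
      then obtain k where k: "1 / Suc k \<le> e" "\<And>x. norm x = 1 \<Longrightarrow> \<bar>G x - F k x\<bar> \<le> e" using approx by blast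
      show "\<exists>g. g \<in> borel_measurable borel \<and> (\<forall>x. norm x = 1 \<longrightarrow> \<bar>g x\<bar> \<le> 1) \<and>
        (\<forall>x. norm x = 1 \<longrightarrow> \<bar>G x - g x\<bar> \<le> e) \<and> (\<forall>x. norm x = 1 \<longrightarrow> g (- x) = g x) \<and>
        (\<integral>\<^sub>S x. g x) = 0 \<and>
        (\<forall>x. norm x = 1 \<longrightarrow> \<bar>g x - (DIM('a) + 1) / cosine_mean TYPE('a) * cosine_transform g x\<bar> \<le> e) \<and>
        (\<forall>a. norm a = 1 \<longrightarrow> \<bar>\<integral>\<^sub>S x. g x * (x \<bullet> a)\<^sup>2\<bar> \<le> e)"
        using FX[of k] k unfolding P_def D_def[symmetric] by (intro exI[of _ "F k"]) (force intro: order_trans)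
    qed
    \<comment> \<open>The limit is zero on the sphere, yet some \<open>F k\<close> within 1/2 of it
      has absolute value 1 at \<open>X k\<close>.\<close>
    obtain k where k: "\<And>x. norm x = 1 \<Longrightarrow> \<bar>G x - F k x\<bar> \<le> 1 / 2" using approx[of "1/2"] by auto
    have "norm (X k) = 1" "\<bar>F k (X k)\<bar> = 1" using FX[of k] by (auto simp: P_def)
    then show False using k[of "X k"] G0[of "X k"] by auto
  qed
  then show ?thesis using that by blast
qed


section \<open>Bodies close to the ball\<close>

lemma convex_body_nonempty: "convex_body K \<Longrightarrow> K \<noteq> {}"
  using interior_subset by (auto simp: convex_body_def)

lemma convex_body_compact: "convex_body K \<Longrightarrow> compact K"
  by (simp add: convex_body_def)

lemma support_function_bdd_above:
  fixes K :: "'a::euclidean_space set"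
  assumes "compact K"
  shows "bdd_above ((\<lambda>x. x \<bullet> u) ` K)"
proof -
  have "compact ((\<lambda>x. x \<bullet> u) ` K)" by (intro compact_continuous_image assms continuous_intros)
  then show ?thesis by (simp add: bounded_imp_bdd_above compact_imp_bounded)
qed

lemma support_function_upper:
  fixes K :: "'a::euclidean_space set"
  assumes "compact K" "x \<in> K"
  shows "x \<bullet> u \<le> support_function K u"
  unfolding support_function_def using assms by (intro cSUP_upper support_function_bdd_above)

lemma support_function_least:
  fixes K :: "'a::euclidean_space set"
  assumes "K \<noteq> {}" "\<And>x. x \<in> K \<Longrightarrow> x \<bullet> u \<le> B"
  shows "support_function K u \<le> B"
  unfolding support_function_def using assms by (intro cSUP_least)

lemma support_function_Lipschitz:
  fixes K :: "'a::euclidean_space set"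
  assumes K: "compact K" "K \<noteq> {}" and R: "\<And>x. x \<in> K \<Longrightarrow> norm x \<le> R"
  shows "\<bar>support_function K u - support_function K v\<bar> \<le> R * norm (u - v)"
proof -
  have "support_function K u \<le> support_function K v + R * norm (u - v)" for u v
  proof (rule support_function_least[OF K(2)])
    fix x assume x: "x \<in> K"
    have "x \<bullet> u = x \<bullet> v + x \<bullet> (u - v)" by (simp add: inner_diff_right)
    also have "x \<bullet> (u - v) \<le> norm x * norm (u - v)" by (rule norm_cauchy_schwarz)
    also have "norm x * norm (u - v) \<le> R * norm (u - v)" using R[OF x] by (intro mult_right_mono) auto
    finally show "x \<bullet> u \<le> support_function K v + R * norm (u - v)"
      using support_function_upper[OF K(1) x, of v] by linarith
  qed
  from this[of u v] this[of v u] show ?thesis by (simp add: norm_minus_commute)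
qed

lemma continuous_support_function:
  fixes K :: "'a::euclidean_space set"
  assumes K: "compact K" "K \<noteq> {}"
  shows "continuous_on UNIV (support_function K)"
proof -
  obtain R where R: "R > 0" "\<And>x. x \<in> K \<Longrightarrow> norm x \<le> R"
    using compact_imp_bounded[OF K(1)] bounded_pos by blast
  have "R-lipschitz_on UNIV (support_function K)"
    using support_function_Lipschitz[OF K R(2)] R(1) by (intro lipschitz_onI) (auto simp: dist_real_def dist_norm)
  then show ?thesis by (rule lipschitz_on_continuous_on)
qed

lemma support_function_minus:
  assumes "origin_symmetric K"
  shows "support_function K (- u) = support_function K u"
proof -
  have "(\<lambda>x. x \<bullet> (- u)) ` K = (\<lambda>x. x \<bullet> u) ` K"
    using assms unfolding origin_symmetric_def
    by (auto simp: image_iff) (metis inner_minus_left minus_minus)+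
  then show ?thesis unfolding support_function_def by simp
qed

text \<open>Comparison of support functions, applied to the singleton {z}.\<close>

lemma mem_by_support_function:
  fixes K :: "'a::euclidean_space set"
  assumes "convex_body K" "\<And>u. norm u = 1 \<Longrightarrow> z \<bullet> u \<le> support_function K u"
  shows "z \<in> K"
proof -
  have "{z} \<subseteq> K"
    using assms convex_body_nonempty[OF assms(1)]
    by (intro support_function_le_imp_subset) (auto simp: convex_body_def support_function_def)
  then show ?thesis by simp
qed

lemma support_function_cball: "norm u = 1 \<Longrightarrow> support_function (cball 0 1) u = 1"
proof -
  assume u: "norm u = 1"
  have "u \<bullet> u \<le> support_function (cball 0 1) u" using u by (intro support_function_upper) auto
  moreover have "support_function (cball 0 1) u \<le> 1"
  proof (rule support_function_least)
    fix x :: 'a assume "x \<in> cball 0 1"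
    then show "x \<bullet> u \<le> 1" using norm_cauchy_schwarz[of x u] u by simp
  qed simp
  ultimately show ?thesis using u by (simp add: norm_eq_1)
qed

text \<open>In the paper's notation this is \<open>\<rho>\<^bsub>K\<^esub>(\<theta>)\<^sup>n\<^sup>+\<^sup>p\<close>, where \<open>\<rho>\<^bsub>K\<^esub>\<close> is the radial function of \<open>K\<close>.\<close>
definition radial_power :: "'a::euclidean_space set \<Rightarrow> nat \<Rightarrow> 'a \<Rightarrow> real" where
  "radial_power K p \<theta> = real (DIM('a) + p) *
    enn2real (\<integral>\<^sup>+r. indicator {0<..} r * ennreal (r ^ (DIM('a) - 1 + p)) * indicator K (r *\<^sub>R \<theta>) \<partial>lborel)"

section \<open>Radial powers and integrals of homogeneous functions\<close>

lemma nn_integral_power: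
  assumes "0 \<le> v"
  shows "(\<integral>\<^sup>+r. ennreal (r ^ k) * indicator {0..v} r \<partial>lborel) = ennreal (v ^ Suc k / Suc k)"
proof -
  have "(\<integral>\<^sup>+r. ennreal (r ^ k) * indicator {0..v} r \<partial>lborel) = ennreal (v ^ Suc k / Suc k - 0 ^ Suc k / Suc k)"
  proof (rule nn_integral_FTC_Icc)
    show "((\<lambda>r. r ^ Suc k / Suc k) has_real_derivative r ^ k) (at r)" for r :: real
      using DERIV_cdivide[OF DERIV_pow[of "Suc k" r UNIV], of "Suc k"] by simp
  qed (use assms in auto)
  then show ?thesis by simp
qed

lemma radial_integral_le:
  fixes K :: "'a::euclidean_space set"
  assumes "0 \<le> v" "\<And>r. 0 < r \<Longrightarrow> r *\<^sub>R \<theta> \<in> K \<Longrightarrow> r \<le> v"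
  shows "(\<integral>\<^sup>+r. indicator {0<..} r * ennreal (r ^ k) * indicator K (r *\<^sub>R \<theta>) \<partial>lborel) \<le> ennreal (v ^ Suc k / Suc k)"
  unfolding nn_integral_power[OF assms(1), symmetric]
  using assms(2) by (intro nn_integral_mono) (auto simp: indicator_def)

lemma radial_integral_ge:
  fixes K :: "'a::euclidean_space set"
  assumes "0 \<le> u" "\<And>r. 0 < r \<Longrightarrow> r \<le> u \<Longrightarrow> r *\<^sub>R \<theta> \<in> K"
  shows "ennreal (u ^ Suc k / Suc k) \<le> (\<integral>\<^sup>+r. indicator {0<..} r * ennreal (r ^ k) * indicator K (r *\<^sub>R \<theta>) \<partial>lborel)"
  unfolding nn_integral_power[OF assms(1), symmetric]
proof (rule nn_integral_mono_AE)
  have "AE r in lborel. r \<noteq> (0::real)" by (rule AE_lborel_singleton)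
  then show "AE r in lborel. ennreal (r ^ k) * indicator {0..u} r \<le> indicator {0<..} r * ennreal (r ^ k) * indicator K (r *\<^sub>R \<theta>)"
    by eventually_elim (use assms(2) in \<open>auto simp: indicator_def\<close>)
qed

lemma radial_power_bounds:
  fixes K :: "'a::euclidean_space set"
  assumes "0 \<le> v" "\<And>r. 0 < r \<Longrightarrow> r *\<^sub>R \<theta> \<in> K \<Longrightarrow> r \<le> v"
    and "0 \<le> u" "\<And>r. 0 < r \<Longrightarrow> r \<le> u \<Longrightarrow> r *\<^sub>R \<theta> \<in> K"
  shows "u ^ (DIM('a) + p) \<le> radial_power K p \<theta>" "radial_power K p \<theta> \<le> v ^ (DIM('a) + p)"
proof -
  define k where "k = DIM('a) - 1 + p"
  have k: "DIM('a) + p = Suc k" by (simp add: k_def)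
  define W where "W = (\<integral>\<^sup>+r. indicator {0<..} r * ennreal (r ^ k) * indicator K (r *\<^sub>R \<theta>) \<partial>lborel)"
  have W: "ennreal (u ^ Suc k / Suc k) \<le> W" "W \<le> ennreal (v ^ Suc k / Suc k)"
    unfolding W_def by (rule radial_integral_ge[OF assms(3,4)] radial_integral_le[OF assms(1,2)]; assumption)+
  then have "W < top" using ennreal_less_top le_less_trans by blast
  then obtain w where w: "W = ennreal w" "w \<ge> 0" by (cases W) auto
  then have "u ^ Suc k / Suc k \<le> enn2real W" "enn2real W \<le> v ^ Suc k / Suc k"
    using W assms(1,3) by (auto simp: ennreal_le_iff2 simp del: of_nat_Suc power_Suc)
  then show "u ^ (DIM('a) + p) \<le> radial_power K p \<theta>" "radial_power K p \<theta> \<le> v ^ (DIM('a) + p)"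
    unfolding radial_power_def W_def[symmetric] k_def[symmetric] k by (simp_all add: field_simps del: of_nat_Suc)
qed

lemma borel_measurable_radial_power [measurable]:
  fixes K :: "'a::euclidean_space set"
  assumes [measurable]: "K \<in> sets borel"
  shows "radial_power K p \<in> borel_measurable borel"
  unfolding radial_power_def[abs_def] by measurable

text \<open>Homogeneity moves the power \<open>r ^ p\<close> into the radial weight, leaving a
  spherical integral against a power of the radial function. The case p = 1 gives the fixed-point
  equation, p = 2 the moment form.\<close>

lemma set_integral_polar:
  fixes K :: "'a::euclidean_space set" and G :: "'a \<Rightarrow> real"
  assumes K: "compact K" and G[measurable]: "G \<in> borel_measurable borel"
    and G0: "\<And>x. 0 \<le> G x" and hom: "\<And>r x. r > 0 \<Longrightarrow> G (r *\<^sub>R x) = r ^ p * G x"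
  shows "(LINT x:K|lborel. G x) = DIM('a) * unit_ball_vol (DIM('a)) / (DIM('a) + p) *
    (\<integral>\<^sub>S \<theta>. G \<theta> * radial_power K p \<theta>)"
proof -
  have [measurable]: "K \<in> sets borel" using K borel_compact by blast
  obtain R where R: "R > 0" "\<And>x. x \<in> K \<Longrightarrow> norm x \<le> R"
    using compact_imp_bounded[OF K] bounded_pos by blast
  define W where "W \<theta> = (\<integral>\<^sup>+r. indicator {0<..} r * ennreal (r ^ (DIM('a) - 1 + p)) * indicator K (r *\<^sub>R \<theta>) \<partial>lborel)" for \<theta>
  have fin: "W \<theta> < top" if "norm \<theta> = 1" for \<theta>
  proof -
    have "W \<theta> \<le> ennreal (R ^ Suc (DIM('a) - 1 + p) / Suc (DIM('a) - 1 + p))"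
      unfolding W_def using R(1) R(2)[of "_ *\<^sub>R \<theta>"] that by (intro radial_integral_le) force+
    then show ?thesis using ennreal_less_top le_less_trans by blast
  qed
  have "(\<integral>\<^sup>+x. ennreal (indicator K x * G x) \<partial>lborel) = ennreal (DIM('a) * unit_ball_vol (DIM('a))) *
    (\<integral>\<^sup>+\<theta>. (\<integral>\<^sup>+r. indicator {0<..} r * ennreal (r ^ (DIM('a) - 1)) * ennreal (indicator K (r *\<^sub>R \<theta>) * G (r *\<^sub>R \<theta>)) \<partial>lborel) \<partial>sphere_measure)"
    by (rule nn_integral_polar) measurable
  also have "(\<integral>\<^sup>+\<theta>. (\<integral>\<^sup>+r. indicator {0<..} r * ennreal (r ^ (DIM('a) - 1)) * ennreal (indicator K (r *\<^sub>R \<theta>) * G (r *\<^sub>R \<theta>)) \<partial>lborel) \<partial>sphere_measure)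
    = (\<integral>\<^sup>+\<theta>. ennreal (G \<theta> * radial_power K p \<theta> / (DIM('a) + p)) \<partial>sphere_measure)"
  proof (rule nn_integral_cong_AE)
    show "AE \<theta> in sphere_measure. (\<integral>\<^sup>+r. indicator {0<..} r * ennreal (r ^ (DIM('a) - 1)) * ennreal (indicator K (r *\<^sub>R \<theta>) * G (r *\<^sub>R \<theta>)) \<partial>lborel)
      = ennreal (G \<theta> * radial_power K p \<theta> / (DIM('a) + p))"
      using AE_sphere_measure
    proof eventually_elim
      case (elim \<theta>)
      have "(\<integral>\<^sup>+r. indicator {0<..} r * ennreal (r ^ (DIM('a) - 1)) * ennreal (indicator K (r *\<^sub>R \<theta>) * G (r *\<^sub>R \<theta>)) \<partial>lborel) =
         (\<integral>\<^sup>+r. indicator {0<..} r * ennreal (r ^ (DIM('a) - 1 + p)) * indicator K (r *\<^sub>R \<theta>) * ennreal (G \<theta>) \<partial>lborel)"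
      proof (rule nn_integral_cong)
        fix r :: real
        have pw: "r ^ (DIM('a) - 1 + p) = r ^ (DIM('a) - 1) * r ^ p" by (rule power_add)
        show "indicator {0<..} r * ennreal (r ^ (DIM('a) - 1)) * ennreal (indicator K (r *\<^sub>R \<theta>) * G (r *\<^sub>R \<theta>)) =
          indicator {0<..} r * ennreal (r ^ (DIM('a) - 1 + p)) * indicator K (r *\<^sub>R \<theta>) * ennreal (G \<theta>)"
          unfolding pw using G0[of \<theta>]
          by (cases "r > 0"; cases "r *\<^sub>R \<theta> \<in> K") (auto simp: hom ennreal_mult[symmetric] mult_ac)
      qed
      also have "\<dots> = W \<theta> * ennreal (G \<theta>)" unfolding W_def by (rule nn_integral_multc) measurable
      also have "W \<theta> = ennreal (radial_power K p \<theta> / (DIM('a) + p))"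
      proof -
        have "real (DIM('a) + p) \<noteq> 0" using DIM_positive[where 'a='a] by linarith
        then show ?thesis
          using fin[OF elim] unfolding radial_power_def W_def[symmetric]
          by (simp only: nonzero_mult_div_cancel_left ennreal_enn2real not_False_eq_True)
      qed
      finally show ?case using G0[of \<theta>] by (simp add: ennreal_mult'[symmetric] mult.commute)
    qed
  qed
  finally have nn: "(\<integral>\<^sup>+x. ennreal (indicator K x * G x) \<partial>lborel) = ennreal (DIM('a) * unit_ball_vol (DIM('a))) *
     (\<integral>\<^sup>+\<theta>. ennreal (G \<theta> * radial_power K p \<theta> / (DIM('a) + p)) \<partial>sphere_measure)" .
  have rp: "radial_power K p \<theta> \<ge> 0" for \<theta> unfolding radial_power_def by simp
  have "(LINT x:K|lborel. G x) = enn2real (\<integral>\<^sup>+x. ennreal (indicator K x * G x) \<partial>lborel)"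
    unfolding set_lebesgue_integral_def using G0 by (subst integral_eq_nn_integral) auto
  also have "\<dots> = DIM('a) * unit_ball_vol (DIM('a)) * enn2real (\<integral>\<^sup>+\<theta>. ennreal (G \<theta> * radial_power K p \<theta> / (DIM('a) + p)) \<partial>sphere_measure)"
    unfolding nn by (simp add: enn2real_mult)
  also have "enn2real (\<integral>\<^sup>+\<theta>. ennreal (G \<theta> * radial_power K p \<theta> / (DIM('a) + p)) \<partial>sphere_measure) =
     (\<integral>\<^sub>S \<theta>. G \<theta> * radial_power K p \<theta> / (DIM('a) + p))"
    using G0 rp by (subst integral_eq_nn_integral) auto
  finally show ?thesis by simp
qed

section \<open>Comparing radial and support functions\<close>

lemma power_Taylor_bound:
  obtains C :: real where "C \<ge> 0" "\<And>u. 0 \<le> u \<Longrightarrow> u \<le> 2 \<Longrightarrow> \<bar>u ^ N - 1 - real N * (u - 1)\<bar> \<le> C * (u - 1)\<^sup>2"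
proof -
  have "\<exists>C\<ge>0. \<forall>u. 0 \<le> u \<longrightarrow> u \<le> (2::real) \<longrightarrow> \<bar>u ^ N - 1 - real N * (u - 1)\<bar> \<le> C * (u - 1)\<^sup>2"
  proof (induction N)
    case (Suc N)
    then obtain C where C: "C \<ge> 0" "\<And>u. 0 \<le> u \<Longrightarrow> u \<le> 2 \<Longrightarrow> \<bar>u ^ N - 1 - real N * (u - 1)\<bar> \<le> C * (u - 1)\<^sup>2" by blast
    show ?case
    \<comment> \<open>The new remainder is u times the old one plus
      \<open>N * (u - 1)\<^sup>2\<close>, and u \<le> 2.\<close>
    proof (intro exI[of _ "2 * C + N"] conjI allI impI)
      fix u :: real assume u: "0 \<le> u" "u \<le> 2"
      have "u ^ Suc N - 1 - real (Suc N) * (u - 1) = u * (u ^ N - 1 - real N * (u - 1)) + N * (u - 1)\<^sup>2"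
        by (simp add: algebra_simps power2_eq_square)
      also have "\<bar>\<dots>\<bar> \<le> u * \<bar>u ^ N - 1 - real N * (u - 1)\<bar> + N * (u - 1)\<^sup>2"
        using u by (intro order_trans[OF abs_triangle_ineq]) (simp add: abs_mult)
      also have "\<dots> \<le> 2 * (C * (u - 1)\<^sup>2) + N * (u - 1)\<^sup>2"
        using C u by (intro add_mono mult_mono) auto
      finally show "\<bar>u ^ Suc N - 1 - real (Suc N) * (u - 1)\<bar> \<le> (2 * C + N) * (u - 1)\<^sup>2" by (simp add: algebra_simps)
    qed (use C in auto)
  qed (rule exI[of _ 0], auto)
  then show ?thesis using that by blast
qed

lemma power_near_1_bound:
  obtains C :: real where "C \<ge> 0" "\<And>u. 0 \<le> u \<Longrightarrow> u \<le> 2 \<Longrightarrow> \<bar>u ^ N - 1\<bar> \<le> C * \<bar>u - 1\<bar>"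
proof -
  obtain C :: real where C: "C \<ge> 0" "\<And>u. 0 \<le> u \<Longrightarrow> u \<le> 2 \<Longrightarrow> \<bar>u ^ N - 1 - real N * (u - 1)\<bar> \<le> C * (u - 1)\<^sup>2"
    using power_Taylor_bound by blast
  show ?thesis
  proof (rule that[of "C + N"])
    fix u :: real assume u: "0 \<le> u" "u \<le> 2"
    have "(u - 1)\<^sup>2 = \<bar>u - 1\<bar> * \<bar>u - 1\<bar>" by (simp add: power2_eq_square)
    also have "\<dots> \<le> 1 * \<bar>u - 1\<bar>" using u by (intro mult_right_mono) auto
    finally have "C * (u - 1)\<^sup>2 \<le> C * \<bar>u - 1\<bar>" using C(1) by (simp add: mult_left_mono)
    moreover have "\<bar>u ^ N - 1\<bar> \<le> \<bar>u ^ N - 1 - real N * (u - 1)\<bar> + \<bar>real N * (u - 1)\<bar>" by linarith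
    moreover have "\<bar>real N * (u - 1)\<bar> = real N * \<bar>u - 1\<bar>" by (simp add: abs_mult)
    ultimately show "\<bar>u ^ N - 1\<bar> \<le> (C + N) * \<bar>u - 1\<bar>"
      unfolding distrib_right using C(2)[OF u] by linarith
  qed (use C in auto)
qed

text \<open>The radial function agrees with the support function up to the square of the Lipschitz constant
  of the support function on the sphere.\<close>
lemma radial_function_ge:
  fixes K :: "'a::euclidean_space set"
  assumes K: "convex_body K" and \<theta>: "norm \<theta> = 1"
    and Lip: "\<And>\<phi>. norm \<phi> = 1 \<Longrightarrow> \<bar>support_function K \<phi> - support_function K \<theta>\<bar> \<le> l * norm (\<phi> - \<theta>)"
    and u: "u = support_function K \<theta> - 2 * l\<^sup>2" "u \<ge> 1/4"
  shows "u *\<^sub>R \<theta> \<in> K"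
proof (rule mem_by_support_function[OF K])
  fix \<phi> :: 'a assume \<phi>: "norm \<phi> = 1"
  define d where "d = norm (\<phi> - \<theta>)"
  have "d\<^sup>2 = 2 - 2 * (\<theta> \<bullet> \<phi>)"
    using \<theta> \<phi> by (simp add: d_def power2_norm_eq_inner inner_diff inner_commute norm_eq_1)
  then have ip: "\<theta> \<bullet> \<phi> = 1 - d\<^sup>2 / 2" by linarith
  \<comment> \<open>Completing the square is what fixes the constants: the loss \<open>l * d\<close>
    in the support function is at most \<open>2 * l\<^sup>2 + d\<^sup>2 / 8\<close>. The first term
    is the one subtracted in u, the second is covered by the decrease
    \<open>u * d\<^sup>2 / 2\<close> of the inner product once u \<ge> 1/4.\<close>
  have "0 \<le> 2 * (l - d / 4)\<^sup>2" by simp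
  also have "2 * (l - d / 4)\<^sup>2 = 2 * l\<^sup>2 + d\<^sup>2 / 8 - l * d" by (simp add: power2_eq_square algebra_simps)
  finally have "l * d \<le> 2 * l\<^sup>2 + d\<^sup>2 / 8" by simp
  moreover have "(1/4) * (d\<^sup>2 / 2) \<le> u * (d\<^sup>2 / 2)" using u(2) by (intro mult_right_mono) auto
  moreover have "support_function K \<theta> - l * d \<le> support_function K \<phi>"
    using Lip[OF \<phi>] by (simp add: d_def abs_le_iff)
  moreover have "u * (1 - d\<^sup>2 / 2) = u - u * (d\<^sup>2 / 2)" by (simp add: algebra_simps)
  ultimately have "u * (1 - d\<^sup>2 / 2) \<le> support_function K \<phi>"
    using u(1) by linarith
  then show "(u *\<^sub>R \<theta>) \<bullet> \<phi> \<le> support_function K \<phi>" by (simp add: ip)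
qed

lemma origin_mem_symmetric:
  assumes "convex_body K" "origin_symmetric K"
  shows "0 \<in> K"
proof -
  obtain x where "x \<in> K" using convex_body_nonempty[OF assms(1)] by blast
  then have "(1/2) *\<^sub>R x + (1/2) *\<^sub>R (- x) \<in> K"
    using assms unfolding convex_body_def origin_symmetric_def by (intro convexD) auto
  then show ?thesis by simp
qed

lemma radial_segment:
  fixes K :: "'a::euclidean_space set"
  assumes "convex K" "0 \<in> K" "u *\<^sub>R \<theta> \<in> K" "0 < r" "r \<le> u"
  shows "r *\<^sub>R \<theta> \<in> K"
proof -
  have "(r / u) *\<^sub>R (u *\<^sub>R \<theta>) + (1 - r / u) *\<^sub>R 0 \<in> K"
    using assms by (intro convexD) auto
  then show ?thesis using assms by simp
qed

lemma radial_power_between: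
  fixes K :: "'a::euclidean_space set"
  assumes K: "convex_body K" "origin_symmetric K" and \<theta>: "norm \<theta> = 1"
    and u: "0 \<le> u" "u *\<^sub>R \<theta> \<in> K"
  shows "u ^ (DIM('a) + p) \<le> radial_power K p \<theta>"
    "radial_power K p \<theta> \<le> support_function K \<theta> ^ (DIM('a) + p)"
proof -
  have 0: "0 \<in> K" by (rule origin_mem_symmetric[OF K])
  have h0: "0 \<le> support_function K \<theta>"
    using support_function_upper[OF convex_body_compact[OF K(1)] 0, of \<theta>] by simp
  have "r \<le> support_function K \<theta>" if "r *\<^sub>R \<theta> \<in> K" for r
    using support_function_upper[OF convex_body_compact[OF K(1)] that, of \<theta>] \<theta> by (simp add: norm_eq_1)
  moreover have "r *\<^sub>R \<theta> \<in> K" if "0 < r" "r \<le> u" for r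
    using radial_segment[OF _ 0 u(2) that] K(1) by (simp add: convex_body_def)
  ultimately show "u ^ (DIM('a) + p) \<le> radial_power K p \<theta>"
    "radial_power K p \<theta> \<le> support_function K \<theta> ^ (DIM('a) + p)"
    using radial_power_bounds[OF h0 _ u(1), of \<theta> K p] by blast+
qed

lemma integral_sphere_inner_square:
  fixes a :: "'a::euclidean_space"
  assumes a: "norm a = 1"
  shows "(\<integral>\<^sub>S x. (x \<bullet> a)\<^sup>2) = 1 / DIM('a)"
proof -
  have i: "integrable sphere_measure (\<lambda>x. (x \<bullet> b)\<^sup>2)" if "norm b = 1" for b :: 'a
    by (rule integrable_sphere_measure[of _ 1]) (use unit_inner_le[OF _ that] in \<open>auto simp: abs_square_le_1\<close>)
  have e: "(\<integral>\<^sub>S x. (x \<bullet> b)\<^sup>2) = (\<integral>\<^sub>S x. (x \<bullet> a)\<^sup>2)" if "norm b = 1" for b :: 'a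
    using sphere_moment_0[OF a a a, of 2] sphere_moment_0[OF a a that, of 2] by simp
  have "(\<integral>\<^sub>S x::'a. 1) = (\<integral>\<^sub>S x::'a. (\<Sum>b\<in>Basis. (x \<bullet> b)\<^sup>2))"
    by (rule integral_sphere_cong) (simp_all add: sum_inner_Basis_square)
  then have "1 = (\<integral>\<^sub>S x::'a. (\<Sum>b\<in>Basis. (x \<bullet> b)\<^sup>2))" unfolding integral_sphere_const .
  also have "\<dots> = (\<Sum>b\<in>Basis. \<integral>\<^sub>S x::'a. (x \<bullet> b)\<^sup>2)"
    by (rule Bochner_Integration.integral_sum) (simp add: i)
  also have "\<dots> = (\<Sum>b\<in>(Basis :: 'a set). \<integral>\<^sub>S x. (x \<bullet> a)\<^sup>2)"
    by (intro sum.cong) (auto simp: e)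
  finally show ?thesis by (simp add: field_simps)
qed

text \<open>A first-order estimate that needs no slope bound: the ball of radius 1 - l lies in K,
  and the radial function never exceeds the support function. It starts the bootstrap from which the
  slope bound is derived.\<close>

lemma radial_power_near_1:
  obtains C :: real where "C > 0" "\<And>(K :: 'a::euclidean_space set) l \<theta>. convex_body K \<Longrightarrow> origin_symmetric K \<Longrightarrow> l \<le> 1 \<Longrightarrow>
      (\<And>u. norm u = 1 \<Longrightarrow> \<bar>support_function K u - 1\<bar> \<le> l) \<Longrightarrow> norm \<theta> = 1 \<Longrightarrow> \<bar>radial_power K p \<theta> - 1\<bar> \<le> C * l"
proof -
  define N where "N = DIM('a) + p"
  obtain C :: real where C: "C \<ge> 0" "\<And>u. 0 \<le> u \<Longrightarrow> u \<le> 2 \<Longrightarrow> \<bar>u ^ N - 1\<bar> \<le> C * \<bar>u - 1\<bar>"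
    using power_near_1_bound by blast
  show ?thesis
  proof (rule that[of "C + 1"])
    show "C + 1 > 0" using C(1) by simp
    fix K :: "'a set" and l and \<theta> :: 'a
    assume K: "convex_body K" "origin_symmetric K" and l: "l \<le> 1"
      and h: "\<And>u. norm u = 1 \<Longrightarrow> \<bar>support_function K u - 1\<bar> \<le> l" and \<theta>: "norm \<theta> = 1"
    have l0: "0 \<le> l" using h[OF \<theta>] by linarith
    have "(1 - l) *\<^sub>R \<theta> \<in> K"
    proof (rule mem_by_support_function[OF K(1)])
      fix u :: 'a assume u: "norm u = 1"
      have "(1 - l) * (\<theta> \<bullet> u) \<le> (1 - l) * 1"
        using unit_inner_le[OF \<theta> u] l by (intro mult_left_mono) auto
      then show "(1 - l) *\<^sub>R \<theta> \<bullet> u \<le> support_function K u" using h[OF u] by simp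
    qed
    then have "(1 - l) ^ N \<le> radial_power K p \<theta>" "radial_power K p \<theta> \<le> support_function K \<theta> ^ N"
      using radial_power_between[OF K \<theta>, of "1 - l" p] l by (simp_all add: N_def)
    moreover have "\<bar>(1 - l) ^ N - 1\<bar> \<le> C * \<bar>1 - l - 1\<bar>" using l l0 by (intro C(2)) auto
    moreover have "\<bar>support_function K \<theta> ^ N - 1\<bar> \<le> C * \<bar>support_function K \<theta> - 1\<bar>"
      using h[OF \<theta>] l by (intro C(2)) auto
    moreover have "C * \<bar>support_function K \<theta> - 1\<bar> \<le> C * l" using h[OF \<theta>] C by (intro mult_left_mono) auto
    moreover have "C * \<bar>1 - l - 1\<bar> = C * l" "(C + 1) * l = C * l + l" using l0 by (auto simp: algebra_simps)
    ultimately show "\<bar>radial_power K p \<theta> - 1\<bar> \<le> (C + 1) * l" using l0 by linarith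
  qed
qed

text \<open>\<open>s\<close> bounds the deviation from the ball and \<open>L * s\<close> the slope.
  Of the smallness conditions, the first two keep the inner radius
  \<open>u = h - 2 * (L * s)\<^sup>2\<close> above 1/4, and the third makes its correction at most
  s, so that u stays within 2s of 1.\<close>

definition nearly_round :: "real \<Rightarrow> real \<Rightarrow> 'a::euclidean_space set \<Rightarrow> bool" where
  "nearly_round L s K \<longleftrightarrow> convex_body K \<and> origin_symmetric K \<and>
     s \<le> 1/4 \<and> 2 * L\<^sup>2 * s\<^sup>2 \<le> 1/4 \<and> 2 * L\<^sup>2 * s \<le> 1 \<and>
     (\<forall>\<phi>. norm \<phi> = 1 \<longrightarrow> \<bar>support_function K \<phi> - 1\<bar> \<le> s) \<and>
     (\<forall>\<phi> \<theta>. norm \<phi> = 1 \<longrightarrow> norm \<theta> = 1 \<longrightarrow>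
        \<bar>support_function K \<phi> - support_function K \<theta>\<bar> \<le> (L * s) * norm (\<phi> - \<theta>))"

text \<open>The radial power lies between powers of u and of h, where u differs from h by a multiple
  of s^2. Both have the same first-order expansion, which replaces the radial function by the
  support function in the linearization. \<open>C\<close> depends on L and the dimension, not on the
  body.\<close>

lemma radial_power_expansion:
  obtains C :: real where "C > 0"
    "\<And>(K :: 'a::euclidean_space set) s \<theta>. nearly_round L s K \<Longrightarrow> norm \<theta> = 1 \<Longrightarrow>
       \<bar>radial_power K p \<theta> - 1 - real (DIM('a) + p) * (support_function K \<theta> - 1)\<bar> \<le> C * s\<^sup>2"
proof -
  define N where "N = DIM('a) + p"
  obtain C :: real where C: "C \<ge> 0" "\<And>u. 0 \<le> u \<Longrightarrow> u \<le> 2 \<Longrightarrow> \<bar>u ^ N - 1 - real N * (u - 1)\<bar> \<le> C * (u - 1)\<^sup>2"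
    using power_Taylor_bound by blast
  show ?thesis
  \<comment> \<open>\<open>4 * C\<close> is the Taylor error at u, whose distance from 1 is at most
    2s; the second term is the first-order cost of replacing h by u; the 1 ensures
    positivity.\<close>
  proof (rule that[of "4 * C + N * (2 * L\<^sup>2) + 1"])
    show "4 * C + N * (2 * L\<^sup>2) + 1 > 0" using C(1) by (intro add_nonneg_pos) auto
    fix K :: "'a set" and s and \<theta> :: 'a
    assume nr: "nearly_round L s K" and \<theta>: "norm \<theta> = 1"
    have K: "convex_body K" "origin_symmetric K"
      and s: "s \<le> 1/4" "2 * L\<^sup>2 * s\<^sup>2 \<le> 1/4" "2 * L\<^sup>2 * s \<le> 1"
      and h: "\<And>\<phi>. norm \<phi> = 1 \<Longrightarrow> \<bar>support_function K \<phi> - 1\<bar> \<le> s"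
      and Lip: "\<And>\<phi>. norm \<phi> = 1 \<Longrightarrow> \<bar>support_function K \<phi> - support_function K \<theta>\<bar> \<le> (L * s) * norm (\<phi> - \<theta>)"
      using nr \<theta> unfolding nearly_round_def by blast+
    define H where "H = support_function K \<theta>"
    define u where "u = H - 2 * (L * s)\<^sup>2"
    have s0: "0 \<le> s" using h[OF \<theta>] by linarith
    have H: "\<bar>H - 1\<bar> \<le> s" using h[OF \<theta>] by (simp add: H_def)
    have Ls: "2 * (L * s)\<^sup>2 = 2 * L\<^sup>2 * s\<^sup>2" by (simp add: power_mult_distrib)
    have Ls2: "2 * L\<^sup>2 * s\<^sup>2 \<le> s" using mult_right_mono[OF s(3) s0] by (simp add: power2_eq_square mult.assoc)
    have Ls0: "0 \<le> 2 * L\<^sup>2 * s\<^sup>2" by simp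
    have u: "u \<ge> 1/4" "u \<le> 2" "\<bar>u - 1\<bar> \<le> 2 * s"
      using H s Ls2 Ls0 unfolding u_def Ls by linarith+
    have "u *\<^sub>R \<theta> \<in> K"
      using radial_function_ge[OF K(1) \<theta> Lip, of u] u(1) by (simp add: u_def H_def)
    then have b: "u ^ N \<le> radial_power K p \<theta>" "radial_power K p \<theta> \<le> H ^ N"
      using radial_power_between[OF K \<theta>, of u p] u(1) by (simp_all add: N_def H_def)
    have sq: "x\<^sup>2 \<le> y\<^sup>2" if "\<bar>x\<bar> \<le> y" for x y :: real
      using that by (meson abs_ge_zero abs_le_square_iff abs_le_iff order_trans abs_ge_self)
    have "C * (H - 1)\<^sup>2 \<le> C * s\<^sup>2" using sq[OF H] C(1) by (intro mult_left_mono)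
    moreover have "\<bar>H ^ N - 1 - real N * (H - 1)\<bar> \<le> C * (H - 1)\<^sup>2" using H s by (intro C(2)) auto
    ultimately have up: "radial_power K p \<theta> - 1 - real N * (H - 1) \<le> C * s\<^sup>2" using b(2) by linarith
    have "C * (u - 1)\<^sup>2 \<le> C * (2 * s)\<^sup>2" using sq[OF u(3)] C(1) by (intro mult_left_mono)
    moreover have "\<bar>u ^ N - 1 - real N * (u - 1)\<bar> \<le> C * (u - 1)\<^sup>2" using u by (intro C(2)) auto
    moreover have "real N * (u - 1) = real N * (H - 1) - N * (2 * L\<^sup>2) * s\<^sup>2"
      unfolding u_def Ls by (simp add: algebra_simps)
    moreover have "C * (2 * s)\<^sup>2 = 4 * (C * s\<^sup>2)" by (simp add: power_mult_distrib)
    ultimately have lo: "radial_power K p \<theta> - 1 - real N * (H - 1) \<ge> - (4 * (C * s\<^sup>2) + N * (2 * L\<^sup>2) * s\<^sup>2)"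
      using b(1) by linarith
    have "0 \<le> C * s\<^sup>2" "0 \<le> N * (2 * L\<^sup>2) * s\<^sup>2" "0 \<le> s\<^sup>2" using C(1) by auto
    moreover have "(4 * C + N * (2 * L\<^sup>2) + 1) * s\<^sup>2 = 4 * (C * s\<^sup>2) + N * (2 * L\<^sup>2) * s\<^sup>2 + s\<^sup>2"
      by (simp add: algebra_simps)
    ultimately have "\<bar>radial_power K p \<theta> - 1 - real N * (H - 1)\<bar> \<le> (4 * C + N * (2 * L\<^sup>2) + 1) * s\<^sup>2"
      using up lo by linarith
    then show "\<bar>radial_power K p \<theta> - 1 - real (DIM('a) + p) * (support_function K \<theta> - 1)\<bar> \<le> (4 * C + N * (2 * L\<^sup>2) + 1) * s\<^sup>2"
      by (simp only: N_def H_def)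
  qed
qed

section \<open>Rigidity of the ball among normalized solutions\<close>

text \<open>The factor \<gamma>, which absorbs \<open>c\<close> and the volume of the body, is left
  open; the condition on the mean of the support function determines it. The last existential is
  isotropy.\<close>

definition normalized_fixed_point :: "real \<Rightarrow> 'a::euclidean_space set \<Rightarrow> bool" where
  "normalized_fixed_point s K \<longleftrightarrow> convex_body K \<and> origin_symmetric K \<and>
    (\<exists>\<gamma>. \<forall>\<phi>. norm \<phi> = 1 \<longrightarrow> support_function K \<phi> = \<gamma> * (LINT x:K|lborel. \<bar>\<phi> \<bullet> x\<bar>)) \<and>
    (\<integral>\<^sub>S \<theta>. support_function K \<theta>) = 1 \<and>
    (\<exists>\<tau>. \<forall>a. norm a = 1 \<longrightarrow> (LINT x:K|lborel. (a \<bullet> x)\<^sup>2) = \<tau>) \<and>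
    (\<forall>\<theta>. norm \<theta> = 1 \<longrightarrow> \<bar>support_function K \<theta> - 1\<bar> \<le> s)"

text \<open>The smallness of \<open>s\<^sub>0\<close> is used twice: to carry a crude bound on the
  radial power up to a slope bound, and to turn the quadratic errors, at most M s^2, into the linear
  bound \<delta> s to which the stability statement applies.\<close>

lemma ball_rigidity:
  assumes dim: "2 \<le> DIM('a::euclidean_space)"
  obtains s\<^sub>0 where "s\<^sub>0 > 0" "\<And>K :: 'a::euclidean_space set. normalized_fixed_point s\<^sub>0 K \<Longrightarrow> K = cball 0 1"
proof -
  define m where "m = cosine_mean TYPE('a)"
  have m: "m > 0" unfolding m_def by (rule cosine_mean_pos[OF dim])
  define N where "N = DIM('a) + 1"
  obtain \<delta> where \<delta>: "\<delta> > 0" "\<And>(f :: 'a \<Rightarrow> real) x\<^sub>0 s. almost_cosine_fixed \<delta> f x\<^sub>0 s \<Longrightarrow> s = 0"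
    using cosine_stability[OF dim] by metis
  have Nm: "(DIM('a) + 1) / cosine_mean TYPE('a) = N / m" by (simp add: N_def m_def)
  obtain C1 :: real where C1: "C1 > 0" "\<And>(K :: 'a set) l \<theta>. convex_body K \<Longrightarrow> origin_symmetric K \<Longrightarrow> l \<le> 1 \<Longrightarrow>
      (\<And>u. norm u = 1 \<Longrightarrow> \<bar>support_function K u - 1\<bar> \<le> l) \<Longrightarrow> norm \<theta> = 1 \<Longrightarrow> \<bar>radial_power K 1 \<theta> - 1\<bar> \<le> C1 * l"
    using radial_power_near_1 by metis
  \<comment> \<open>The scalar in front of the transform is at most 2/m, and the transformed
    function \<open>w - 1\<close> is bounded by \<open>C1 * s\<close>.\<close>
  define L where "L = 2 * C1 / m"
  have L: "L > 0" using C1(1) m by (simp add: L_def)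
  obtain A :: real where A: "A > 0" "\<And>(K :: 'a set) s \<theta>. nearly_round L s K \<Longrightarrow> norm \<theta> = 1 \<Longrightarrow>
       \<bar>radial_power K 1 \<theta> - 1 - real (DIM('a) + 1) * (support_function K \<theta> - 1)\<bar> \<le> A * s\<^sup>2"
    using radial_power_expansion by metis
  obtain A' :: real where A': "A' > 0" "\<And>(K :: 'a set) s \<theta>. nearly_round L s K \<Longrightarrow> norm \<theta> = 1 \<Longrightarrow>
       \<bar>radial_power K 2 \<theta> - 1 - real (DIM('a) + 2) * (support_function K \<theta> - 1)\<bar> \<le> A' * s\<^sup>2"
    using radial_power_expansion by metis
  \<comment> \<open>\<open>3 * A\<close> is the error of the linearized equation,
    \<open>2 * A'\<close> that of the degree-two component. In \<open>s\<^sub>0\<close>, the entry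
    with \<open>C1\<close> keeps w within 1/2 of 1, those with 1/4 and L yield
    \<open>nearly_round\<close>, and \<delta>/M makes the quadratic errors at most \<delta>
    s.\<close>
  define M where "M = 3 * A + 2 * A'"
  have M: "M > 0" "3 * A \<le> M" "2 * A' \<le> M" using A(1) A'(1) by (simp_all add: M_def)
  define s\<^sub>0 where "s\<^sub>0 = Min {1/4, 1 / (2 * C1), 1 / (4 * L), 1 / (2 * L\<^sup>2), \<delta> / M}"
  have s\<^sub>0: "s\<^sub>0 > 0" "s\<^sub>0 \<le> 1/4" "s\<^sub>0 \<le> 1 / (2 * C1)" "s\<^sub>0 \<le> 1 / (4 * L)" "s\<^sub>0 \<le> 1 / (2 * L\<^sup>2)" "s\<^sub>0 \<le> \<delta> / M"
  proof -
    show "s\<^sub>0 > 0" unfolding s\<^sub>0_def using C1(1) L M \<delta>(1) by (subst Min_gr_iff) auto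
    have "s\<^sub>0 \<le> y" if "y \<in> {1/4, 1 / (2 * C1), 1 / (4 * L), 1 / (2 * L\<^sup>2), \<delta> / M}" for y
      unfolding s\<^sub>0_def by (rule Min_le[OF _ that]) simp
    then show "s\<^sub>0 \<le> 1/4" "s\<^sub>0 \<le> 1 / (2 * C1)" "s\<^sub>0 \<le> 1 / (4 * L)" "s\<^sub>0 \<le> 1 / (2 * L\<^sup>2)" "s\<^sub>0 \<le> \<delta> / M"
      by blast+
  qed
  show ?thesis
  proof (rule that[OF s\<^sub>0(1)])
    fix K :: "'a set"
    assume "normalized_fixed_point s\<^sub>0 K"
    then obtain \<gamma> \<tau> where K: "convex_body K" "origin_symmetric K"
      and fp: "\<And>\<phi>. norm \<phi> = 1 \<Longrightarrow> support_function K \<phi> = \<gamma> * (LINT x:K|lborel. \<bar>\<phi> \<bullet> x\<bar>)"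
      and mean: "(\<integral>\<^sub>S \<theta>. support_function K \<theta>) = 1"
      and iso: "\<And>a. norm a = 1 \<Longrightarrow> (LINT x:K|lborel. (a \<bullet> x)\<^sup>2) = \<tau>"
      and near: "\<And>\<theta>. norm \<theta> = 1 \<Longrightarrow> \<bar>support_function K \<theta> - 1\<bar> \<le> s\<^sub>0"
      unfolding normalized_fixed_point_def by metis
    define h where "h = support_function K"
    have hc: "continuous_on UNIV h"
      unfolding h_def by (intro continuous_support_function convex_body_compact convex_body_nonempty K)
    have hm[measurable]: "h \<in> borel_measurable borel" by (rule borel_measurable_continuous_onI[OF hc])
    have [measurable]: "K \<in> sets borel" using convex_body_compact[OF K(1)] borel_compact by blast
    define f where "f x = h x - 1" for x
    have fm[measurable]: "f \<in> borel_measurable borel" unfolding f_def by measurable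
    have ne: "sphere (0::'a) 1 \<noteq> {}" by (simp add: sphere_eq_empty)
    have "continuous_on (sphere 0 1) (\<lambda>x. \<bar>f x\<bar>)"
      unfolding f_def using hc by (intro continuous_intros) (auto intro: continuous_on_subset)
    from continuous_attains_sup[OF compact_sphere ne this]
    obtain x\<^sub>0 where x\<^sub>0: "norm x\<^sub>0 = 1" "\<And>x. norm x = 1 \<Longrightarrow> \<bar>f x\<bar> \<le> \<bar>f x\<^sub>0\<bar>" by auto
    define s where "s = \<bar>f x\<^sub>0\<bar>"
    have fs: "\<bar>f x\<bar> \<le> s" if "norm x = 1" for x using x\<^sub>0(2)[OF that] by (simp add: s_def)
    have s: "0 \<le> s" "s \<le> s\<^sub>0" using near[OF x\<^sub>0(1)] by (auto simp: s_def f_def h_def)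
    have s4: "s \<le> 1/4" and sC1: "C1 * s \<le> 1/2" and sL: "L * s \<le> 1/4" and sLL: "2 * L\<^sup>2 * s \<le> 1" and sM: "M * s \<le> \<delta>"
    proof -
      show "s \<le> 1/4" using s s\<^sub>0 by linarith
      have "s \<le> 1 / (2 * C1)" "s \<le> 1 / (4 * L)" "s \<le> 1 / (2 * L\<^sup>2)" "s \<le> \<delta> / M" using s s\<^sub>0 by linarith+
      then show "C1 * s \<le> 1/2" "L * s \<le> 1/4" "2 * L\<^sup>2 * s \<le> 1" "M * s \<le> \<delta>"
        using C1(1) L M by (simp_all add: field_simps)
    qed
    have sLL': "2 * L\<^sup>2 * s\<^sup>2 \<le> 1/4"
      using mult_mono[OF sL sL] L s(1) by (simp add: power2_eq_square mult_ac)
    have fi: "integrable sphere_measure f" by (rule integrable_sphere_measure[OF fm fs])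
    have hi: "integrable sphere_measure h"
      using Bochner_Integration.integrable_add[OF fi integrable_sphere_measure[of "\<lambda>_. 1" 1]] by (simp add: f_def)
    have f0: "(\<integral>\<^sub>S x. f x) = 0"
      using mean hi integrable_sphere_measure[of "\<lambda>_. 1 :: real" 1]
      unfolding f_def h_def by (subst Bochner_Integration.integral_diff) (simp_all only: integral_sphere_const, simp_all)
    define w where "w = radial_power K 1"
    have wm[measurable]: "w \<in> borel_measurable borel" unfolding w_def by measurable
    have w1: "\<bar>w \<theta> - 1\<bar> \<le> C1 * s" if "norm \<theta> = 1" for \<theta>
      unfolding w_def using C1(2)[OF K _ _ that, of s] s4 fs by (simp add: f_def h_def)
    have wb: "\<bar>w \<theta>\<bar> \<le> 2" if "norm \<theta> = 1" for \<theta> using w1[OF that] sC1 by linarith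
    have one: "\<bar>1::real\<bar> \<le> 1" by simp
    have wi: "integrable sphere_measure w" by (rule integrable_sphere_measure[OF wm wb])
    have ci: "integrable (sphere_measure :: 'a measure) (\<lambda>_. c)" for c :: real by (rule integrable_sphere_measure[of _ "\<bar>c\<bar>"]) auto
    define \<beta> where "\<beta> = \<gamma> * (DIM('a) * unit_ball_vol (DIM('a)) / N) * m"
    have hw: "h \<phi> = \<beta> / m * cosine_transform w \<phi>" if "norm \<phi> = 1" for \<phi>
    proof -
      have "(LINT x:K|lborel. \<bar>\<phi> \<bullet> x\<bar>) = DIM('a) * unit_ball_vol (DIM('a)) / (DIM('a) + 1) *
        (\<integral>\<^sub>S \<theta>. \<bar>\<phi> \<bullet> \<theta>\<bar> * radial_power K 1 \<theta>)"
        by (rule set_integral_polar[OF convex_body_compact[OF K(1)], where p = 1]) (auto simp: abs_mult)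
      then show ?thesis using m fp[OF that] by (simp add: h_def \<beta>_def cosine_transform_def w_def N_def)
    qed
    have c1: "cosine_transform (\<lambda>_. 1) x = m" if "norm x = 1" for x :: 'a
      using cosine_transform_1[OF that] by (simp add: m_def)
    define W where "W = (\<integral>\<^sub>S x. w x)"
    \<comment> \<open>Integrating the equation over the sphere and using the symmetry of the
      transform: mean half-width one fixes the unknown factor as the reciprocal of the mean of
      w.\<close>
    have bW: "\<beta> * W = 1"
    proof -
      have "(\<integral>\<^sub>S x. h x) = (\<integral>\<^sub>S x. \<beta> / m * (1 * cosine_transform w x))"
        by (rule integral_sphere_cong) (auto simp: hw)
      also have "\<dots> = \<beta> / m * (\<integral>\<^sub>S x. 1 * cosine_transform w x)" by simp
      also have "(\<integral>\<^sub>S x. 1 * cosine_transform w x) = (\<integral>\<^sub>S x. w x * cosine_transform (\<lambda>_. 1) x)"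
        by (rule integral_cosine_transform[OF wm wb, where C = 1]) auto
      also have "\<dots> = (\<integral>\<^sub>S x. w x * m)" by (rule integral_sphere_cong) (auto simp: c1)
      finally show ?thesis using m mean by (simp add: W_def h_def)
    qed
    have Wdiff: "W - 1 = (\<integral>\<^sub>S x. w x - 1)"
      unfolding W_def by (subst Bochner_Integration.integral_diff[OF wi ci]) (simp only: integral_sphere_const)
    have W1: "\<bar>W - 1\<bar> \<le> 1/2"
      unfolding Wdiff
    proof (rule abs_integral_sphere_le)
      show "\<bar>w x - 1\<bar> \<le> 1/2" if "norm x = 1" for x using w1[OF that] sC1 by linarith
    qed measurable
    have \<beta>: "0 < \<beta>" "\<beta> \<le> 2"
    proof -
      have W: "W \<ge> 1/2" using W1 by linarith
      then have "W \<noteq> 0" by auto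
      then have b: "\<beta> = 1 / W" using bW by (simp add: eq_divide_eq)
      show "0 < \<beta>" "\<beta> \<le> 2" unfolding b using W by (simp_all add: divide_le_eq)
    qed
    have Lip: "\<bar>h \<phi> - h \<theta>\<bar> \<le> (L * s) * norm (\<phi> - \<theta>)" if \<phi>: "norm \<phi> = 1" and \<theta>: "norm \<theta> = 1" for \<phi> \<theta>
    proof -
      \<comment> \<open>The transform of 1 is constant on the sphere and drops out of differences,
        so w may be replaced by \<open>w - 1\<close>. This is what makes the Lipschitz constant O(s)
        instead of O(1).\<close>
      have cd: "cosine_transform (\<lambda>x. w x - 1) x = cosine_transform w x - m" if "norm x = 1" for x
        using cosine_transform_diff[OF wm wb borel_measurable_const one] c1[OF that] by simp
      have "h \<phi> - h \<theta> = \<beta> / m * (cosine_transform (\<lambda>x. w x - 1) \<phi> - cosine_transform (\<lambda>x. w x - 1) \<theta>)"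
        unfolding cd[OF \<phi>] cd[OF \<theta>] hw[OF \<phi>] hw[OF \<theta>] by (simp add: right_diff_distrib)
      also have "\<bar>\<dots>\<bar> = \<beta> / m * \<bar>cosine_transform (\<lambda>x. w x - 1) \<phi> - cosine_transform (\<lambda>x. w x - 1) \<theta>\<bar>"
        using \<beta> m by (simp add: abs_mult)
      also have "\<dots> \<le> 2 / m * ((C1 * s) * norm (\<phi> - \<theta>))"
        using \<beta> m w1 by (intro mult_mono divide_right_mono cosine_transform_Lipschitz) auto
      finally show ?thesis by (simp add: L_def)
    qed
    have nr: "nearly_round L s K"
      unfolding nearly_round_def
      using K s4 sLL' sLL fs Lip by (auto simp: f_def h_def)
    define E where "E x = w x - 1 - real N * f x" for x
    have E: "\<bar>E x\<bar> \<le> A * s\<^sup>2" if "norm x = 1" for x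
      unfolding E_def w_def N_def f_def h_def
      by (rule A(2)[OF nr that])
    have Em[measurable]: "E \<in> borel_measurable borel" unfolding E_def by measurable
    \<comment> \<open>The first-order part of \<open>w - 1\<close> is a multiple of f, which has
      mean zero; hence the mean of w is 1 up to a quadratic error.\<close>
    have W2: "\<bar>W - 1\<bar> \<le> A * s\<^sup>2"
    proof -
      have "W - 1 = (\<integral>\<^sub>S x. E x + real N * f x)" unfolding Wdiff E_def by simp
      also have "\<dots> = (\<integral>\<^sub>S x. E x)"
        using f0 fi integrable_sphere_measure[OF Em E] by simp
      finally show ?thesis using abs_integral_sphere_le[OF Em E] by simp
    qed
    have As: "0 \<le> A * s\<^sup>2" "0 \<le> A' * s\<^sup>2" using A(1) A'(1) by auto
    have Ms: "M * s\<^sup>2 \<le> \<delta> * s" using mult_right_mono[OF sM s(1)] by (simp add: power2_eq_square mult.assoc)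
    have lin: "\<bar>f x - (DIM('a) + 1) / cosine_mean TYPE('a) * cosine_transform f x\<bar> \<le> \<delta> * s"
      if x: "norm x = 1" for x
    proof -
      have cE: "cosine_transform E x = cosine_transform w x - m - N * cosine_transform f x"
      proof -
        have w1': "\<bar>w x - 1\<bar> \<le> 3" if "norm x = 1" for x using wb[OF that] by linarith
        have Nf: "\<bar>real N * f x\<bar> \<le> real N * s" if "norm x = 1" for x
          using fs[OF that] by (simp add: abs_mult mult_left_mono)
        have "cosine_transform E x = cosine_transform (\<lambda>x. w x - 1) x - cosine_transform (\<lambda>x. real N * f x) x"
          unfolding E_def by (rule cosine_transform_diff[OF _ w1' _ Nf]) auto
        also have "cosine_transform (\<lambda>x. w x - 1) x = cosine_transform w x - m"
          using cosine_transform_diff[OF wm wb borel_measurable_const one] c1[OF x] by simp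
        also have "cosine_transform (\<lambda>x. real N * f x) x = N * cosine_transform f x"
          unfolding cosine_transform_def by (simp add: mult.left_commute)
        finally show ?thesis .
      qed
      have cw: "cosine_transform w x = W * m * h x"
        using hw[OF x] bW m \<beta> by (simp add: field_simps)
      \<comment> \<open>The defect consists of the error in the constant, bounded by 2A s^2 since h
        \<le> 2, and the transform of the expansion error, bounded by A s^2.\<close>
      have "f x - N / m * cosine_transform f x = (1 - W) * h x + cosine_transform E x / m"
        unfolding cE cw f_def using m by (simp add: field_simps)
      moreover have "\<bar>cosine_transform E x / m\<bar> \<le> A * s\<^sup>2"
        using cosine_transform_le[OF Em E x] m by (simp add: abs_divide m_def[symmetric] field_simps)
      moreover have "\<bar>(1 - W) * h x\<bar> \<le> A * s\<^sup>2 * 2"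
        unfolding abs_mult using W2 fs[OF x] s4 by (intro mult_mono) (auto simp: f_def)
      moreover have "3 * A * s\<^sup>2 \<le> M * s\<^sup>2" using M by (intro mult_right_mono) auto
      ultimately show ?thesis unfolding Nm using Ms by linarith
    qed
    define w' where "w' = radial_power K 2"
    have w'm[measurable]: "w' \<in> borel_measurable borel" unfolding w'_def by measurable
    define E' where "E' x = w' x - 1 - real (DIM('a) + 2) * f x" for x
    have E'm[measurable]: "E' \<in> borel_measurable borel" unfolding E'_def by measurable
    have E': "\<bar>E' x\<bar> \<le> A' * s\<^sup>2" if "norm x = 1" for x
      unfolding E'_def w'_def f_def h_def
      by (rule A'(2)[OF nr that])
    define Q where "Q a = (\<integral>\<^sub>S x. f x * (x \<bullet> a)\<^sup>2)" for a
    define e where "e a = (\<integral>\<^sub>S x. E' x * (x \<bullet> a)\<^sup>2)" for a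
    have bd: "\<bar>g x * (x \<bullet> a)\<^sup>2\<bar> \<le> C" if "norm x = 1" "norm a = 1" "\<bar>g x\<bar> \<le> C" for g :: "'a \<Rightarrow> real" and x a C
      by (rule abs_mult_inner_power_le[OF that])
    have eb: "\<bar>e a\<bar> \<le> A' * s\<^sup>2" if "norm a = 1" for a
      unfolding e_def using bd[OF _ that] E' by (intro abs_integral_sphere_le) auto
    have iQ: "integrable sphere_measure (\<lambda>x. f x * (x \<bullet> a)\<^sup>2)" if "norm a = 1" for a
      using bd[OF _ that] fs by (intro integrable_sphere_measure[where B = s]) auto
    have ie: "integrable sphere_measure (\<lambda>x. E' x * (x \<bullet> a)\<^sup>2)" if "norm a = 1" for a
      using bd[OF _ that] E' by (intro integrable_sphere_measure[where B = "A' * s\<^sup>2"]) auto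
    have i1: "integrable sphere_measure (\<lambda>x. (x \<bullet> a)\<^sup>2)" if "norm a = 1" for a :: 'a
      using bd[OF _ that, of _ "\<lambda>_. 1" 1] by (intro integrable_sphere_measure[where B = 1]) auto
    define c where "c = DIM('a) * unit_ball_vol (DIM('a)) / (DIM('a) + 2)"
    have c: "c > 0" unfolding c_def by simp
    \<comment> \<open>The second moment in direction a is, to first order, a constant plus a
      multiple of the quadratic moment \<open>Q a\<close> of f. By isotropy the left-hand side does
      not depend on a.\<close>
    have tau: "\<tau> / c = 1 / DIM('a) + real (DIM('a) + 2) * Q a + e a" if a: "norm a = 1" for a
    proof -
      have "(LINT x:K|lborel. (a \<bullet> x)\<^sup>2) = c * (\<integral>\<^sub>S \<theta>. (a \<bullet> \<theta>)\<^sup>2 * radial_power K 2 \<theta>)"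
        unfolding c_def using set_integral_polar[OF convex_body_compact[OF K(1)], of "\<lambda>x. (a \<bullet> x)\<^sup>2" 2]
        by (simp add: power_mult_distrib)
      then have "\<tau> / c = (\<integral>\<^sub>S \<theta>. (a \<bullet> \<theta>)\<^sup>2 * radial_power K 2 \<theta>)"
        using c iso[OF a] by simp
      also have "\<dots> = (\<integral>\<^sub>S x. (x \<bullet> a)\<^sup>2 + real (DIM('a) + 2) * (f x * (x \<bullet> a)\<^sup>2) + E' x * (x \<bullet> a)\<^sup>2)"
        by (intro Bochner_Integration.integral_cong) (auto simp: E'_def w'_def inner_commute algebra_simps)
      also have "\<dots> = 1 / DIM('a) + real (DIM('a) + 2) * Q a + e a"
        using iQ[OF a] ie[OF a] i1[OF a] integral_sphere_inner_square[OF a]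
        by (simp add: Q_def e_def)
      finally show ?thesis .
    qed
    have sumQ: "(\<Sum>b\<in>Basis. Q b) = 0"
    proof -
      have "(\<Sum>b\<in>Basis. Q b) = (\<integral>\<^sub>S x. (\<Sum>b\<in>Basis. f x * (x \<bullet> b)\<^sup>2))"
        unfolding Q_def by (rule Bochner_Integration.integral_sum[symmetric]) (simp add: iQ)
      also have "\<dots> = (\<integral>\<^sub>S x. f x)"
      proof (rule integral_sphere_cong)
        fix x :: 'a assume "norm x = 1"
        then show "(\<Sum>b\<in>Basis. f x * (x \<bullet> b)\<^sup>2) = f x" by (simp add: sum_distrib_left[symmetric] sum_inner_Basis_square)
      qed measurable
      finally show ?thesis using f0 by simp
    qed
    have n: "real (DIM('a)) > 0" by simp
    \<comment> \<open>Summing over an orthonormal basis cancels the \<open>Q\<close> terms, because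
      f has mean zero. This determines the isotropy constant up to a quadratic error, and then every
      single \<open>Q a\<close> is quadratic too.\<close>
    have tau1: "\<bar>\<tau> / c - 1 / DIM('a)\<bar> \<le> A' * s\<^sup>2"
    proof -
      have "(\<Sum>b\<in>(Basis::'a set). \<tau> / c - 1 / DIM('a)) = (\<Sum>b\<in>Basis. real (DIM('a) + 2) * Q b + e b)"
      proof (rule sum.cong)
        fix b :: 'a assume "b \<in> Basis"
        then show "\<tau> / c - 1 / DIM('a) = real (DIM('a) + 2) * Q b + e b" using tau[of b] by simp
      qed simp
      also have "\<dots> = (\<Sum>b\<in>Basis. e b)"
        by (simp add: sum.distrib sum_distrib_left[symmetric] sumQ)
      finally have "DIM('a) * (\<tau> / c - 1 / DIM('a)) = (\<Sum>b\<in>Basis. e b)" by simp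
      moreover have "\<bar>\<Sum>b\<in>Basis. e b\<bar> \<le> DIM('a) * (A' * s\<^sup>2)"
        using eb by (intro sum_abs[THEN order_trans] sum_bounded_above) auto
      ultimately have "DIM('a) * \<bar>\<tau> / c - 1 / DIM('a)\<bar> \<le> DIM('a) * (A' * s\<^sup>2)"
        by (metis abs_mult abs_of_nat)
      then show ?thesis using n by (simp only: mult_le_cancel_left_pos)
    qed
    have quad: "\<bar>\<integral>\<^sub>S x. f x * (x \<bullet> a)\<^sup>2\<bar> \<le> \<delta> * s" if a: "norm a = 1" for a
    proof -
      have "real (DIM('a) + 2) * Q a = (\<tau> / c - 1 / DIM('a)) - e a" using tau[OF a] by simp
      then have "\<bar>real (DIM('a) + 2) * Q a\<bar> \<le> 2 * A' * s\<^sup>2" using tau1 eb[OF a] by linarith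
      moreover have "1 * \<bar>Q a\<bar> \<le> real (DIM('a) + 2) * \<bar>Q a\<bar>" by (intro mult_right_mono) auto
      moreover have "2 * A' * s\<^sup>2 \<le> M * s\<^sup>2" using M by (intro mult_right_mono) auto
      ultimately show ?thesis using Ms unfolding Q_def by (simp add: abs_mult)
    qed
    have "s = 0"
    proof (rule \<delta>(2))
      have "f (- x) = f x" for x by (simp add: f_def h_def support_function_minus[OF K(2)])
      then show "almost_cosine_fixed \<delta> f x\<^sub>0 s"
        unfolding almost_cosine_fixed_def using fm f0 fs x\<^sub>0(1) s_def lin quad by blast
    qed
    then have h1: "support_function K u = 1" if "norm u = 1" for u using fs[OF that] by (simp add: f_def h_def)
    show "K = cball 0 1"
    proof (rule subset_antisym)
      show "K \<subseteq> cball 0 1"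
        using K(1) convex_body_nonempty[OF K(1)]
        by (intro support_function_le_imp_subset) (auto simp: convex_body_def h1 support_function_cball)
      show "cball 0 1 \<subseteq> K"
        using K(1) convex_body_nonempty[OF K(1)]
        by (intro support_function_le_imp_subset) (auto simp: convex_body_def h1 support_function_cball)
    qed
  qed
qed


section \<open>Reduction by linear maps\<close>

lemma support_function_image_adjoint:
  assumes "\<And>x y. T x \<bullet> y = x \<bullet> S y"
  shows "support_function (T ` K) u = support_function K (S u)"
  unfolding support_function_def image_image assms ..

lemma support_function_scaleR:
  fixes K :: "'a::euclidean_space set"
  assumes K: "compact K" "K \<noteq> {}" and r: "0 \<le> r"
  shows "support_function K (r *\<^sub>R u) = r * support_function K u"
proof (cases "r = 0")
  case True
  then show ?thesis using K by (simp add: support_function_def)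
next
  case False
  with r have r: "r > 0" by simp
  have "support_function K (r *\<^sub>R u) \<le> r * support_function K u"
    using r support_function_upper[OF K(1)] by (intro support_function_least[OF K(2)]) auto
  moreover have "support_function K u \<le> support_function K (r *\<^sub>R u) / r"
    using r support_function_upper[OF K(1), of _ "r *\<^sub>R u"]
    by (intro support_function_least[OF K(2)]) (auto simp: field_simps)
  ultimately show ?thesis using r by (simp add: field_simps)
qed

text \<open>The defining property speaks of unit vectors only; positive homogeneity of both sides
  extends it to all vectors, as is needed once an adjoint map is applied to the argument.\<close>

lemma support_function_centroid_body:
  fixes K :: "'a::euclidean_space set"
  assumes K: "convex_body K"
  shows "convex_body (centroid_body K)"
    "support_function (centroid_body K) \<phi> = 1 / measure lborel K * (LINT x:K|lborel. \<bar>\<phi> \<bullet> x\<bar>)"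
proof -
  have *: "convex_body (centroid_body K) \<and> (\<forall>\<phi>\<in>sphere 0 1. support_function (centroid_body K) \<phi> =
        1 / measure lborel K * (LINT x:K|lborel. \<bar>\<phi> \<bullet> x\<bar>))"
    unfolding centroid_body_def by (rule theI'[OF centroid_body_ex1[OF K]])
  then show C: "convex_body (centroid_body K)" by simp
  have "support_function (centroid_body K) \<phi> = support_function (centroid_body K) (norm \<phi> *\<^sub>R sgn \<phi>)"
    by (cases "\<phi> = 0") (simp_all add: sgn_div_norm)
  also have "\<dots> = norm \<phi> * support_function (centroid_body K) (sgn \<phi>)"
    by (intro support_function_scaleR convex_body_compact convex_body_nonempty C) simp
  also have "\<dots> = norm \<phi> * (1 / measure lborel K * (LINT x:K|lborel. \<bar>sgn \<phi> \<bullet> x\<bar>))"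
    using * by (cases "\<phi> = 0") (auto simp: norm_sgn)
  also have "\<dots> = 1 / measure lborel K * (LINT x:K|lborel. norm \<phi> * \<bar>sgn \<phi> \<bullet> x\<bar>)" by simp
  also have "(\<lambda>x. norm \<phi> * \<bar>sgn \<phi> \<bullet> x\<bar>) = (\<lambda>x. \<bar>\<phi> \<bullet> x\<bar>)"
    by (cases "\<phi> = 0") (auto simp: sgn_div_norm abs_mult)
  finally show "support_function (centroid_body K) \<phi> = 1 / measure lborel K * (LINT x:K|lborel. \<bar>\<phi> \<bullet> x\<bar>)" .
qed

text \<open>The equation is imposed on all vectors because adjoint maps do not preserve the sphere,
  and with an arbitrary factor because volume changes rescale it; in this form the property is
  invariant under linear bijections.\<close>

definition centroid_fixed :: "'a::euclidean_space set \<Rightarrow> bool" where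
  "centroid_fixed K \<longleftrightarrow> convex_body K \<and> origin_symmetric K \<and>
     (\<exists>\<gamma>. \<forall>\<phi>. support_function K \<phi> = \<gamma> * (LINT x:K|lborel. \<bar>\<phi> \<bullet> x\<bar>))"

text \<open>The integrand is even in its direction, so a negative \<open>c\<close> enters through
  its absolute value.\<close>

lemma centroid_fixedI:
  fixes K :: "'a::euclidean_space set"
  assumes K: "convex_body K" "origin_symmetric K" and c: "(*\<^sub>R) c ` centroid_body K = K"
  shows "centroid_fixed K"
proof -
  have "support_function K \<phi> = (\<bar>c\<bar> / measure lborel K) * (LINT x:K|lborel. \<bar>\<phi> \<bullet> x\<bar>)" for \<phi>
  proof -
    have "support_function K \<phi> = support_function (centroid_body K) (c *\<^sub>R \<phi>)"
      using support_function_image_adjoint[of "(*\<^sub>R) c" "(*\<^sub>R) c" "centroid_body K" \<phi>] unfolding c by simp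
    also have "\<dots> = (\<bar>c\<bar> / measure lborel K) * (LINT x:K|lborel. \<bar>\<phi> \<bullet> x\<bar>)"
      unfolding support_function_centroid_body(2)[OF K(1)] by (simp add: abs_mult)
    finally show ?thesis .
  qed
  then show ?thesis using K unfolding centroid_fixed_def by blast
qed

text \<open>\<open>d\<close> is determined by the map before the set and the integrand are chosen.
  Otherwise the new factors in the transformed equation and in the isotropy condition could vary
  with the direction.\<close>

lemma set_integral_linear_image:
  fixes T :: "'a::euclidean_space \<Rightarrow> 'a"
  assumes T: "linear T" "bij T"
  obtains d where "d > 0" "\<And>K G. compact K \<Longrightarrow> G \<in> borel_measurable borel \<Longrightarrow> (\<And>x. 0 \<le> G x) \<Longrightarrow>
    (LINT x:K|lborel. G (T x)) = d * (LINT x:T ` K|lborel. (G x :: real))"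
proof -
  obtain d where d: "d > 0" "\<And>g. g \<in> borel_measurable borel \<Longrightarrow>
    (\<integral>\<^sup>+x. g (T x) \<partial>lborel) = ennreal d * (\<integral>\<^sup>+x. g x \<partial>lborel)"
    using nn_integral_lborel_linear[OF T] by metis
  have cT: "continuous_on UNIV T" using T(1) by (simp add: linear_continuous_on linear_linear)
  have [measurable]: "T \<in> borel_measurable borel" by (rule borel_measurable_continuous_onI[OF cT])
  show ?thesis
  proof (rule that[OF d(1)])
    fix K :: "'a set" and G :: "'a \<Rightarrow> real" assume K: "compact K" and G[measurable]: "G \<in> borel_measurable borel" and G0: "\<And>x. 0 \<le> G x"
    have [measurable]: "K \<in> sets borel" using K borel_compact by blast
    have "compact (T ` K)" using K cT by (metis compact_continuous_image continuous_on_subset subset_UNIV)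
    then have [measurable]: "T ` K \<in> sets borel" using borel_compact by blast
    have i: "indicator (T ` K) (T x) = (indicator K x :: real)" for x
      by (simp add: indicator_def inj_image_mem_iff[OF bij_is_inj[OF T(2)]])
    have "(LINT x:K|lborel. G (T x)) = enn2real (\<integral>\<^sup>+x. ennreal (indicator (T ` K) (T x) * G (T x)) \<partial>lborel)"
      unfolding set_lebesgue_integral_def i using G0 by (subst integral_eq_nn_integral) auto
    also have "\<dots> = enn2real (ennreal d * (\<integral>\<^sup>+x. ennreal (indicator (T ` K) x * G x) \<partial>lborel))"
      by (subst d(2)[of "\<lambda>x. ennreal (indicator (T ` K) x * G x)"]) auto
    also have "\<dots> = d * enn2real (\<integral>\<^sup>+x. ennreal (indicator (T ` K) x * G x) \<partial>lborel)"
      using d(1) by (simp add: enn2real_mult)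
    also have "enn2real (\<integral>\<^sup>+x. ennreal (indicator (T ` K) x * G x) \<partial>lborel) = (LINT x:T ` K|lborel. G x)"
      unfolding set_lebesgue_integral_def using G0 by (subst integral_eq_nn_integral) auto
    finally show "(LINT x:K|lborel. G (T x)) = d * (LINT x:T ` K|lborel. G x)" .
  qed
qed

text \<open>The adjoint acts in the same way on both sides: it transforms the argument of the
  support function, and inside the integral it can be moved onto x, where a change of variables
  absorbs it.\<close>

lemma centroid_fixed_linear_image:
  fixes T :: "'a::euclidean_space \<Rightarrow> 'a"
  assumes T: "linear T" "bij T" and K: "centroid_fixed K"
  shows "centroid_fixed (T ` K)"
proof -
  obtain \<gamma> where g: "convex_body K" "origin_symmetric K" "\<And>\<phi>. support_function K \<phi> = \<gamma> * (LINT x:K|lborel. \<bar>\<phi> \<bullet> x\<bar>)"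
    using K unfolding centroid_fixed_def by blast
  obtain d where d: "\<And>K G. compact K \<Longrightarrow> G \<in> borel_measurable borel \<Longrightarrow> (\<And>x. 0 \<le> G x) \<Longrightarrow>
    (LINT x:K|lborel. G (T x)) = d * (LINT x:T ` K|lborel. (G x :: real))"
    using set_integral_linear_image[OF T] by metis
  have cT: "continuous_on UNIV T" using T(1) by (simp add: linear_continuous_on linear_linear)
  have ad: "T x \<bullet> y = x \<bullet> adjoint T y" for x y using adjoint_works[OF T(1)] by (simp add: inner_commute)
  have "support_function (T ` K) \<phi> = (\<gamma> * d) * (LINT x:T ` K|lborel. \<bar>\<phi> \<bullet> x\<bar>)" for \<phi>
  proof -
    have "support_function (T ` K) \<phi> = \<gamma> * (LINT x:K|lborel. \<bar>adjoint T \<phi> \<bullet> x\<bar>)"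
      unfolding support_function_image_adjoint[of T, OF ad] g(3) ..
    also have "(LINT x:K|lborel. \<bar>adjoint T \<phi> \<bullet> x\<bar>) = (LINT x:K|lborel. \<bar>\<phi> \<bullet> T x\<bar>)"
      by (simp add: inner_commute[of _ "_ :: 'a"] flip: ad)
    also have "\<dots> = d * (LINT x:T ` K|lborel. \<bar>\<phi> \<bullet> x\<bar>)"
      by (rule d[OF convex_body_compact[OF g(1)]]) auto
    finally show ?thesis by simp
  qed
  moreover have "convex_body (T ` K)"
    using g(1) T cT unfolding convex_body_def
    by (auto simp: convex_linear_image interior_injective_linear_image bij_is_inj
        intro: compact_continuous_image continuous_on_subset)
  moreover have "origin_symmetric (T ` K)"
    using g(2) T(1) unfolding origin_symmetric_def by (auto simp: linear_neg[symmetric])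
  ultimately show ?thesis unfolding centroid_fixed_def by blast
qed

text \<open>The fixed point \<open>X\<close> of \<open>X \<mapsto> (E + X\<^sup>2) / 2\<close> satisfies \<open>(I - X)\<^sup>2 = I - E\<close>.\<close>
lemma symmetric_square_root:
  fixes E :: "'a::euclidean_space \<Rightarrow>\<^sub>L 'a"
  assumes sym: "\<And>x y. E x \<bullet> y = x \<bullet> E y" and \<eta>: "norm E \<le> \<eta>" "\<eta> \<le> 1/2"
  obtains X :: "'a \<Rightarrow>\<^sub>L 'a" where "norm X \<le> \<eta>" "\<And>x y. X x \<bullet> y = x \<bullet> X y"
    "\<And>x. (x - X x) - X (x - X x) = x - E x"
proof -
  \<comment> \<open>Symmetry is built into the complete set on which the iteration runs, so the
    fixed point inherits it together with the norm bound.\<close>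
  define S where "S = cball 0 \<eta> \<inter> {X :: 'a \<Rightarrow>\<^sub>L 'a. \<forall>x y. X x \<bullet> y = x \<bullet> X y}"
  define \<Psi> where "\<Psi> X = (1/2) *\<^sub>R (E + (X o\<^sub>L X))" for X :: "'a \<Rightarrow>\<^sub>L 'a"
  have \<eta>0: "0 \<le> \<eta>" using \<eta>(1) norm_ge_zero order_trans by blast
  have "closed S" unfolding S_def
    by (intro closed_Int closed_cball closed_Collect_all closed_Collect_eq continuous_intros)
  then have "uniform_space_class.complete S" by (simp add: complete_eq_closed)
  moreover have "S \<noteq> {}"
  proof -
    have "0 \<in> S" using \<eta>0 by (simp add: S_def)
    then show ?thesis by blast
  qed
  moreover have "\<Psi> ` S \<subseteq> S"
  proof
    fix Y assume "Y \<in> \<Psi> ` S"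
    then obtain X :: "'a \<Rightarrow>\<^sub>L 'a" where X: "norm X \<le> \<eta>" "\<And>x y. X x \<bullet> y = x \<bullet> X y" "Y = \<Psi> X" by (auto simp: S_def)
    have "norm (X o\<^sub>L X) \<le> norm X * norm X" by (rule norm_blinfun_compose)
    also have "\<dots> \<le> \<eta> * 1" using X(1) \<eta> \<eta>0 by (intro mult_mono) auto
    finally have "norm (E + (X o\<^sub>L X)) \<le> 2 * \<eta>" using norm_triangle_ineq[of E "X o\<^sub>L X"] \<eta>(1) by linarith
    then have "norm Y \<le> \<eta>" by (simp add: X(3) \<Psi>_def)
    moreover have "Y x \<bullet> y = x \<bullet> Y y" for x y
      unfolding X(3) \<Psi>_def
      by (simp add: blinfun.scaleR_left blinfun.add_left inner_add_left inner_add_right sym X(2))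
    ultimately show "Y \<in> S" by (simp add: S_def)
  qed
  moreover have "\<forall>X\<in>S. \<forall>Y\<in>S. dist (\<Psi> X) (\<Psi> Y) \<le> (1/2) * dist X Y"
  proof (intro ballI)
    fix X Y assume XY: "X \<in> S" "Y \<in> S"
    \<comment> \<open>X and Y need not commute, hence the two-sided splitting of the difference of
      squares. With both norms at most 1/2, the contraction factor is 1/2.\<close>
    have "\<Psi> X - \<Psi> Y = (1/2) *\<^sub>R ((X o\<^sub>L (X - Y)) + ((X - Y) o\<^sub>L Y))"
      by (rule blinfun_eqI) (simp add: \<Psi>_def blinfun.bilinear_simps algebra_simps)
    then have "norm (\<Psi> X - \<Psi> Y) = (1/2) * norm ((X o\<^sub>L (X - Y)) + ((X - Y) o\<^sub>L Y))" by simp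
    also have "norm ((X o\<^sub>L (X - Y)) + ((X - Y) o\<^sub>L Y)) \<le> norm X * norm (X - Y) + norm (X - Y) * norm Y"
      by (intro norm_triangle_le add_mono norm_blinfun_compose)
    also have "\<dots> \<le> (1/2) * norm (X - Y) + norm (X - Y) * (1/2)"
      using XY \<eta> by (intro add_mono mult_mono) (auto simp: S_def)
    finally show "dist (\<Psi> X) (\<Psi> Y) \<le> (1/2) * dist X Y" by (simp add: dist_norm)
  qed
  ultimately have "\<exists>!X\<in>S. \<Psi> X = X"
    by (intro Banach_fix[of S "1/2" \<Psi>]) auto
  then obtain X where X: "X \<in> S" "\<Psi> X = X" by blast
  show ?thesis
  proof (rule that[of X])
    show "norm X \<le> \<eta>" "X x \<bullet> y = x \<bullet> X y" for x y using X(1) by (auto simp: S_def)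
    fix x
    have "X x = (1/2) *\<^sub>R (E x + X (X x))"
      by (subst X(2)[symmetric]) (simp add: \<Psi>_def blinfun.bilinear_simps)
    then have "2 *\<^sub>R X x = 2 *\<^sub>R ((1/2) *\<^sub>R (E x + X (X x)))" by (rule arg_cong)
    then have "2 *\<^sub>R X x = E x + X (X x)" by (simp only: scaleR_scaleR) simp
    then show "(x - X x) - X (x - X x) = x - E x"
      by (simp add: blinfun.diff_right scaleR_2 algebra_simps)
  qed
qed

lemma centroid_fixed_scaleR:
  fixes K :: "'a::euclidean_space set"
  assumes "centroid_fixed K" "r \<noteq> 0"
  shows "centroid_fixed ((*\<^sub>R) r ` K)"
proof (rule centroid_fixed_linear_image)
  show "linear ((*\<^sub>R) r :: 'a \<Rightarrow> 'a)" by (rule linear_scale_self)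
  show "bij ((*\<^sub>R) r :: 'a \<Rightarrow> 'a)"
    using assms(2) by (intro bij_betw_byWitness[where f' = "(*\<^sub>R) (1 / r)"]) auto
qed (rule assms)

section \<open>Isotropic position of a nearly round body\<close>

lemma support_function_near_ball:
  fixes K :: "'a::euclidean_space set"
  assumes K: "convex_body K" and h: "\<And>u. norm u = 1 \<Longrightarrow> \<bar>support_function K u - 1\<bar> \<le> l"
  shows "(1 - l) * norm v \<le> support_function K v" "support_function K v \<le> (1 + l) * norm v"
proof -
  have "support_function K v = norm v * support_function K (sgn v)"
    using support_function_scaleR[OF convex_body_compact[OF K] convex_body_nonempty[OF K], of "norm v" "sgn v"]
    by (cases "v = 0") (simp_all add: sgn_div_norm)
  moreover have "norm v * (1 - l) \<le> norm v * support_function K (sgn v)"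
    "norm v * support_function K (sgn v) \<le> norm v * (1 + l)"
    using h[of "sgn v"] by (cases "v = 0"; auto simp: norm_sgn abs_le_iff intro!: mult_left_mono)+
  ultimately show "(1 - l) * norm v \<le> support_function K v" "support_function K v \<le> (1 + l) * norm v"
    by (simp_all add: mult.commute)
qed

text \<open>The prefactor normalizes the moment form so that for the unit ball it is the squared
  norm. Near the ball the error is linear in l, by the first-order bound on the radial
  power.\<close>

lemma set_integral_inner_square_near_ball:
  obtains C :: real where "C > 0" "\<And>(K :: 'a::euclidean_space set) l a. convex_body K \<Longrightarrow> origin_symmetric K \<Longrightarrow> l \<le> 1 \<Longrightarrow>
      (\<And>u. norm u = 1 \<Longrightarrow> \<bar>support_function K u - 1\<bar> \<le> l) \<Longrightarrow>
      \<bar>a \<bullet> a - (DIM('a) + 2) / unit_ball_vol (DIM('a)) * (LINT x:K|lborel. (a \<bullet> x)\<^sup>2)\<bar> \<le> C * l * (a \<bullet> a)"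
proof -
  obtain C :: real where C: "C > 0" "\<And>(K :: 'a set) l \<theta>. convex_body K \<Longrightarrow> origin_symmetric K \<Longrightarrow> l \<le> 1 \<Longrightarrow>
      (\<And>u. norm u = 1 \<Longrightarrow> \<bar>support_function K u - 1\<bar> \<le> l) \<Longrightarrow> norm \<theta> = 1 \<Longrightarrow> \<bar>radial_power K 2 \<theta> - 1\<bar> \<le> C * l"
    using radial_power_near_1 by metis
  show ?thesis
  proof (rule that[of "DIM('a) * C"])
    show "DIM('a) * C > 0" using C(1) by simp
    fix K :: "'a set" and l and a :: 'a
    assume K: "convex_body K" "origin_symmetric K" and l: "l \<le> 1"
      and h: "\<And>u. norm u = 1 \<Longrightarrow> \<bar>support_function K u - 1\<bar> \<le> l"
    have [measurable]: "K \<in> sets borel" using convex_body_compact[OF K(1)] borel_compact by blast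
    define w where "w = radial_power K 2"
    have wm[measurable]: "w \<in> borel_measurable borel" unfolding w_def by measurable
    have w: "\<bar>w \<theta> - 1\<bar> \<le> C * l" if "norm \<theta> = 1" for \<theta> unfolding w_def by (rule C(2)[OF K l h that])
    define q where "q u = (DIM('a) + 2) / unit_ball_vol (DIM('a)) * (LINT x:K|lborel. (u \<bullet> x)\<^sup>2)" for u
    have unit: "\<bar>1 - q u\<bar> \<le> DIM('a) * C * l" if u: "norm u = 1" for u
    proof -
      have bw: "\<bar>(w x - 1) * (x \<bullet> u)\<^sup>2\<bar> \<le> C * l" if x: "norm x = 1" for x
        by (rule abs_mult_inner_power_le[OF x u w[OF x]])
      have i1: "integrable sphere_measure (\<lambda>x. (x \<bullet> u)\<^sup>2)"
        by (rule integrable_sphere_measure[of _ 1]) (use unit_inner_le[OF _ u] in \<open>auto simp: abs_square_le_1\<close>)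
      have i2: "integrable sphere_measure (\<lambda>x. (w x - 1) * (x \<bullet> u)\<^sup>2)"
        by (rule integrable_sphere_measure[OF _ bw]) measurable
      have "(LINT x:K|lborel. (u \<bullet> x)\<^sup>2) = DIM('a) * unit_ball_vol (DIM('a)) / (DIM('a) + 2) *
          (\<integral>\<^sub>S \<theta>. (u \<bullet> \<theta>)\<^sup>2 * radial_power K 2 \<theta>)"
        using set_integral_polar[OF convex_body_compact[OF K(1)], of "\<lambda>x. (u \<bullet> x)\<^sup>2" 2]
        by (simp add: power_mult_distrib)
      also have "(\<integral>\<^sub>S \<theta>. (u \<bullet> \<theta>)\<^sup>2 * radial_power K 2 \<theta>) = (\<integral>\<^sub>S x. (x \<bullet> u)\<^sup>2 + (w x - 1) * (x \<bullet> u)\<^sup>2)"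
        by (intro Bochner_Integration.integral_cong) (auto simp: w_def inner_commute algebra_simps)
      also have "\<dots> = 1 / DIM('a) + (\<integral>\<^sub>S x. (w x - 1) * (x \<bullet> u)\<^sup>2)"
        using i1 i2 integral_sphere_inner_square[OF u] by simp
      finally have "q u = DIM('a) * (1 / DIM('a) + (\<integral>\<^sub>S x. (w x - 1) * (x \<bullet> u)\<^sup>2))"
        using unit_ball_vol_pos[of "DIM('a)"] by (simp add: q_def less_imp_neq[symmetric] del: unit_ball_vol_pos)
      then have "\<bar>1 - q u\<bar> = DIM('a) * \<bar>\<integral>\<^sub>S x. (w x - 1) * (x \<bullet> u)\<^sup>2\<bar>"
        by (simp add: distrib_left abs_mult)
      also have "\<dots> \<le> DIM('a) * (C * l)" by (intro mult_left_mono abs_integral_sphere_le bw) auto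
      finally show ?thesis by (simp add: mult.assoc)
    qed
    have "\<bar>a \<bullet> a - q a\<bar> \<le> DIM('a) * C * l * (a \<bullet> a)"
    proof (cases "a = 0")
      case False
      have "norm a * (sgn a \<bullet> x) = a \<bullet> x" for x using False by (simp add: sgn_div_norm)
      then have "(LINT x:K|lborel. (a \<bullet> x)\<^sup>2) = (LINT x:K|lborel. (norm a)\<^sup>2 * (sgn a \<bullet> x)\<^sup>2)"
        by (simp only: power_mult_distrib[symmetric])
      then have e: "a \<bullet> a - q a = (a \<bullet> a) * (1 - q (sgn a))"
        by (simp add: q_def power2_norm_eq_inner right_diff_distrib)
      have "(a \<bullet> a) * \<bar>1 - q (sgn a)\<bar> \<le> (a \<bullet> a) * (DIM('a) * C * l)"
        using False by (intro mult_left_mono unit) (auto simp: norm_sgn)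
      then show ?thesis unfolding e abs_mult by (simp add: mult.commute)
    qed (simp add: q_def set_lebesgue_integral_def)
    then show "\<bar>a \<bullet> a - (DIM('a) + 2) / unit_ball_vol (DIM('a)) * (LINT x:K|lborel. (a \<bullet> x)\<^sup>2)\<bar> \<le> DIM('a) * C * l * (a \<bullet> a)"
      by (simp only: q_def)
  qed
qed

text \<open>For a symmetric operator the quadratic form controls the norm, by polarization and the
  parallelogram law.\<close>

lemma norm_symmetric_le:
  fixes E :: "'a::euclidean_space \<Rightarrow>\<^sub>L 'a"
  assumes sym: "\<And>x y. E x \<bullet> y = x \<bullet> E y" and q: "\<And>x. \<bar>x \<bullet> E x\<bar> \<le> \<eta> * (x \<bullet> x)"
  shows "norm E \<le> \<eta>"
proof (rule norm_blinfun_bound)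
  obtain b :: 'a where "b \<in> Basis" using nonempty_Basis by blast
  then show \<eta>: "0 \<le> \<eta>" using q[of b] by (simp add: inner_same_Basis)
  fix a
  show "norm (E a) \<le> \<eta> * norm a"
  proof (cases "E a = 0 \<or> a = 0")
    case False
    \<comment> \<open>The image \<open>E a\<close> rescaled to the length of a: then
      \<open>u \<bullet> E a\<close> is the product of the norms of a and
      \<open>E a\<close>.\<close>
    define u where "u = (norm a / norm (E a)) *\<^sub>R E a"
    have nu: "u \<bullet> u = a \<bullet> a" using False by (simp add: u_def power2_norm_eq_inner[symmetric] power2_eq_square)
    have "4 * (u \<bullet> E a) = (u + a) \<bullet> E (u + a) - (u - a) \<bullet> E (u - a)"
      using sym[of a u] by (simp add: blinfun.bilinear_simps inner_add_left inner_add_right inner_diff_left inner_diff_right inner_commute)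
    also have "\<dots> \<le> \<eta> * ((u + a) \<bullet> (u + a)) + \<eta> * ((u - a) \<bullet> (u - a))"
      using q[of "u + a"] q[of "u - a"] by linarith
    also have "\<dots> = 4 * (\<eta> * (a \<bullet> a))"
      by (simp add: inner_add_left inner_add_right inner_diff_left inner_diff_right inner_commute nu algebra_simps)
    finally have "u \<bullet> E a \<le> \<eta> * (a \<bullet> a)" by simp
    moreover have "u \<bullet> E a = norm a * norm (E a)" using False by (simp add: u_def power2_norm_eq_inner[symmetric] power2_eq_square)
    ultimately have "norm a * norm (E a) \<le> norm a * (\<eta> * norm a)"
      by (simp add: power2_norm_eq_inner[symmetric] power2_eq_square mult_ac)
    then show ?thesis using False by simp
  qed (use \<eta> in auto)
qed

text \<open>\<open>R\<^sup>2\<close> is the normalized moment operator of \<open>K\<close>, so \<open>R\<close> maps an isotropic body onto \<open>K\<close>.\<close>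
lemma isotropic_square_root:
  obtains C :: real where "C > 0" "\<And>(K :: 'a::euclidean_space set) l. convex_body K \<Longrightarrow> origin_symmetric K \<Longrightarrow> 0 \<le> l \<Longrightarrow> C * l \<le> 1/2 \<Longrightarrow>
      l \<le> 1 \<Longrightarrow> (\<And>u. norm u = 1 \<Longrightarrow> \<bar>support_function K u - 1\<bar> \<le> l) \<Longrightarrow>
      \<exists>R \<tau>. linear R \<and> (\<forall>x y. R x \<bullet> y = x \<bullet> R y) \<and> (\<forall>x. norm (R x - x) \<le> C * l * norm x) \<and>
        (\<forall>a. (LINT x:K|lborel. (a \<bullet> x)\<^sup>2) = \<tau> * (norm (R a))\<^sup>2)"
proof -
  define \<kappa> where "\<kappa> = (DIM('a) + 2) / unit_ball_vol (DIM('a))"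
  have \<kappa>: "\<kappa> > 0" unfolding \<kappa>_def by simp
  obtain C :: real where C: "C > 0" "\<And>(K :: 'a set) l a. convex_body K \<Longrightarrow> origin_symmetric K \<Longrightarrow> l \<le> 1 \<Longrightarrow>
      (\<And>u. norm u = 1 \<Longrightarrow> \<bar>support_function K u - 1\<bar> \<le> l) \<Longrightarrow>
      \<bar>a \<bullet> a - \<kappa> * (LINT x:K|lborel. (a \<bullet> x)\<^sup>2)\<bar> \<le> C * l * (a \<bullet> a)"
    unfolding \<kappa>_def using set_integral_inner_square_near_ball[where 'a = 'a] by metis
  show ?thesis
  proof (rule that[OF C(1)])
    fix K :: "'a set" and l
    assume K: "convex_body K" "origin_symmetric K" and l: "0 \<le> l" "C * l \<le> 1/2" "l \<le> 1"
      and h: "\<And>u. norm u = 1 \<Longrightarrow> \<bar>support_function K u - 1\<bar> \<le> l"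
    have cK: "compact K" by (rule convex_body_compact[OF K(1)])
    have int: "integrable lborel (\<lambda>x. indicator K x *\<^sub>R ((a \<bullet> x) *\<^sub>R x))" for a :: 'a
      by (intro borel_integrable_compact cK continuous_intros)
    define m where "m a = (LINT x:K|lborel. (a \<bullet> x) *\<^sub>R x)" for a
    have m_inner: "m a \<bullet> b = (LINT x:K|lborel. (a \<bullet> x) * (b \<bullet> x))" for a b
    proof -
      have "m a \<bullet> b = (\<integral>x. (indicator K x *\<^sub>R ((a \<bullet> x) *\<^sub>R x)) \<bullet> b \<partial>lborel)"
        unfolding m_def set_lebesgue_integral_def by (rule integral_inner_left[symmetric, OF int])
      then show ?thesis by (simp add: set_lebesgue_integral_def inner_commute mult.assoc)
    qed
    have "linear m"
    proof (rule linearI)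
      show "m (a + b) = m a + m b" for a b
        unfolding m_def set_lebesgue_integral_def
        by (subst Bochner_Integration.integral_add[OF int int, symmetric]) (simp add: inner_add_left scaleR_add_left scaleR_add_right)
      show "m (r *\<^sub>R a) = r *\<^sub>R m a" for r a
        unfolding m_def set_lebesgue_integral_def by (simp flip: integral_scaleR_right add: mult_ac)
    qed
    then have "linear (\<lambda>a. a - \<kappa> *\<^sub>R m a)"
      by (intro linear_compose_sub linear_ident linear_compose_scale_right)
    then have bl: "bounded_linear (\<lambda>a. a - \<kappa> *\<^sub>R m a)" by (simp add: linear_linear)
    \<comment> \<open>The deviation of the normalized moment operator from the identity; it is small
      because its quadratic form is.\<close>
    define E where "E = Blinfun (\<lambda>a. a - \<kappa> *\<^sub>R m a)"
    have E: "E a = a - \<kappa> *\<^sub>R m a" for a unfolding E_def by (simp add: bounded_linear_Blinfun_apply[OF bl])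
    have symE: "E x \<bullet> y = x \<bullet> E y" for x y
      using m_inner[of x y] m_inner[of y x] by (simp add: E inner_diff_left inner_diff_right inner_commute mult.commute)
    have mq: "a \<bullet> m a = (LINT x:K|lborel. (a \<bullet> x)\<^sup>2)" for a
      using m_inner[of a a] by (simp add: inner_commute power2_eq_square)
    have "norm E \<le> C * l"
    proof (rule norm_symmetric_le[OF symE])
      fix a
      have "a \<bullet> E a = a \<bullet> a - \<kappa> * (LINT x:K|lborel. (a \<bullet> x)\<^sup>2)"
        by (simp add: E inner_diff_right mq)
      then show "\<bar>a \<bullet> E a\<bar> \<le> C * l * (a \<bullet> a)" using C(2)[OF K l(3) h, of a] by simp
    qed
    then obtain X :: "'a \<Rightarrow>\<^sub>L 'a" where X: "norm X \<le> C * l" "\<And>x y. X x \<bullet> y = x \<bullet> X y"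
      "\<And>x. (x - X x) - X (x - X x) = x - E x"
      using symmetric_square_root[OF symE _ l(2)] by metis
    define R where "R x = x - X x" for x
    have "(LINT x:K|lborel. (a \<bullet> x)\<^sup>2) = (1 / \<kappa>) * (norm (R a))\<^sup>2" for a
    proof -
      have "(norm (R a))\<^sup>2 = R a \<bullet> R a" by (simp add: power2_norm_eq_inner)
      also have "\<dots> = a \<bullet> (R a - X (R a))" using X(2)[of a "R a"] by (simp add: R_def inner_diff_left inner_diff_right)
      also have "R a - X (R a) = \<kappa> *\<^sub>R m a" unfolding R_def X(3) E by simp
      finally show ?thesis using \<kappa> by (simp add: mq)
    qed
    moreover have "linear R" unfolding R_def
      by (intro linear_compose_sub linear_ident bounded_linear.linear blinfun.bounded_linear_right)
    moreover have "R x \<bullet> y = x \<bullet> R y" for x y by (simp add: R_def inner_diff_left inner_diff_right X(2))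
    moreover have "norm (R x - x) \<le> C * l * norm x" for x
    proof -
      have "norm (R x - x) = norm (X x)" by (simp add: R_def)
      also have "\<dots> \<le> norm X * norm x" by (rule norm_blinfun)
      also have "\<dots> \<le> C * l * norm x" using X(1) by (rule mult_right_mono) simp
      finally show ?thesis .
    qed
    ultimately show "\<exists>R \<tau>. linear R \<and> (\<forall>x y. R x \<bullet> y = x \<bullet> R y) \<and> (\<forall>x. norm (R x - x) \<le> C * l * norm x) \<and>
        (\<forall>a. (LINT x:K|lborel. (a \<bullet> x)\<^sup>2) = \<tau> * (norm (R a))\<^sup>2)" by blast
  qed
qed

text \<open>The inverse of \<open>R\<close> brings the body into isotropic position and a dilation
  then normalizes the mean half-width. Both stay close to the identity, so the result is still near
  the ball; rigidity applies, and undoing the maps exhibits the ellipsoid.\<close>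

lemma centroid_fixed_near_ball:
  assumes dim: "2 \<le> DIM('a::euclidean_space)"
  obtains t :: real where "t > 0" "t \<le> 1/4" "\<And>(K :: 'a::euclidean_space set) l. centroid_fixed K \<Longrightarrow> 0 \<le> l \<Longrightarrow> l \<le> t \<Longrightarrow>
      (\<And>u. norm u = 1 \<Longrightarrow> \<bar>support_function K u - 1\<bar> \<le> l) \<Longrightarrow>
      \<exists>U :: 'a \<Rightarrow> 'a. linear U \<and> bij U \<and> K = U ` cball 0 1"
proof -
  obtain s\<^sub>0 where s\<^sub>0: "s\<^sub>0 > 0" "\<And>K :: 'a set. normalized_fixed_point s\<^sub>0 K \<Longrightarrow> K = cball 0 1"
    using ball_rigidity[OF dim] by metis
  obtain C :: real where C: "C > 0" "\<And>(K :: 'a set) l. convex_body K \<Longrightarrow> origin_symmetric K \<Longrightarrow> 0 \<le> l \<Longrightarrow> C * l \<le> 1/2 \<Longrightarrow>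
      l \<le> 1 \<Longrightarrow> (\<And>u. norm u = 1 \<Longrightarrow> \<bar>support_function K u - 1\<bar> \<le> l) \<Longrightarrow>
      \<exists>R \<tau>. linear R \<and> (\<forall>x y. R x \<bullet> y = x \<bullet> R y) \<and> (\<forall>x. norm (R x - x) \<le> C * l * norm x) \<and>
        (\<forall>a. (LINT x:K|lborel. (a \<bullet> x)\<^sup>2) = \<tau> * (norm (R a))\<^sup>2)"
    using isotropic_square_root[where 'a = 'a] by metis
  \<comment> \<open>The normalized support function lies between the reciprocal of \<rho>^2 and
    \<rho>^2, where \<rho> \<le> 1 + 3 t'. For t' \<le> 1/4 its square is at most 1 + 9 t', hence
    the 9.\<close>
  define t' where "t' = min (1/4) (s\<^sub>0 / 9)"
  have t': "t' > 0" "t' \<le> 1/4" "9 * t' \<le> s\<^sub>0" using s\<^sub>0(1) by (auto simp: t'_def)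
  \<comment> \<open>Both l and the operator error \<open>C * l\<close> then stay below t'.\<close>
  define t where "t = t' / (C + 1)"
  have t: "t > 0" "t \<le> t'" "C * t \<le> t'" using C(1) t' by (auto simp: t_def field_simps)
  define \<rho> where "\<rho> = (1 + t') / (1 - t')"
  have \<rho>: "\<rho> \<ge> 1" "\<rho> > 0" "1 / \<rho> = (1 - t') / (1 + t')" using t' by (auto simp: \<rho>_def field_simps)
  have \<rho>2: "\<rho>\<^sup>2 \<le> 1 + s\<^sub>0"
  proof -
    have "\<rho> \<le> 1 + 3 * t'"
    proof -
      have "t' * t' \<le> t' * (1/4)" using t' by (intro mult_left_mono) auto
      then have "1 + t' \<le> (1 + 3 * t') * (1 - t')" using t' by (simp add: algebra_simps)
      then show ?thesis using t' by (simp add: \<rho>_def divide_le_eq)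
    qed
    then have "\<rho>\<^sup>2 \<le> (1 + 3 * t')\<^sup>2" using \<rho> by (intro power_mono) auto
    also have "\<dots> = 1 + 6 * t' + 9 * (t' * t')" by (simp add: power2_eq_square algebra_simps)
    also have "t' * t' \<le> t' * (1/4)" using t' by (intro mult_left_mono) auto
    finally show ?thesis using t' by linarith
  qed
  show ?thesis
  proof (rule that[OF t(1)])
    show "t \<le> 1/4" using t t' by linarith
    fix K :: "'a set" and l :: real
    assume K: "centroid_fixed K" and l: "0 \<le> l" "l \<le> t"
      and h: "\<And>u. norm u = 1 \<Longrightarrow> \<bar>support_function K u - 1\<bar> \<le> l"
    have cb: "convex_body K" "origin_symmetric K" using K by (auto simp: centroid_fixed_def)
    have "C * l \<le> C * t" using C(1) l by simp
    then have Cl: "C * l \<le> t'" using t by linarith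
    have lt: "l \<le> t'" using l t by linarith
    obtain R \<tau> where R: "linear R" "\<And>x y. R x \<bullet> y = x \<bullet> R y" "\<And>x. norm (R x - x) \<le> C * l * norm x"
        "\<And>a. (LINT x:K|lborel. (a \<bullet> x)\<^sup>2) = \<tau> * (norm (R a))\<^sup>2"
      using C(2)[OF cb l(1) _ _ h] Cl lt t' by force
    have R': "(1 - t') * norm x \<le> norm (R x)" "norm (R x) \<le> (1 + t') * norm x" for x
    proof -
      have "C * l * norm x \<le> t' * norm x" using Cl by (rule mult_right_mono) simp
      then have "norm (R x - x) \<le> t' * norm x" using R(3)[of x] by linarith
      moreover have "norm (R x) \<le> norm x + norm (R x - x)" using norm_triangle_sub[of "R x" x] by simp
      moreover have "norm x \<le> norm (R x) + norm (R x - x)"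
        using norm_triangle_sub[of x "R x"] by (simp add: norm_minus_commute)
      ultimately show "(1 - t') * norm x \<le> norm (R x)" "norm (R x) \<le> (1 + t') * norm x"
        by (simp_all add: algebra_simps)
    qed
    have "inj R"
    proof (rule linear_inj_iff_eq_0[OF R(1), THEN iffD2], intro allI impI)
      fix x assume "R x = 0"
      then have "(1 - t') * norm x \<le> 0" using R'(1)[of x] by simp
      then show "x = 0" using t' by (simp add: mult_le_0_iff)
    qed
    then have bR: "bij R" using linear_injective_imp_surjective[OF R(1)] by (simp add: bij_def)
    define T where "T = inv R"
    have RT: "R (T x) = x" "T (R x) = x" for x
      using bR by (auto simp: T_def bij_is_surj surj_f_inv_f bij_is_inj)
    have T: "linear T" "bij T"
      unfolding T_def using inj_linear_imp_inv_linear[OF R(1)] bR by (auto simp: bij_is_inj bij_imp_bij_inv)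
    have T_sym: "T x \<bullet> y = x \<bullet> T y" for x y
      using R(2)[of "T x" "T y"] by (simp add: RT)
    have T': "norm (T x) \<le> norm x / (1 - t')" "norm x / (1 + t') \<le> norm (T x)" for x
      using R'[of "T x"] t' by (auto simp: RT field_simps)
    define K2 where "K2 = T ` K"
    have K2: "centroid_fixed K2" unfolding K2_def by (rule centroid_fixed_linear_image[OF T K])
    then have cb2: "convex_body K2" "origin_symmetric K2" by (auto simp: centroid_fixed_def)
    have h2: "support_function K2 u \<le> \<rho>" "1 / \<rho> \<le> support_function K2 u" if u: "norm u = 1" for u
    proof -
      \<comment> \<open>T is symmetric and hence its own adjoint, so the bounds on the norm of
        \<open>T u\<close> pass directly to the support function.\<close>
      have e: "support_function K2 u = support_function K (T u)"
        unfolding K2_def by (rule support_function_image_adjoint) (rule T_sym)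
      have "support_function K (T u) \<le> (1 + l) * norm (T u)" by (rule support_function_near_ball[OF cb(1) h])
      also have "\<dots> \<le> (1 + t') * (1 / (1 - t'))" using T'(1)[of u] u lt l t' by (intro mult_mono) auto
      finally show "support_function K2 u \<le> \<rho>" by (simp add: e \<rho>_def)
      have "(1 - t') * (1 / (1 + t')) \<le> (1 - l) * norm (T u)" using T'(2)[of u] u lt l t' by (intro mult_mono) auto
      also have "\<dots> \<le> support_function K (T u)" by (rule support_function_near_ball[OF cb(1) h])
      finally show "1 / \<rho> \<le> support_function K2 u" by (simp add: e \<rho>(3))
    qed
    have hm: "support_function K2 \<in> borel_measurable borel"
      by (intro borel_measurable_continuous_onI continuous_support_function convex_body_compact convex_body_nonempty cb2)
    have \<rho>1: "0 < 1 / \<rho>" using \<rho>(2) by simp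
    have hi: "integrable sphere_measure (support_function K2)"
    proof (rule integrable_sphere_measure[OF hm])
      show "\<bar>support_function K2 x\<bar> \<le> \<rho>" if "norm x = 1" for x using h2[OF that] \<rho>1 by linarith
    qed
    have ci: "integrable (sphere_measure :: 'a measure) (\<lambda>_. c)" for c :: real by (rule integrable_sphere_measure[of _ "\<bar>c\<bar>"]) auto
    define A where "A = (\<integral>\<^sub>S x. support_function K2 x)"
    have A: "A \<le> \<rho>" "1 / \<rho> \<le> A"
      using integral_sphere_mono[OF hi ci h2(1)] integral_sphere_mono[OF ci hi h2(2)]
      unfolding A_def integral_sphere_const by auto
    have A0: "A > 0" using A(2) \<rho>1 by linarith
    define K3 where "K3 = (*\<^sub>R) (1 / A) ` K2"
    have K3: "centroid_fixed K3" unfolding K3_def using A0 by (intro centroid_fixed_scaleR K2) auto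
    have h3: "support_function K3 u = support_function K2 u / A" for u
    proof -
      have "support_function K3 u = support_function K2 ((1 / A) *\<^sub>R u)"
        unfolding K3_def by (rule support_function_image_adjoint) simp
      also have "\<dots> = (1 / A) * support_function K2 u"
        using A0 by (intro support_function_scaleR convex_body_compact convex_body_nonempty cb2) auto
      finally show ?thesis by simp
    qed
    have "normalized_fixed_point s\<^sub>0 K3"
      unfolding normalized_fixed_point_def
    proof (intro conjI)
      show "convex_body K3" "origin_symmetric K3" using K3 by (auto simp: centroid_fixed_def)
      show "\<exists>\<gamma>. \<forall>\<phi>. norm \<phi> = 1 \<longrightarrow> support_function K3 \<phi> = \<gamma> * (LINT x:K3|lborel. \<bar>\<phi> \<bullet> x\<bar>)"
        using K3 unfolding centroid_fixed_def by blast
      show "(\<integral>\<^sub>S \<theta>. support_function K3 \<theta>) = 1"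
        unfolding h3 using A0 by (simp add: A_def)
      define S where "S x = (1 / A) *\<^sub>R T x" for x
      have S: "linear S" "bij S"
      proof -
        show l: "linear S" unfolding S_def using T(1) by (rule linear_compose_scale_right)
        show "bij S" using A0 RT linear_scale[OF R(1)] linear_scale[OF T(1)]
          by (intro bij_betw_byWitness[where f' = "\<lambda>x. A *\<^sub>R R x"]) (auto simp: S_def)
      qed
      have K3S: "K3 = S ` K" by (simp add: K3_def K2_def S_def image_image)
      obtain d where d: "d > 0" "\<And>K G. compact K \<Longrightarrow> G \<in> borel_measurable borel \<Longrightarrow> (\<And>x. 0 \<le> G x) \<Longrightarrow>
          (LINT x:K|lborel. G (S x)) = d * (LINT x:S ` K|lborel. (G x :: real))"
        using set_integral_linear_image[OF S] by metis
      have "(LINT x:K3|lborel. (a \<bullet> x)\<^sup>2) = \<tau> / (d * A\<^sup>2)" if a: "norm a = 1" for a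
      proof -
        have "(LINT x:K|lborel. (a \<bullet> S x)\<^sup>2) = d * (LINT x:K3|lborel. (a \<bullet> x)\<^sup>2)"
          unfolding K3S by (rule d(2)[OF convex_body_compact[OF cb(1)]]) auto
        also have "(\<lambda>x. (a \<bullet> S x)\<^sup>2) = (\<lambda>x. ((1 / A) *\<^sub>R T a \<bullet> x)\<^sup>2)"
          by (simp add: S_def T_sym)
        also have "(LINT x:K|lborel. ((1 / A) *\<^sub>R T a \<bullet> x)\<^sup>2) = \<tau> * (norm (R ((1 / A) *\<^sub>R T a)))\<^sup>2" by (rule R(4))
        \<comment> \<open>\<open>R\<close> undoes T, leaving a vector of length 1/A: the second
          moment no longer depends on the direction.\<close>
        also have "R ((1 / A) *\<^sub>R T a) = (1 / A) *\<^sub>R a" by (simp add: linear_scale[OF R(1)] RT)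
        finally show ?thesis using d(1) A0 a by (simp add: field_simps power2_eq_square)
      qed
      then show "\<exists>\<tau>. \<forall>a. norm a = 1 \<longrightarrow> (LINT x:K3|lborel. (a \<bullet> x)\<^sup>2) = \<tau>" by blast
      show "\<forall>\<theta>. norm \<theta> = 1 \<longrightarrow> \<bar>support_function K3 \<theta> - 1\<bar> \<le> s\<^sub>0"
      proof (intro allI impI)
        fix u :: 'a assume u: "norm u = 1"
        have "support_function K2 u / A \<le> \<rho> / (1 / \<rho>)"
          using h2[OF u] A A0 \<rho> \<rho>1 by (intro frac_le) auto
        then have up: "support_function K3 u \<le> \<rho>\<^sup>2" by (simp add: h3 power2_eq_square)
        have "(1 / \<rho>) / \<rho> \<le> support_function K2 u / A"
          using h2[OF u] A A0 \<rho> \<rho>1 by (intro frac_le) auto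
        then have lo: "1 / \<rho>\<^sup>2 \<le> support_function K3 u" by (simp add: h3 power2_eq_square)
        \<comment> \<open>The lower bound follows from the upper one through (1 - s)(1 + s) \<le> 1
          at \<open>s = s\<^sub>0\<close>; if \<open>s\<^sub>0 > 1\<close> the left factor is
          negative.\<close>
        have "(1 - s\<^sub>0) * \<rho>\<^sup>2 \<le> 1"
        proof (cases "s\<^sub>0 \<le> 1")
          case True
          then have "(1 - s\<^sub>0) * \<rho>\<^sup>2 \<le> (1 - s\<^sub>0) * (1 + s\<^sub>0)" using \<rho>2 by (intro mult_left_mono) auto
          also have "\<dots> \<le> 1" by (simp add: algebra_simps)
          finally show ?thesis .
        next
          case False
          then have "(1 - s\<^sub>0) * \<rho>\<^sup>2 \<le> 0" by (simp add: mult_nonpos_nonneg)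
          then show ?thesis by linarith
        qed
        then have "1 - s\<^sub>0 \<le> 1 / \<rho>\<^sup>2" using \<rho>(2) by (simp add: pos_le_divide_eq)
        then show "\<bar>support_function K3 u - 1\<bar> \<le> s\<^sub>0" using up lo \<rho>2 by linarith
      qed
    qed
    then have ball: "K3 = cball 0 1" by (rule s\<^sub>0(2))
    define U where "U x = A *\<^sub>R R x" for x
    have "linear U" unfolding U_def using R(1) by (rule linear_compose_scale_right)
    moreover have "bij U" using A0 RT linear_scale[OF R(1)] linear_scale[OF T(1)]
      by (intro bij_betw_byWitness[where f' = "\<lambda>x. (1 / A) *\<^sub>R T x"]) (auto simp: U_def)
    moreover have "K = U ` cball 0 1"
    proof -
      have "U ` K3 = K"
        unfolding K3_def K2_def image_image U_def using A0 by (simp add: linear_scale[OF R(1)] RT)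
      then show ?thesis unfolding ball by simp
    qed
    ultimately show "\<exists>U :: 'a \<Rightarrow> 'a. linear U \<and> bij U \<and> K = U ` cball 0 1" by blast
  qed
qed

section \<open>From the Banach-Mazur distance to support functions\<close>

text \<open>The origin is the midpoint of an interior point and its reflection, and the interior is
  convex.\<close>

lemma convex_body_symmetric_ball_subset:
  fixes K :: "'a::euclidean_space set"
  assumes K: "convex_body K" "origin_symmetric K"
  obtains r where "r > 0" "cball 0 r \<subseteq> K"
proof -
  have "uminus ` K = K" using K(2) unfolding origin_symmetric_def by (auto simp: image_iff) (metis minus_minus)
  then have sym: "uminus ` interior K = interior K" using interior_negations[of K] by simp
  obtain x where x: "x \<in> interior K" using K(1) by (auto simp: convex_body_def)
  then have "- x \<in> interior K" using sym by blast
  then have "(1/2) *\<^sub>R x + (1/2) *\<^sub>R (- x) \<in> interior K"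
    using K(1) x convex_interior[of K] unfolding convex_body_def by (intro convexD) auto
  then have "0 \<in> interior K" by simp
  then show ?thesis using that by (auto simp: mem_interior_cball)
qed

text \<open>An infimum below 1 + e yields an admissible value below 1 + e, provided that the set is
  non-empty; attainment of the minimum is not involved.\<close>

lemma banach_mazur_near_ball:
  fixes K :: "(real^'n) set"
  assumes K: "convex_body K" "origin_symmetric K" and e: "banach_mazur_distance (cball 0 1) K < 1 + e"
  obtains l and T :: "real^'n^'n" where "0 \<le> l" "l < e" "l < 1" "invertible T"
    "(*\<^sub>R) (1 - l) ` cball 0 1 \<subseteq> (*v) T ` K" "(*v) T ` K \<subseteq> (*\<^sub>R) (1 + l) ` cball 0 1"
proof -
  define S where "S = {(1 + l) / (1 - l) | l. (1 + l) / (1 - l) \<ge> 1 \<and>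
       (\<exists>T :: real^'n^'n. invertible T \<and>
          (*\<^sub>R) (1 - l) ` cball 0 1 \<subseteq> (*v) T ` K \<and> (*v) T ` K \<subseteq> (*\<^sub>R) (1 + l) ` cball 0 1)}"
  obtain r where r: "r > 0" "cball 0 r \<subseteq> K" using convex_body_symmetric_ball_subset[OF K] by metis
  obtain R where R: "R \<ge> r" "\<And>x. x \<in> K \<Longrightarrow> norm x \<le> R"
  proof -
    obtain B where B: "\<And>x. x \<in> K \<Longrightarrow> norm x \<le> B"
      using compact_imp_bounded[OF convex_body_compact[OF K(1)]] by (auto simp: bounded_iff)
    show ?thesis by (rule that[of "max r B"]) (auto intro: order_trans[OF B])
  qed
  have "S \<noteq> {}"
  proof -
    \<comment> \<open>With the body between balls of radii r and R, the dilation by s turns these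
      radii into 1 - l and 1 + l.\<close>
    define l where "l = (R - r) / (R + r)"
    define s where "s = 2 / (R + r)"
    have s: "s > 0" using r R by (simp add: s_def)
    have l: "1 - l = s * r" "1 + l = s * R" using r R by (auto simp: l_def s_def field_simps)
    define T where "T = s *\<^sub>R (mat 1 :: real^'n^'n)"
    have T: "T *v x = s *\<^sub>R x" for x by (simp add: T_def scaleR_matrix_vector_assoc[symmetric])
    have "(*v) T = (*\<^sub>R) s" by (rule ext) (rule T)
    moreover have "bij ((*\<^sub>R) s :: real^'n \<Rightarrow> real^'n)"
      using s by (intro bij_betw_byWitness[where f' = "(*\<^sub>R) (1 / s)"]) auto
    ultimately have "invertible T" by (simp add: invertible_eq_bij)
    moreover have "(*\<^sub>R) (1 - l) ` cball 0 1 \<subseteq> (*v) T ` K"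
    proof
      fix y assume "y \<in> (*\<^sub>R) (1 - l) ` cball (0 :: real^'n) 1"
      then obtain x where x: "norm x \<le> 1" "y = (s * r) *\<^sub>R x" by (auto simp: l)
      then have "r *\<^sub>R x \<in> K" using r by (intro subsetD[OF r(2)]) (simp add: mult_left_le)
      moreover have "y = T *v (r *\<^sub>R x)" unfolding T x by simp
      ultimately show "y \<in> (*v) T ` K" by blast
    qed
    moreover have "(*v) T ` K \<subseteq> (*\<^sub>R) (1 + l) ` cball 0 1"
    proof
      fix y assume "y \<in> (*v) T ` K"
      then obtain x where x: "x \<in> K" "y = s *\<^sub>R x" by (auto simp: T)
      have "y = (1 + l) *\<^sub>R ((1 / R) *\<^sub>R x)" unfolding l x(2) using r R by simp
      moreover have "(1 / R) *\<^sub>R x \<in> cball 0 1" using R(2)[OF x(1)] r R(1) by (simp add: divide_le_eq)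
      ultimately show "y \<in> (*\<^sub>R) (1 + l) ` cball 0 1" by blast
    qed
    moreover have "(1 + l) / (1 - l) \<ge> 1" unfolding l using s r R by simp
    ultimately have "(1 + l) / (1 - l) \<in> S" unfolding S_def by blast
    then show ?thesis by blast
  qed
  moreover have "Inf S < 1 + e" using e unfolding banach_mazur_distance_def S_def .
  ultimately obtain v where v: "v \<in> S" "v < 1 + e" using cInf_lessD by blast
  then obtain l and T :: "real^'n^'n" where l: "(1 + l) / (1 - l) < 1 + e" "(1 + l) / (1 - l) \<ge> 1"
    and T: "invertible T" "(*\<^sub>R) (1 - l) ` cball 0 1 \<subseteq> (*v) T ` K" "(*v) T ` K \<subseteq> (*\<^sub>R) (1 + l) ` cball 0 1"
    unfolding S_def by blast
  \<comment> \<open>At l = 1 the quotient is 0 by the convention for division, and for l > 1 it is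
    negative; both contradict the lower bound 1.\<close>
  have l01: "0 \<le> l" "l < 1" using l(2) by (auto simp: le_divide_eq split: if_splits)
  have "l * l \<ge> 0" by simp
  then have "(1 + l) * (1 - l) \<le> 1 + l" using l01 by (simp add: algebra_simps)
  then have "1 + l \<le> (1 + l) / (1 - l)" using l01 by (simp add: le_divide_eq)
  then have "l < e" using l(1) by linarith
  then show ?thesis using that l01 T by blast
qed

theorem theorem1:
  assumes "CARD('n::finite) \<ge> 3"
  shows "\<exists>\<epsilon>>0. \<forall>K :: (real^'n) set.
    convex_body K \<and> origin_symmetric K \<and>
    banach_mazur_distance (cball 0 1) K < 1 + \<epsilon> \<and>
    (\<exists>c::real. (*\<^sub>R) c ` centroid_body K = K) \<longrightarrow> ellipsoid K"
proof -
  have dim: "2 \<le> DIM(real^'n)" using assms by simp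
  obtain t :: real where t: "t > 0" "t \<le> 1/4" "\<And>(K :: (real^'n) set) l. centroid_fixed K \<Longrightarrow> 0 \<le> l \<Longrightarrow> l \<le> t \<Longrightarrow>
      (\<And>u. norm u = 1 \<Longrightarrow> \<bar>support_function K u - 1\<bar> \<le> l) \<Longrightarrow>
      \<exists>U :: real^'n \<Rightarrow> real^'n. linear U \<and> bij U \<and> K = U ` cball 0 1"
    using centroid_fixed_near_ball[OF dim] by metis
  have "ellipsoid K" if K: "convex_body K" "origin_symmetric K"
    and bm: "banach_mazur_distance (cball 0 1) K < 1 + t" and c: "(*\<^sub>R) c ` centroid_body K = K"
    for K :: "(real^'n) set" and c
  proof -
    obtain l and T :: "real^'n^'n" where l: "0 \<le> l" "l < t" "l < 1" and T: "invertible T"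
      and sub: "(*\<^sub>R) (1 - l) ` cball 0 1 \<subseteq> (*v) T ` K" "(*v) T ` K \<subseteq> (*\<^sub>R) (1 + l) ` cball 0 1"
      using banach_mazur_near_ball[OF K bm] by metis
    have bT: "bij ((*v) T)" using T by (simp add: invertible_eq_bij)
    have fp: "centroid_fixed ((*v) T ` K)"
      by (rule centroid_fixed_linear_image[OF matrix_vector_mul_linear bT centroid_fixedI[OF K c]])
    then have cb: "convex_body ((*v) T ` K)" by (simp add: centroid_fixed_def)
    \<comment> \<open>The two inclusions become the two sides of this bound, because the support
      function of a centred ball is its radius in every unit direction.\<close>
    have "\<bar>support_function ((*v) T ` K) u - 1\<bar> \<le> l" if u: "norm u = 1" for u
    proof -
      have "(1 - l) *\<^sub>R u \<in> (*v) T ` K" using sub(1) u by (auto simp: image_subset_iff)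
      then have "1 - l \<le> support_function ((*v) T ` K) u"
        using support_function_upper[OF convex_body_compact[OF cb], of "(1 - l) *\<^sub>R u" u] u by (simp add: norm_eq_1)
      moreover have "support_function ((*v) T ` K) u \<le> 1 + l"
      proof (rule support_function_least[OF convex_body_nonempty[OF cb]])
        fix x assume "x \<in> (*v) T ` K"
        then have "x \<in> (*\<^sub>R) (1 + l) ` cball 0 1" using sub(2) by blast
        then obtain y where y: "x = (1 + l) *\<^sub>R y" "y \<in> cball 0 1" by (rule imageE)
        have "y \<bullet> u \<le> 1" using norm_cauchy_schwarz[of y u] y(2) u by simp
        then have "(1 + l) * (y \<bullet> u) \<le> (1 + l) * 1" using l by (intro mult_left_mono) auto
        then show "x \<bullet> u \<le> 1 + l" by (simp add: y(1))
      qed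
      ultimately show ?thesis by linarith
    qed
    then obtain U :: "real^'n \<Rightarrow> real^'n" where U: "linear U" "bij U" "(*v) T ` K = U ` cball 0 1"
      using t(3)[OF fp l(1)] l(2) by force
    obtain T' where T': "T ** T' = mat 1" "T' ** T = mat 1" using T unfolding invertible_def by blast
    define S where "S = T' ** matrix U"
    have mU: "matrix U *v x = U x" for x
      using fun_cong[OF matrix_vector_mul(2)[OF U(1)], of x] .
    have "invertible (matrix U)" using U(2) by (simp add: invertible_eq_bij mU[abs_def])
    moreover have "invertible T'" unfolding invertible_def using T' by blast
    ultimately have "invertible S" unfolding S_def by (intro invertible_mult)
    moreover have "K = (*v) S ` cball 0 1"
    proof -
      have "T' *v (T *v x) = x" for x by (simp add: matrix_vector_mul_assoc T')
      then have "K = (*v) T' ` (*v) T ` K" by (simp add: image_image)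
      also have "\<dots> = (*v) S ` cball 0 1"
        unfolding U(3) image_image S_def by (simp add: matrix_vector_mul_assoc[symmetric] mU)
      finally show ?thesis .
    qed
    ultimately show ?thesis unfolding ellipsoid_def by blast
  qed
  then show ?thesis using t(1) by blast
qed


end
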